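(* Let $(R,\mathfrak{m})$ be a two-dimensional complete Noetherian local domain whose residue field $k$ satisfies $[\bar{k}:k]<\infty$, where $\bar{k}$ is the algebraic closure of $k$. Let $A$ be a Krull domain such that $R\subseteq A$ with $\operatorname{tr.deg}_R A>0$. Suppose that there exists $\pi\in\mathfrak{m}$ such that: (I) $A[\pi^{-1}]$ is Noetherian; (II) for every minimal prime ideal $P$ of $\pi A$, $\operatorname{ht}(P\cap R)=1$ and $\operatorname{tr.deg}_{R/(P\cap R)} A/P=0$. Then the following statements are equivalent. (i) $A$ is Noetherian. (ii) $A/\pi A$ is Noetherian. (iii) $\mathfrak{m}A=A$.
   Context: All rings are commutative with unity. For integral domains $S\subseteq B$, $\operatorname{tr.deg}_S B$ denotes the transcendence degree of the field of fractions of $B$ over that of $S$. A minimal prime ideal of $\pi A$ is a prime ideal of $A$ minimal among those containing $\pi A$; $\operatorname{ht}$ denotes height. *)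

theory Defs
  imports "HOL-Algebra.Algebra" "HOL-Library.Extended_Nat"
begin

section \<open>Localization and fraction fields\<close>

text \<open>
  The localization is the set of classes of pairs \<open>(a, s)\<close> under the relation
  \<open>\<exists>u \<in> S. u(at - bs) = 0\<close>, for a multiplicative set \<open>S\<close> that may contain zero divisors or
  even zero. As in \<^const>\<open>FactRing\<close>, the operations take the union over all representatives, which
  is a single class whenever \<open>S\<close> is a submonoid.
\<close>

definition loc_rel :: "('a, 'b) ring_scheme \<Rightarrow> 'a set \<Rightarrow> (('a \<times> 'a) \<times> ('a \<times> 'a)) set"
  where "loc_rel A S =
    {((a, s), (b, t)). a \<in> carrier A \<and> b \<in> carrier A \<and> s \<in> S \<and> t \<in> S \<and>
       (\<exists>u \<in> S. u \<otimes>\<^bsub>A\<^esub> (a \<otimes>\<^bsub>A\<^esub> t \<ominus>\<^bsub>A\<^esub> b \<otimes>\<^bsub>A\<^esub> s) = \<zero>\<^bsub>A\<^esub>)}"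

definition loc_frac :: "('a, 'b) ring_scheme \<Rightarrow> 'a set \<Rightarrow> 'a \<Rightarrow> 'a \<Rightarrow> ('a \<times> 'a) set"
  where "loc_frac A S a s = loc_rel A S `` {(a, s)}"

definition localization :: "('a, 'b) ring_scheme \<Rightarrow> 'a set \<Rightarrow> ('a \<times> 'a) set ring"
  where "localization A S =
    \<lparr>carrier = {loc_frac A S a s | a s. a \<in> carrier A \<and> s \<in> S},
     monoid.mult = (\<lambda>x y. \<Union>(a, s) \<in> x. \<Union>(b, t) \<in> y. loc_frac A S (a \<otimes>\<^bsub>A\<^esub> b) (s \<otimes>\<^bsub>A\<^esub> t)),
     one = loc_frac A S \<one>\<^bsub>A\<^esub> \<one>\<^bsub>A\<^esub>,
     ring.zero = loc_frac A S \<zero>\<^bsub>A\<^esub> \<one>\<^bsub>A\<^esub>,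
     add = (\<lambda>x y. \<Union>(a, s) \<in> x. \<Union>(b, t) \<in> y.
              loc_frac A S (a \<otimes>\<^bsub>A\<^esub> t \<oplus>\<^bsub>A\<^esub> b \<otimes>\<^bsub>A\<^esub> s) (s \<otimes>\<^bsub>A\<^esub> t))\<rparr>"

definition frac_field :: "('a, 'b) ring_scheme \<Rightarrow> ('a \<times> 'a) set ring"
  where "frac_field B = localization B (carrier B - {\<zero>\<^bsub>B\<^esub>})"

text \<open>The fraction field of a subdomain \<open>S\<close> of \<open>B\<close>, as a subfield of the fraction field of \<open>B\<close>.\<close>

definition frac_subfield :: "('a, 'b) ring_scheme \<Rightarrow> 'a set \<Rightarrow> ('a \<times> 'a) set set"
  where "frac_subfield B S =
    {loc_frac B (carrier B - {\<zero>\<^bsub>B\<^esub>}) a s | a s. a \<in> S \<and> s \<in> S \<and> s \<noteq> \<zero>\<^bsub>B\<^esub>}"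


section \<open>Transcendence degree\<close>

text \<open>
  Polynomials over a subfield \<open>K\<close> of \<open>L\<close> in indeterminates indexed by the elements of a set
  \<open>T \<subseteq> L\<close> are the library's indexed polynomials: finitely supported functions from monomials
  (multisets on \<open>T\<close>) to coefficients. Evaluation substitutes every element of \<open>T\<close> for its own
  indeterminate.
\<close>

definition mpoly_eval :: "('a, 'b) ring_scheme \<Rightarrow> ('a multiset \<Rightarrow> 'a) \<Rightarrow> 'a"
  where "mpoly_eval L p =
    (\<Oplus>\<^bsub>L\<^esub>M \<in> {M. p M \<noteq> \<zero>\<^bsub>L\<^esub>}. p M \<otimes>\<^bsub>L\<^esub> (\<Otimes>\<^bsub>L\<^esub>x \<in> set_mset M. x [^]\<^bsub>L\<^esub> count M x))"

definition alg_independent :: "('a, 'b) ring_scheme \<Rightarrow> 'a set \<Rightarrow> 'a set \<Rightarrow> bool"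
  where "alg_independent L K T \<longleftrightarrow>
    (\<forall>p \<in> ring.indexed_pset L T K. mpoly_eval L p = \<zero>\<^bsub>L\<^esub> \<longrightarrow> p = ring.indexed_const L \<zero>\<^bsub>L\<^esub>)"

text \<open>
  The largest cardinality of an algebraically independent subset of \<open>L\<close> over \<open>K\<close>, with all
  infinite cardinalities identified to \<open>\<infinity>\<close>.
\<close>

definition field_trdeg :: "('a, 'b) ring_scheme \<Rightarrow> 'a set \<Rightarrow> enat"
  where "field_trdeg L K =
    Sup {enat (card T) | T. T \<subseteq> carrier L \<and> finite T \<and> alg_independent L K T}"

definition trdeg :: "'a set \<Rightarrow> ('a, 'b) ring_scheme \<Rightarrow> enat"
  where "trdeg S B = field_trdeg (frac_field B) (frac_subfield B S)"


section \<open>Prime ideals, height and dimension\<close>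

definition prime_chain :: "('a, 'b) ring_scheme \<Rightarrow> nat \<Rightarrow> (nat \<Rightarrow> 'a set) \<Rightarrow> bool"
  where "prime_chain R n C \<longleftrightarrow>
    (\<forall>i \<le> n. primeideal (C i) R) \<and> (\<forall>i < n. C i \<subset> C (Suc i))"

definition height :: "('a, 'b) ring_scheme \<Rightarrow> 'a set \<Rightarrow> enat"
  where "height R P = Sup {enat n | n. \<exists>C. prime_chain R n C \<and> C n = P}"

definition krull_dim :: "('a, 'b) ring_scheme \<Rightarrow> enat"
  where "krull_dim R = Sup {enat n | n. \<exists>C. prime_chain R n C}"

definition minimal_prime_over :: "('a, 'b) ring_scheme \<Rightarrow> 'a set \<Rightarrow> 'a set \<Rightarrow> bool"
  where "minimal_prime_over A I P \<longleftrightarrow>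
    primeideal P A \<and> I \<subseteq> P \<and> (\<forall>Q. primeideal Q A \<and> I \<subseteq> Q \<and> Q \<subseteq> P \<longrightarrow> Q = P)"


section \<open>Complete local rings\<close>

definition local_ring :: "('a, 'b) ring_scheme \<Rightarrow> 'a set \<Rightarrow> bool"
  where "local_ring R m \<longleftrightarrow> cring R \<and> {M. maximalideal M R} = {m}"

text \<open>Completeness includes separatedness; \<open>I [^] n\<close> in \<^const>\<open>ideals_set\<close> is the ideal power.\<close>

definition adically_complete :: "('a, 'b) ring_scheme \<Rightarrow> 'a set \<Rightarrow> bool"
  where "adically_complete R I \<longleftrightarrow>
    (\<Inter>k::nat. I [^]\<^bsub>ideals_set R\<^esub> k) = {\<zero>\<^bsub>R\<^esub>} \<and>
    (\<forall>x :: nat \<Rightarrow> 'a.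
       range x \<subseteq> carrier R \<and>
       (\<forall>k::nat. \<exists>N. \<forall>i \<ge> N. \<forall>j \<ge> N. x i \<ominus>\<^bsub>R\<^esub> x j \<in> I [^]\<^bsub>ideals_set R\<^esub> k) \<longrightarrow>
       (\<exists>l \<in> carrier R. \<forall>k::nat. \<exists>N. \<forall>i \<ge> N. x i \<ominus>\<^bsub>R\<^esub> l \<in> I [^]\<^bsub>ideals_set R\<^esub> k))"

text \<open>\<open>[kbar : k] < \<infinity>\<close>; the library embeds \<open>k\<close> into its algebraic closure by constants.\<close>

definition finite_closure_degree :: "('a, 'b) ring_scheme \<Rightarrow> bool"
  where "finite_closure_degree k \<longleftrightarrow>
    ring.finite_dimension (field.alg_closure k)
      (ring.indexed_const k ` carrier k) (carrier (field.alg_closure k))"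


section \<open>Krull domains\<close>

definition dvr :: "('a, 'b) ring_scheme \<Rightarrow> bool"
  where "dvr V \<longleftrightarrow> principal_domain V \<and> (\<exists>m. local_ring V m) \<and> \<not> field V"

definition dvr_of_field :: "('a, 'b) ring_scheme \<Rightarrow> 'a set \<Rightarrow> bool"
  where "dvr_of_field L V \<longleftrightarrow>
    subring V L \<and> dvr (L\<lparr>carrier := V\<rparr>) \<and>
    (\<forall>x \<in> carrier L. \<exists>a \<in> V. \<exists>b \<in> V - {\<zero>\<^bsub>L\<^esub>}. b \<otimes>\<^bsub>L\<^esub> x = a)"

text \<open>
  \<open>A\<close> is the intersection, inside its fraction field \<open>L\<close>, of a family \<open>F\<close> of discrete valuation
  rings of \<open>L\<close> such that every nonzero element of \<open>L\<close> has value zero (is a unit) in all but finitely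
  many members. The family may be empty, the intersection then being \<open>L\<close>; so fields are Krull
  domains.
\<close>

definition krull_domain :: "('a, 'b) ring_scheme \<Rightarrow> bool"
  where "krull_domain A \<longleftrightarrow> domain A \<and>
    (let L = frac_field A in
     \<exists>F. (\<forall>V \<in> F. dvr_of_field L V) \<and>
         (\<lambda>a. loc_frac A (carrier A - {\<zero>\<^bsub>A\<^esub>}) a \<one>\<^bsub>A\<^esub>) ` carrier A
           = {x \<in> carrier L. \<forall>V \<in> F. x \<in> V} \<and>
         (\<forall>x \<in> carrier L - {\<zero>\<^bsub>L\<^esub>}. finite {V \<in> F. x \<notin> Units (L\<lparr>carrier := V\<rparr>)}))"

end

(* (iii) implies (i): a prime of A strictly above a minimal prime P of pi A contains an element of R
   outside P, because A/P is algebraic over R/(P \<inter> R); as P \<inter> R has height one in the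
   two-dimensional R, such a prime contains m. So mA = A makes all minimal primes of pi A maximal.
   There are finitely many of them and A localizes to a discrete valuation ring at each, so an ideal
   that is finitely generated after inverting pi is finitely generated.

   (ii) implies (iii): suppose mA is proper. At each minimal prime of pi A the Krull-Akizuki argument
   turns an algebraic relation into one with a unit coefficient, so each A/Q with Q a prime over mA
   is algebraic over k, hence finite over k because the algebraic closure of k is. By Noetherian
   induction A/mA is finite over R, say generated by us. Completeness of R together with Krull's
   intersection theorem in A/pi A lifts this to A = R us, up to elements divisible by all powers of
   pi after multiplication by some 1 - e with e in mA; a valuation centered inside a maximal ideal
   over mA shows that such elements vanish. A finite R-module has no element transcendental over R,
   a contradiction. *)

theory Submission
  imports Defs
begin

section \<open>Finitely generated ideals\<close>

text \<open>While (ii) is in force, \<open>A\<close> itself is not known to be Noetherian; only its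
  ideals containing \<pi> are finitely generated. This is why several lemmas carry a base ideal
  \<open>I0\<close> and assume finite generation only above it. Dimension two enters through
  lengths: for a minimal prime P of \<pi>A the only prime of R strictly above P \<inter> R is m, so
  R/(P \<inter> R) becomes a ring of finite length modulo any d outside P, and this length is the
  constant in the pigeonhole argument. The factors 1 - e cannot be avoided at that stage because mA
  need not lie in the Jacobson radical of \<open>A\<close>, so Krull's intersection theorem gives
  vanishing only up to such a factor. Positive transcendence degree speaks of fractions a/b, whereas
  the finite module lies in \<open>A\<close>; homogeneous forms in a and b bridge the gap. The
  height condition in (II) also excludes \<pi> = 0.\<close>

lemma (in cring) exists_maximalideal_containing:
  assumes "ideal I R" "I \<noteq> carrier R"
  obtains M where "maximalideal M R" "I \<subseteq> M"
proof -
  have proper: "\<one> \<notin> J" if "ideal J R" "J \<noteq> carrier R" for J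
    using ideal.one_imp_carrier[OF that(1)] that(2) by blast
  let ?P = "{J. ideal J R \<and> I \<subseteq> J \<and> \<one> \<notin> J}"
  have "\<exists>M\<in>?P. \<forall>J\<in>?P. M \<subseteq> J \<longrightarrow> J = M"
  proof (rule subset_Zorn_nonempty)
    show "?P \<noteq> {}" using assms proper by blast
  next
    fix C assume C: "C \<noteq> {}" "subset.chain ?P C"
    have "subset.chain {I. ideal I R} C"
      using C(2) unfolding pred_on.chain_def by blast
    from chain_Union_is_ideal[OF this] C show "\<Union>C \<in> ?P"
      unfolding pred_on.chain_def by auto
  qed
  then obtain M where M: "ideal M R" "I \<subseteq> M" "\<one> \<notin> M"
    "\<And>J. ideal J R \<Longrightarrow> I \<subseteq> J \<Longrightarrow> \<one> \<notin> J \<Longrightarrow> M \<subseteq> J \<Longrightarrow> J = M" by auto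
  have "maximalideal M R"
  proof (rule maximalidealI)
    fix J assume "ideal J R" "M \<subseteq> J" "J \<subseteq> carrier R"
    then show "J = M \<or> J = carrier R" using M proper[of J] by blast
  qed (use M in auto)
  with M(2) show thesis by (rule that[rotated -1])
qed

definition fg_ideal :: "('a, 'b) ring_scheme \<Rightarrow> 'a set \<Rightarrow> bool"
  where "fg_ideal R J \<longleftrightarrow> (\<exists>S \<subseteq> carrier R. finite S \<and> J = genideal R S)"

lemma noetherian_ring_fg: "noetherian_ring R \<Longrightarrow> ideal J R \<Longrightarrow> fg_ideal R J"
  unfolding fg_ideal_def using noetherian_ring.finetely_gen by blast

text \<open>The union of a chain is generated by finitely many elements, which already lie in one
  member. Finite generation is asked only above \<open>I\<close>: an ideal containing \<pi> serves
  the ring \<open>A\<close>, and \<open>I = {}\<close> serves a Noetherian ring.\<close>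

lemma (in ring) maximal_condition:
  assumes fg: "\<And>J. ideal J R \<Longrightarrow> I \<subseteq> J \<Longrightarrow> fg_ideal R J"
    and C: "C \<noteq> {}" "\<And>J. J \<in> C \<Longrightarrow> ideal J R \<and> I \<subseteq> J"
  obtains M where "M \<in> C" "\<And>J. J \<in> C \<Longrightarrow> M \<subseteq> J \<Longrightarrow> J = M"
proof -
  have "\<exists>M\<in>C. \<forall>J\<in>C. M \<subseteq> J \<longrightarrow> J = M"
  proof (rule subset_Zorn_nonempty[OF C(1)])
    fix K assume K: "K \<noteq> {}" "subset.chain C K"
    then have KC: "K \<subseteq> C" and tot: "\<And>x y. x \<in> K \<Longrightarrow> y \<in> K \<Longrightarrow> x \<subseteq> y \<or> y \<subseteq> x"
      unfolding pred_on.chain_def by auto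
    have "subset.chain {I. ideal I R} K"
      using K(2) C(2) unfolding pred_on.chain_def by blast
    from chain_Union_is_ideal[OF this] K(1) have "ideal (\<Union>K) R" by simp
    moreover have "I \<subseteq> \<Union>K" using K(1) KC C(2) by blast
    ultimately obtain S where S: "S \<subseteq> carrier R" "finite S" "\<Union>K = Idl S"
      using fg unfolding fg_ideal_def by meson
    have "\<exists>J\<in>K. T \<subseteq> J" if "finite T" "T \<subseteq> \<Union>K" for T
      using that
    proof (induct T)
      case empty then show ?case using K(1) by blast
    next
      case (insert t T)
      then obtain J J' where "J \<in> K" "T \<subseteq> J" "J' \<in> K" "t \<in> J'" by auto
      with tot[of J J'] show ?case by blast
    qed
    from this[OF S(2)] genideal_self[OF S(1)] S(3) obtain J where J: "J \<in> K" "S \<subseteq> J" by auto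
    then have "Idl S \<subseteq> J" using genideal_minimal C(2) KC by (metis subsetD)
    then have "\<Union>K = J" using J S(3) by auto
    then show "\<Union>K \<in> C" using J KC by auto
  qed
  then show thesis using that by blast
qed

text \<open>Lifted generators of the image of \<open>J\<close>, together with \<open>a\<close>,
  generate \<open>J\<close>. This is the form in which (ii) is used.\<close>

lemma (in cring) fg_ideal_of_quotient:
  assumes noeth: "noetherian_ring (R Quot (PIdl a))" and a: "a \<in> carrier R"
    and J: "ideal J R" "PIdl a \<subseteq> J"
  shows "fg_ideal R J"
proof -
  have idI: "ideal (PIdl a) R" using a by (rule cgenideal_ideal)
  interpret I: ideal "PIdl a" R by (rule idI)
  interpret h: ring_hom_ring R "R Quot (PIdl a)" "(+>) (PIdl a)"
    by (rule I.rcos_ring_hom_ring)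
  have "ideal ((+>) (PIdl a) ` J) (R Quot (PIdl a))"
    using ring_ideal_imp_quot_ideal[OF idI J(1)] .
  from noetherian_ring_fg[OF noeth this] obtain T where T: "finite T"
    "T \<subseteq> carrier (R Quot (PIdl a))" "(+>) (PIdl a) ` J = genideal (R Quot (PIdl a)) T"
    unfolding fg_ideal_def by blast
  have "T \<subseteq> (+>) (PIdl a) ` J" using T(3) h.S.genideal_self[OF T(2)] by simp
  then obtain S where S: "S \<subseteq> J" "finite S" "T = (+>) (PIdl a) ` S"
    using T(1) by (meson finite_subset_image)
  have Jc: "J \<subseteq> carrier R" using ideal.Icarr[OF J(1)] by blast
  then have Sc: "insert a S \<subseteq> carrier R" using S(1) a by blast
  let ?G = "Idl (insert a S)"
  have G: "ideal ?G R" by (rule genideal_ideal[OF Sc])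
  have inc: "insert a S \<subseteq> ?G" by (rule genideal_self[OF Sc])
  have IG: "PIdl a \<subseteq> ?G" by (rule cgenideal_minimal[OF G]) (use inc in auto)
  have aJ: "a \<in> J" using J(2) cgenideal_self[OF a] by blast
  have GJ: "?G \<subseteq> J" by (rule genideal_minimal[OF J(1)]) (use S(1) aJ in auto)
  have "ideal ((+>) (PIdl a) ` ?G) (R Quot (PIdl a))"
    using ring_ideal_imp_quot_ideal[OF idI G] .
  then have sub: "(+>) (PIdl a) ` J \<subseteq> (+>) (PIdl a) ` ?G"
    unfolding T(3) by (rule h.S.genideal_minimal) (use S(3) inc in auto)
  have "J \<subseteq> ?G"
  proof
    fix x assume x: "x \<in> J"
    then obtain y where y: "y \<in> ?G" "PIdl a +> x = PIdl a +> y" using sub by blast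
    have yc: "y \<in> carrier R" "x \<in> carrier R" using y GJ Jc x by auto
    have "x \<ominus> y \<in> PIdl a" using quotient_eq_iff_same_a_r_cos[OF idI yc(2,1)] y(2) by simp
    then have "(x \<ominus> y) \<oplus> y \<in> ?G" using IG y(1) G by (simp add: additive_subgroup.a_closed ideal.axioms(1) subset_iff)
    moreover have "(x \<ominus> y) \<oplus> y = x" using yc by algebra
    ultimately show "x \<in> ?G" by simp
  qed
  then show ?thesis unfolding fg_ideal_def using GJ Sc S(2) by blast
qed

lemma (in cring) noetherian_quotient:
  assumes noeth: "noetherian_ring R" and I: "ideal I R"
  shows "noetherian_ring (R Quot I)"
proof -
  interpret I: ideal I R by (rule I)
  interpret h: ring_hom_ring R "R Quot I" "(+>) I" by (rule I.rcos_ring_hom_ring)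
  have surj: "\<exists>x\<in>carrier R. y = I +> x" if "y \<in> carrier (R Quot I)" for y
    using that unfolding FactRing_def A_RCOSETS_def' by auto
  show ?thesis
  proof (rule h.S.noetherian_ringI)
    fix J assume J: "ideal J (R Quot I)"
    have Jc: "J \<subseteq> carrier (R Quot I)" using ideal.Icarr[OF J] by blast
    have id: "ideal {r \<in> carrier R. I +> r \<in> J} R" using h.ideal_vimage[OF J] .
    from noetherian_ring_fg[OF noeth this] obtain S where S: "S \<subseteq> carrier R" "finite S"
      "{r \<in> carrier R. I +> r \<in> J} = Idl S" unfolding fg_ideal_def by blast
    let ?T = "(+>) I ` S"
    have T: "?T \<subseteq> carrier (R Quot I)" using S(1) by auto
    have "?T \<subseteq> J" using S(3) genideal_self[OF S(1)] by blast
    then have 1: "genideal (R Quot I) ?T \<subseteq> J" by (rule h.S.genideal_minimal[OF J])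
    have "ideal {r \<in> carrier R. I +> r \<in> genideal (R Quot I) ?T} R"
      using h.ideal_vimage[OF h.S.genideal_ideal[OF T]] .
    then have "Idl S \<subseteq> {r \<in> carrier R. I +> r \<in> genideal (R Quot I) ?T}"
      by (rule genideal_minimal) (use S(1) h.S.genideal_self[OF T] in auto)
    then have "J \<subseteq> genideal (R Quot I) ?T" using surj Jc S(3) by blast
    with 1 show "\<exists>A\<subseteq>carrier (R Quot I). finite A \<and> J = genideal (R Quot I) A"
      using T S(2) by blast
  qed
qed

section \<open>Associated primes and powers of ideals\<close>

lemma (in cring) ideal_of_closed:
  assumes "I \<subseteq> carrier R" "\<zero> \<in> I" "\<And>x y. x \<in> I \<Longrightarrow> y \<in> I \<Longrightarrow> x \<oplus> y \<in> I"
    and mult: "\<And>d x. d \<in> carrier R \<Longrightarrow> x \<in> I \<Longrightarrow> d \<otimes> x \<in> I"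
  shows "ideal I R"
proof (rule idealI[OF ring_axioms])
  show "subgroup I (add_monoid R)"
  proof (rule add.subgroupI)
    fix x assume x: "x \<in> I"
    then have "\<ominus> x = (\<ominus> \<one>) \<otimes> x" using assms(1) by (simp add: l_minus subset_iff)
    then show "\<ominus> x \<in> I" using mult[of "\<ominus> \<one>" x] x by simp
  qed (use assms in auto)
next
  fix a x assume "a \<in> I" "x \<in> carrier R"
  moreover from this have "a \<otimes> x = x \<otimes> a" using assms(1) by (intro m_comm) auto
  ultimately show "x \<otimes> a \<in> I" "a \<otimes> x \<in> I" using mult[of x a] by auto
qed

text \<open>A maximal one among the annihilators of nonzero classes modulo \<open>I\<close> is
  prime: the annihilator of a nonzero \<open>b \<otimes> w\<close> contains that of \<open>w\<close>
  and so equals it. Such a \<open>w\<close> supplies the next simple layer of a chain.\<close>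

lemma (in cring) exists_prime_annihilator:
  assumes noeth: "noetherian_ring R" and I: "ideal I R" "I \<noteq> carrier R"
  obtains w where "w \<in> carrier R" "w \<notin> I" "primeideal {x \<in> carrier R. x \<otimes> w \<in> I} R"
proof -
  interpret I: ideal I R by (rule I)
  let ?an = "\<lambda>w. {x \<in> carrier R. x \<otimes> w \<in> I}"
  let ?C = "?an ` (carrier R - I)"
  have an_ideal: "ideal (?an w) R" if "w \<in> carrier R" for w
    using that by (intro ideal_of_closed) (auto simp: l_distr m_assoc I.I_l_closed)
  have "\<one> \<notin> I" using I.one_imp_carrier I(2) by blast
  then have ne: "?C \<noteq> {}" by blast
  obtain M where M: "M \<in> ?C" "\<And>J. J \<in> ?C \<Longrightarrow> M \<subseteq> J \<Longrightarrow> J = M"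
    by (rule maximal_condition[of "{}" ?C])
      (use ne noetherian_ring_fg[OF noeth] an_ideal in auto)
  then obtain w where w: "w \<in> carrier R" "w \<notin> I" "M = ?an w" by blast
  have "primeideal (?an w) R"
  proof (rule primeidealI[OF an_ideal[OF w(1)] cring_axioms])
    have "\<one> \<notin> ?an w" using w by simp
    then show "carrier R \<noteq> ?an w" by blast
  next
    fix a b assume ab: "a \<in> carrier R" "b \<in> carrier R" "a \<otimes> b \<in> ?an w"
    show "a \<in> ?an w \<or> b \<in> ?an w"
    proof (cases "b \<otimes> w \<in> I")
      case False
      have "?an w \<subseteq> ?an (b \<otimes> w)" using ab w(1) by (auto simp: m_lcomm[of _ b w] I.I_l_closed)
      with M(2)[of "?an (b \<otimes> w)"] w False ab have "?an (b \<otimes> w) = ?an w" by auto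
      with ab w show ?thesis by (auto simp: m_assoc)
    qed (use ab in auto)
  qed
  with w that show thesis by blast
qed

lemma (in cring) ideal_prod_subset:
  assumes "ideal K R" "\<And>i j. i \<in> I \<Longrightarrow> j \<in> J \<Longrightarrow> i \<otimes> j \<in> K"
  shows "ideal_prod R I J \<subseteq> K"
proof
  fix x assume "x \<in> ideal_prod R I J"
  then show "x \<in> K" by induct (use assms additive_subgroup.a_closed[OF ideal.axioms(1)[OF assms(1)]] in auto)
qed

text \<open>The powers in \<open>adically_complete\<close> are taken in the monoid
  \<open>ideals_set R\<close>; these equations translate them into
  \<open>ideal_prod\<close>.\<close>

lemma (in cring) ideal_pow:
  assumes "ideal J R"
  shows "J [^]\<^bsub>ideals_set R\<^esub> (0::nat) = carrier R"
    and "J [^]\<^bsub>ideals_set R\<^esub> Suc n = ideal_prod R (J [^]\<^bsub>ideals_set R\<^esub> n) J"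
    and "ideal (J [^]\<^bsub>ideals_set R\<^esub> n) R"
    and "J [^]\<^bsub>ideals_set R\<^esub> (n + k) = ideal_prod R (J [^]\<^bsub>ideals_set R\<^esub> n) (J [^]\<^bsub>ideals_set R\<^esub> k)"
proof -
  interpret S: comm_monoid "ideals_set R" by (rule ideals_set_is_comm_monoid)
  have J: "J \<in> carrier (ideals_set R)" using assms unfolding ideals_set_def by simp
  show "J [^]\<^bsub>ideals_set R\<^esub> (0::nat) = carrier R" unfolding S.nat_pow_0 by (simp add: ideals_set_def)
  show "J [^]\<^bsub>ideals_set R\<^esub> Suc n = ideal_prod R (J [^]\<^bsub>ideals_set R\<^esub> n) J"
    unfolding S.nat_pow_Suc by (simp add: ideals_set_def)
  show "ideal (J [^]\<^bsub>ideals_set R\<^esub> n) R" using S.nat_pow_closed[OF J, of n] unfolding ideals_set_def by simp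
  show "J [^]\<^bsub>ideals_set R\<^esub> (n + k) = ideal_prod R (J [^]\<^bsub>ideals_set R\<^esub> n) (J [^]\<^bsub>ideals_set R\<^esub> k)"
    unfolding S.nat_pow_mult[OF J, symmetric] by (simp add: ideals_set_def)
qed

text \<open>\<open>line_extension\<close>, one step of the library's linear span, doubles as the
  ideal \<open>M + R a\<close>.\<close>

lemma (in cring) ideal_add_principal:
  assumes M: "ideal M R" and a: "a \<in> carrier R"
  shows "ideal (line_extension (carrier R) a M) R" "M \<subseteq> line_extension (carrier R) a M"
    "a \<in> line_extension (carrier R) a M"
proof -
  interpret M: ideal M R by (rule M)
  show "M \<subseteq> line_extension (carrier R) a M"
  proof
    fix i assume "i \<in> M"
    then have "i = \<zero> \<otimes> a \<oplus> i" using a M.Icarr by simp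
    then show "i \<in> line_extension (carrier R) a M" unfolding line_extension_mem_iff using \<open>i \<in> M\<close> by blast
  qed
  have "a = \<one> \<otimes> a \<oplus> \<zero>" using a by simp
  then show "a \<in> line_extension (carrier R) a M" unfolding line_extension_mem_iff using M.zero_closed by blast
  show "ideal (line_extension (carrier R) a M) R" (is "ideal ?J R")
  proof (rule ideal_of_closed)
    show "?J \<subseteq> carrier R" using a M.Icarr by (auto simp: line_extension_mem_iff)
    show "\<zero> \<in> ?J" using \<open>M \<subseteq> ?J\<close> M.zero_closed by blast
  next
    fix x y assume "x \<in> ?J" "y \<in> ?J"
    then obtain c i e j where *: "c \<in> carrier R" "i \<in> M" "x = c \<otimes> a \<oplus> i" "e \<in> carrier R" "j \<in> M" "y = e \<otimes> a \<oplus> j"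
      unfolding line_extension_mem_iff by blast
    have "x \<oplus> y = (c \<oplus> e) \<otimes> a \<oplus> (i \<oplus> j)" unfolding *(3,6) using * a M.Icarr[OF *(2)] M.Icarr[OF *(5)] by algebra
    then show "x \<oplus> y \<in> ?J" unfolding line_extension_mem_iff using M.a_closed[OF *(2,5)] * by blast
  next
    fix d x assume d: "d \<in> carrier R" and "x \<in> ?J"
    then obtain c i where *: "c \<in> carrier R" "i \<in> M" "x = c \<otimes> a \<oplus> i" unfolding line_extension_mem_iff by blast
    have "d \<otimes> x = (d \<otimes> c) \<otimes> a \<oplus> d \<otimes> i" unfolding *(3) using * a M.Icarr[OF *(2)] d by algebra
    then show "d \<otimes> x \<in> ?J" unfolding line_extension_mem_iff using M.I_l_closed[OF *(2) d] m_closed[OF d *(1)] by blast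
  qed
qed

text \<open>An ideal over \<open>M\<close> that is maximal among those containing no power of
  \<open>J\<close> is prime, so it contains \<open>J\<close>, which is absurd.\<close>

lemma (in cring) power_subset_of_primes:
  assumes fg: "\<And>K. ideal K R \<Longrightarrow> I0 \<subseteq> K \<Longrightarrow> fg_ideal R K"
    and M: "ideal M R" "I0 \<subseteq> M" and J: "ideal J R"
    and primes: "\<And>Q. primeideal Q R \<Longrightarrow> M \<subseteq> Q \<Longrightarrow> J \<subseteq> Q"
  shows "\<exists>n::nat. J [^]\<^bsub>ideals_set R\<^esub> n \<subseteq> M"
proof (rule ccontr)
  let ?pw = "\<lambda>n::nat. J [^]\<^bsub>ideals_set R\<^esub> n"
  assume no: "\<not> ?thesis"
  let ?C = "{K. ideal K R \<and> M \<subseteq> K \<and> \<not> (\<exists>n. ?pw n \<subseteq> K)}"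
  have "?C \<noteq> {}" using M no by blast
  then obtain K where K: "K \<in> ?C" "\<And>K'. K' \<in> ?C \<Longrightarrow> K \<subseteq> K' \<Longrightarrow> K' = K"
    by (rule maximal_condition[of I0 ?C, rotated]) (use fg M(2) in auto)
  then have Ki: "ideal K R" and MK: "M \<subseteq> K" and nK: "\<And>n. \<not> ?pw n \<subseteq> K" by auto
  interpret K: ideal K R by (rule Ki)
  have ne: "carrier R \<noteq> K" using nK[of 0] ideal_pow(1)[OF J] by blast
  have big: "\<exists>n. ?pw n \<subseteq> line_extension (carrier R) a K" if a: "a \<in> carrier R" "a \<notin> K" for a
    using K(2)[of "line_extension (carrier R) a K"] ideal_add_principal[OF Ki a(1)] MK a(2) by blast
  have "primeideal K R"
  proof (rule primeidealI[OF Ki cring_axioms ne])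
    fix a b assume ab: "a \<in> carrier R" "b \<in> carrier R" "a \<otimes> b \<in> K"
    show "a \<in> K \<or> b \<in> K"
    proof (rule ccontr)
      assume "\<not> ?thesis"
      then have nab: "a \<notin> K" "b \<notin> K" by auto
      obtain n where "?pw n \<subseteq> line_extension (carrier R) a K" using big[OF ab(1) nab(1)] by (elim exE)
      moreover obtain k where "?pw k \<subseteq> line_extension (carrier R) b K" using big[OF ab(2) nab(2)] by (elim exE)
      ultimately have nk: "?pw n \<subseteq> line_extension (carrier R) a K" "?pw k \<subseteq> line_extension (carrier R) b K" .
      \<comment> \<open>An element of \<open>K + R a\<close> times one of \<open>K + R b\<close>
        lies in \<open>K\<close>, because \<open>a \<otimes> b\<close> does.\<close>
      have "?pw (n + k) \<subseteq> K" unfolding ideal_pow(4)[OF J]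
      proof (rule ideal_prod_subset[OF Ki])
        fix i j assume "i \<in> ?pw n" "j \<in> ?pw k"
        then have "i \<in> line_extension (carrier R) a K" "j \<in> line_extension (carrier R) b K" using nk by auto
        then obtain c u d v where *: "c \<in> carrier R" "u \<in> K" "i = c \<otimes> a \<oplus> u" "d \<in> carrier R" "v \<in> K" "j = d \<otimes> b \<oplus> v"
          unfolding line_extension_mem_iff by blast
        have uv: "u \<in> carrier R" "v \<in> carrier R" using * K.Icarr by auto
        have "i \<otimes> j = (c \<otimes> d) \<otimes> (a \<otimes> b) \<oplus> ((d \<otimes> b \<oplus> v) \<otimes> u \<oplus> (c \<otimes> a) \<otimes> v)"
          unfolding *(3,6) using *(1,4) ab(1,2) uv by algebra
        also have "\<dots> \<in> K"
          by (intro K.a_closed K.I_l_closed[OF ab(3)] K.I_l_closed[OF *(2)] K.I_l_closed[OF *(5)])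
            (use * ab uv in auto)
        finally show "i \<otimes> j \<in> K" .
      qed
      then show False using nK by blast
    qed
  qed
  then have "J \<subseteq> K" by (rule primes[OF _ MK])
  moreover have "?pw 1 \<subseteq> J" using ideal_pow(2)[OF J, of 0] ideal_pow(1)[OF J] ideal_prod_subset[OF J, of "carrier R" J] ideal.I_l_closed[OF J] by auto
  ultimately show False using nK[of 1] by blast
qed

text \<open>Elementwise nilpotency modulo \<open>M\<close> puts \<open>J\<close> into every prime
  over \<open>M\<close>; finite generation then makes the exponent uniform.\<close>

lemma (in cring) power_subset_of_nil:
  assumes fg: "\<And>K. ideal K R \<Longrightarrow> I0 \<subseteq> K \<Longrightarrow> fg_ideal R K"
    and M: "ideal M R" "I0 \<subseteq> M" and J: "ideal J R"
    and nil: "\<And>e. e \<in> J \<Longrightarrow> \<exists>n::nat. e [^] n \<in> M"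
  shows "\<exists>n::nat. J [^]\<^bsub>ideals_set R\<^esub> n \<subseteq> M"
proof (rule power_subset_of_primes[OF fg M J])
  fix Q assume Q: "primeideal Q R" "M \<subseteq> Q"
  interpret Q: primeideal Q R by (rule Q)
  show "J \<subseteq> Q"
  proof
    fix e assume e: "e \<in> J"
    then have ec: "e \<in> carrier R" using ideal.Icarr[OF J] by auto
    obtain n :: nat where "e [^] n \<in> Q" using nil[OF e] Q(2) by blast
    then show "e \<in> Q"
    proof (induct n)
      case 0 then show ?case using Q.I_notcarr Q.one_imp_carrier by simp
    next
      case (Suc n) then show ?case using Q.I_prime[of "e [^] n" e] ec by auto
    qed
  qed
qed

text \<open>The principal case: some power of the ideal generated by \<open>d\<close> lies in
  \<open>I\<close>, and it contains the same power of \<open>d\<close>.\<close>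

lemma (in cring) power_mem_of_primes:
  assumes noeth: "noetherian_ring R" and I: "ideal I R" and d: "d \<in> carrier R"
    and primes: "\<And>Q. primeideal Q R \<Longrightarrow> I \<subseteq> Q \<Longrightarrow> d \<in> Q"
  shows "\<exists>n::nat. d [^] n \<in> I"
proof -
  note J = cgenideal_ideal[OF d]
  have "PIdl d \<subseteq> Q" if "primeideal Q R" "I \<subseteq> Q" for Q
    by (rule cgenideal_minimal[OF primeideal.axioms(1)[OF that(1)] primes[OF that]])
  then obtain n :: nat where "PIdl d [^]\<^bsub>ideals_set R\<^esub> n \<subseteq> I"
    using power_subset_of_primes[OF noetherian_ring_fg[OF noeth] I order_refl J] by blast
  moreover have "d [^] k \<in> PIdl d [^]\<^bsub>ideals_set R\<^esub> k" for k :: nat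
  proof (induct k)
    case 0 show ?case unfolding ideal_pow(1)[OF J] by simp
  next
    case (Suc k)
    then show ?case unfolding ideal_pow(2)[OF J] nat_pow_Suc
      by (rule ideal_prod.prod[OF _ cgenideal_self[OF d]])
  qed
  ultimately show ?thesis by blast
qed

section \<open>Modules over a local subring\<close>

text \<open>\<open>R\<close> plays the ring \<open>A\<close> of the theorem, and \<open>D\<close>
  the local ring called R there; completeness is assumed only in the lemmas that use it. All
  \<open>D\<close>-modules are subsets of the ambient ring, so that \<open>line_extension\<close>
  and \<open>Span\<close> apply to them.\<close>

locale noeth_local_subring = cring R for R (structure) +
  fixes D m :: "'a set"
  assumes D: "subring D R"
    and noethD: "noetherian_ring (R\<lparr>carrier := D\<rparr>)"
    and localD: "local_ring (R\<lparr>carrier := D\<rparr>) m"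
begin

abbreviation "DD \<equiv> R\<lparr>carrier := D\<rparr>"

lemma D_carrier: "D \<subseteq> carrier R" by (rule subringE(1)[OF D])
lemma D_carr [simp, intro]: "x \<in> D \<Longrightarrow> x \<in> carrier R" using D_carrier by blast
lemma D_zero [simp, intro]: "\<zero> \<in> D" by (rule subringE(2)[OF D])
lemma D_one [simp, intro]: "\<one> \<in> D" by (rule subringE(3)[OF D])
lemma D_neg [simp, intro]: "x \<in> D \<Longrightarrow> \<ominus> x \<in> D" by (rule subringE(5)[OF D])
lemma D_mult [simp, intro]: "x \<in> D \<Longrightarrow> y \<in> D \<Longrightarrow> x \<otimes> y \<in> D" by (rule subringE(6)[OF D])
lemma D_add [simp, intro]: "x \<in> D \<Longrightarrow> y \<in> D \<Longrightarrow> x \<oplus> y \<in> D" by (rule subringE(7)[OF D])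
lemma D_minus [simp, intro]: "x \<in> D \<Longrightarrow> y \<in> D \<Longrightarrow> x \<ominus> y \<in> D" unfolding a_minus_def by simp
lemma D_pow [simp, intro]: "x \<in> D \<Longrightarrow> x [^] (n::nat) \<in> D" by (induct n) auto

lemma DD_cring: "cring DD" using localD unfolding local_ring_def by simp
lemma DD_pow [simp]: "x [^]\<^bsub>DD\<^esub> (n::nat) = x [^] n" by (rule nat_pow_consistent[symmetric])

lemma DD_ideal_neg: "ideal I DD \<Longrightarrow> x \<in> I \<Longrightarrow> \<ominus> x \<in> I"
  using ideal.I_l_closed[of I DD x "\<ominus> \<one>"] ideal.Icarr[of I DD x] by (simp add: l_minus)

lemma DD_idealI:
  assumes "I \<subseteq> D" "\<zero> \<in> I" "\<And>x y. x \<in> I \<Longrightarrow> y \<in> I \<Longrightarrow> x \<oplus> y \<in> I" "\<And>d x. d \<in> D \<Longrightarrow> x \<in> I \<Longrightarrow> d \<otimes> x \<in> I"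
  shows "ideal I DD"
proof -
  interpret DD: cring DD by (rule DD_cring)
  show ?thesis by (rule DD.ideal_of_closed) (use assms in auto)
qed

lemma m_max: "maximalideal m DD" and m_unique: "\<And>M. maximalideal M DD \<Longrightarrow> M = m"
  using localD unfolding local_ring_def by blast+

lemma m_ideal: "ideal m DD" using m_max by (rule maximalideal.axioms)
lemma m_prime: "primeideal m DD" using cring.maximalideal_prime[OF DD_cring m_max] .
lemma m_D [simp, intro]: "x \<in> m \<Longrightarrow> x \<in> D" using ideal.Icarr[OF m_ideal] by simp
lemma m_zero [simp, intro]: "\<zero> \<in> m"
  using additive_subgroup.zero_closed[OF ideal.axioms(1)[OF m_ideal]] by simp
lemma m_add [simp, intro]: "x \<in> m \<Longrightarrow> y \<in> m \<Longrightarrow> x \<oplus> y \<in> m"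
  using additive_subgroup.a_closed[OF ideal.axioms(1)[OF m_ideal]] by simp
lemma m_mult_l [simp, intro]: "d \<in> D \<Longrightarrow> x \<in> m \<Longrightarrow> d \<otimes> x \<in> m"
  using ideal.I_l_closed[OF m_ideal] by simp
lemma m_mult_r [simp, intro]: "d \<in> D \<Longrightarrow> x \<in> m \<Longrightarrow> x \<otimes> d \<in> m"
  using ideal.I_r_closed[OF m_ideal] by simp
lemma m_neg [simp, intro]: "x \<in> m \<Longrightarrow> \<ominus> x \<in> m" using DD_ideal_neg[OF m_ideal] .
lemma m_minus [simp, intro]: "x \<in> m \<Longrightarrow> y \<in> m \<Longrightarrow> x \<ominus> y \<in> m" unfolding a_minus_def by simp

lemma one_notin_m: "\<one> \<notin> m"
  using primeideal.I_notcarr[OF m_prime] ideal.one_imp_carrier[OF m_ideal] by auto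

lemma DD_ideal_sub_m:
  assumes "ideal I DD" "I \<noteq> D" shows "I \<subseteq> m"
  using cring.exists_maximalideal_containing[OF DD_cring assms(1)] assms(2) m_unique by auto

lemma unit_of_notin_m:
  assumes "u \<in> D" "u \<notin> m" obtains v where "v \<in> D" "v \<otimes> u = \<one>"
proof -
  interpret DD: cring DD by (rule DD_cring)
  have "ideal (PIdl\<^bsub>DD\<^esub> u) DD" using assms by (intro DD.cgenideal_ideal) auto
  moreover have "u \<in> PIdl\<^bsub>DD\<^esub> u" using assms by (intro DD.cgenideal_self) auto
  ultimately have "PIdl\<^bsub>DD\<^esub> u = D" using DD_ideal_sub_m assms by blast
  then have "\<one> \<in> PIdl\<^bsub>DD\<^esub> u" by auto
  then show thesis using that unfolding cgenideal_def by auto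
qed

text \<open>The \<open>D\<close>-submodules of \<open>R\<close>, as plain sets. A submodule of a
  quotient \<open>R / P\<close> is represented by its preimage, a set containing \<open>P\<close>,
  so that no quotient module is formed.\<close>

definition dsub :: "'a set \<Rightarrow> bool" where
  "dsub N \<longleftrightarrow> N \<subseteq> carrier R \<and> \<zero> \<in> N \<and> (\<forall>x\<in>N. \<forall>y\<in>N. x \<oplus> y \<in> N) \<and> (\<forall>d\<in>D. \<forall>x\<in>N. d \<otimes> x \<in> N)"

lemma dsub_neg: "dsub N \<Longrightarrow> x \<in> N \<Longrightarrow> \<ominus> x \<in> N"
  using D_neg[OF D_one] unfolding dsub_def by (metis l_minus l_one one_closed subset_iff)

lemma dsub_minus: "dsub N \<Longrightarrow> x \<in> N \<Longrightarrow> y \<in> N \<Longrightarrow> x \<ominus> y \<in> N"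
  using dsub_neg[of N y] unfolding a_minus_def dsub_def by blast

lemma dsub_line_extension:
  assumes N: "dsub N" and w: "w \<in> carrier R" and I: "ideal I DD"
  shows "dsub (line_extension I w N)"
proof -
  have ID: "i \<in> I \<Longrightarrow> i \<in> D" for i using ideal.Icarr[OF I] by auto
  have Iz: "\<zero> \<in> I" using additive_subgroup.zero_closed[OF ideal.axioms(1)[OF I]] by simp
  have Ia: "i \<in> I \<Longrightarrow> j \<in> I \<Longrightarrow> i \<oplus> j \<in> I" for i j
    using additive_subgroup.a_closed[OF ideal.axioms(1)[OF I]] by simp
  have Im: "d \<in> D \<Longrightarrow> i \<in> I \<Longrightarrow> d \<otimes> i \<in> I" for d i using ideal.I_l_closed[OF I] by simp
  have Nc: "n \<in> N \<Longrightarrow> n \<in> carrier R" for n using N unfolding dsub_def by auto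
  show ?thesis unfolding dsub_def
  proof (intro conjI ballI subsetI)
    fix x assume "x \<in> line_extension I w N"
    then show "x \<in> carrier R" using Nc w ID by (auto simp: line_extension_mem_iff)
  next
    show "\<zero> \<in> line_extension I w N" unfolding line_extension_mem_iff
      using Iz N w unfolding dsub_def by (intro bexI[of _ \<zero>]) auto
  next
    fix x y assume "x \<in> line_extension I w N" "y \<in> line_extension I w N"
    then obtain i j n k where *: "i \<in> I" "j \<in> I" "n \<in> N" "k \<in> N" "x = i \<otimes> w \<oplus> n" "y = j \<otimes> w \<oplus> k"
      unfolding line_extension_mem_iff by blast
    then have "x \<oplus> y = (i \<oplus> j) \<otimes> w \<oplus> (n \<oplus> k)" using ID Nc w D_carr[OF ID] by (auto simp: l_distr a_ac)
    then show "x \<oplus> y \<in> line_extension I w N" unfolding line_extension_mem_iff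
      using * Ia N unfolding dsub_def by blast
  next
    fix d x assume d: "d \<in> D" and "x \<in> line_extension I w N"
    then obtain i n where *: "i \<in> I" "n \<in> N" "x = i \<otimes> w \<oplus> n"
      unfolding line_extension_mem_iff by blast
    then have "d \<otimes> x = (d \<otimes> i) \<otimes> w \<oplus> d \<otimes> n" using ID Nc w d by (auto simp: r_distr m_assoc)
    then show "d \<otimes> x \<in> line_extension I w N" unfolding line_extension_mem_iff
      using * Im d N unfolding dsub_def by blast
  qed
qed

lemma D_ideal: "ideal D DD" using ring.oneideal[OF cring.axioms(1)[OF DD_cring]] by simp

lemma line_extension_incr: "dsub N \<Longrightarrow> ideal I DD \<Longrightarrow> w \<in> carrier R \<Longrightarrow> N \<subseteq> line_extension I w N"
proof
  fix x assume *: "dsub N" "ideal I DD" "w \<in> carrier R" "x \<in> N"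
  have "\<zero> \<in> I" using additive_subgroup.zero_closed[OF ideal.axioms(1)[OF *(2)]] by simp
  moreover have "x = \<zero> \<otimes> w \<oplus> x" using * unfolding dsub_def by auto
  ultimately show "x \<in> line_extension I w N" unfolding line_extension_mem_iff using * by blast
qed

lemma line_extension_gen: "dsub N \<Longrightarrow> w \<in> carrier R \<Longrightarrow> w \<in> line_extension D w N"
  unfolding line_extension_mem_iff dsub_def by (intro bexI[of _ \<one>] bexI[of _ \<zero>]) auto

lemma line_extensionI: "k \<in> K \<Longrightarrow> v \<in> E \<Longrightarrow> x = k \<otimes> a \<oplus> v \<Longrightarrow> x \<in> line_extension K a E"
  unfolding line_extension_mem_iff by blast

lemma line_extensionE:
  assumes "x \<in> line_extension K a E" obtains k v where "k \<in> K" "v \<in> E" "x = k \<otimes> a \<oplus> v"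
  using assms unfolding line_extension_mem_iff by blast

lemma line_extension_sub_D: "w \<in> D \<Longrightarrow> N \<subseteq> D \<Longrightarrow> line_extension D w N \<subseteq> D"
  by (auto elim!: line_extensionE)

lemma dsub_carrier: "dsub N \<Longrightarrow> x \<in> N \<Longrightarrow> x \<in> carrier R"
  and dsub_zero: "dsub N \<Longrightarrow> \<zero> \<in> N"
  and dsub_add: "dsub N \<Longrightarrow> x \<in> N \<Longrightarrow> y \<in> N \<Longrightarrow> x \<oplus> y \<in> N"
  and dsub_smult: "dsub N \<Longrightarrow> d \<in> D \<Longrightarrow> x \<in> N \<Longrightarrow> d \<otimes> x \<in> N"
  unfolding dsub_def by auto

text \<open>A chain of length \<open>l\<close> from \<open>N\<close> whose successive quotients are cyclic and killed by \<open>m\<close>,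
  hence simple or zero.\<close>

inductive layers :: "'a set \<Rightarrow> nat \<Rightarrow> 'a set \<Rightarrow> bool" for N where
  layers_0: "layers N 0 N"
| layers_Suc: "layers N l N' \<Longrightarrow> w \<in> carrier R \<Longrightarrow> (\<And>e. e \<in> m \<Longrightarrow> e \<otimes> w \<in> N')
    \<Longrightarrow> layers N (Suc l) (line_extension D w N')"

lemma layers_trans:
  assumes "layers N2 b N3" "layers N1 a N2" shows "layers N1 (b + a) N3"
  using assms by (induct rule: layers.induct) (auto intro: layers.intros)

lemma layers_dsub: "layers N l N' \<Longrightarrow> dsub N \<Longrightarrow> dsub N'"
  by (induct rule: layers.induct) (auto intro: dsub_line_extension D_ideal)

text \<open>Indexing the members of a chain is what allows it to be repeated periodically in
  \<open>exists_filtration\<close>.\<close>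

lemma layers_exists_fun:
  "layers N l N' \<Longrightarrow> dsub N \<Longrightarrow> \<exists>G. G 0 = N \<and> G l = N' \<and> (\<forall>i\<le>l. dsub (G i)) \<and>
     (\<forall>i<l. \<exists>w\<in>carrier R. G (Suc i) = line_extension D w (G i) \<and> (\<forall>e\<in>m. e \<otimes> w \<in> G i))"
proof (induct rule: layers.induct)
  case layers_0 then show ?case by (intro exI[of _ "\<lambda>_. N"]) auto
next
  case (layers_Suc l N' w)
  then obtain G where G: "G 0 = N" "G l = N'" "\<And>i. i \<le> l \<Longrightarrow> dsub (G i)"
     "\<And>i. i < l \<Longrightarrow> \<exists>w\<in>carrier R. G (Suc i) = line_extension D w (G i) \<and> (\<forall>e\<in>m. e \<otimes> w \<in> G i)"
    by auto
  let ?G = "G(Suc l := line_extension D w N')"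
  show ?case
  proof (intro exI[of _ ?G] conjI allI impI)
    fix i assume "i \<le> Suc l" then show "dsub (?G i)"
      using G(2,3) G(3)[of l] layers_Suc(3) dsub_line_extension[OF _ _ D_ideal] by (auto simp: le_Suc_eq)
  next
    fix i assume "i < Suc l" then show "\<exists>w\<in>carrier R. ?G (Suc i) = line_extension D w (?G i) \<and> (\<forall>e\<in>m. e \<otimes> w \<in> ?G i)"
      using G(4)[of i] G(2) layers_Suc(3,4) by (cases "i = l") auto
  qed (use G in auto)
qed

text \<open>An associated prime of \<open>D / M\<close> with \<open>I0 \<subseteq> M\<close> lies
  strictly above \<open>P \<inter> D\<close> and hence is \<open>m\<close>, so a chain that stops
  short of \<open>D\<close> can be prolonged by a simple layer. In other words,
  \<open>D / I0\<close> has finite length.\<close>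

lemma layers_of_ideal:
  assumes P: "primeideal P R" and I0: "ideal I0 DD" "P \<inter> D \<subset> I0"
    and dimP: "\<And>q. primeideal q DD \<Longrightarrow> P \<inter> D \<subset> q \<Longrightarrow> q = m"
  shows "\<exists>l. layers I0 l D"
proof -
  interpret DD: cring DD by (rule DD_cring)
  let ?C = "{I. ideal I DD \<and> I0 \<subseteq> I \<and> (\<exists>l. layers I0 l I)}"
  have "?C \<noteq> {}" using I0 layers_0 by blast
  then obtain M where M: "M \<in> ?C" "\<And>J. J \<in> ?C \<Longrightarrow> M \<subseteq> J \<Longrightarrow> J = M"
    by (rule DD.maximal_condition[of "{}" ?C, rotated]) (use noetherian_ring_fg[OF noethD] in auto)
  have Mi: "ideal M DD" and IM: "I0 \<subseteq> M" using M by auto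
  obtain l where l: "layers I0 l M" using M by auto
  have "M = D"
  proof (rule ccontr)
    assume "M \<noteq> D"
    then obtain w where w: "w \<in> D" "w \<notin> M" "primeideal {x \<in> D. x \<otimes> w \<in> M} DD"
      using DD.exists_prime_annihilator[OF noethD Mi] by auto
    have MD: "M \<subseteq> D" using ideal.Icarr[OF Mi] by auto
    have "M \<subseteq> {x \<in> D. x \<otimes> w \<in> M}" using MD ideal.I_r_closed[OF Mi] w by auto
    then have "{x \<in> D. x \<otimes> w \<in> M} = m" using I0 IM by (intro dimP[OF w(3)]) blast
    then have ann: "e \<otimes> w \<in> M" if "e \<in> m" for e using that by blast
    have dM: "dsub M" using MD additive_subgroup.zero_closed[OF ideal.axioms(1)[OF Mi]]
        additive_subgroup.a_closed[OF ideal.axioms(1)[OF Mi]] ideal.I_l_closed[OF Mi]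
      unfolding dsub_def by auto
    let ?J = "line_extension D w M"
    have dJ: "dsub ?J" using dsub_line_extension[OF dM _ D_ideal] w by auto
    have JD: "?J \<subseteq> D" by (rule line_extension_sub_D[OF w(1) MD])
    have "ideal ?J DD" using dJ JD unfolding dsub_def by (intro DD_idealI) auto
    moreover have "M \<subseteq> ?J" using line_extension_incr[OF dM D_ideal] w by auto
    moreover have "layers I0 (Suc l) ?J" using layers_Suc[OF l _ ann] w by auto
    ultimately have "?J = M" using M(2)[of ?J] IM by blast
    then show False using line_extension_gen[OF dM, of w] w by auto
  qed
  then show ?thesis using l by blast
qed

text \<open>Multiplying by \<open>v\<close> and adding \<open>N\<close> turns ideals of
  \<open>D\<close> into submodules of \<open>R\<close> and keeps the layers cyclic and killed by
  \<open>m\<close>.\<close>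

lemma layers_scale:
  assumes "layers I0 l I" "dsub I0" "v \<in> carrier R" "dsub N"
  shows "layers (line_extension I0 v N) l (line_extension I v N)"
  using assms
proof (induct rule: layers.induct)
  case layers_0 then show ?case using layers.layers_0 by blast
next
  case (layers_Suc l I w)
  have IH: "I \<subseteq> carrier R" "layers (line_extension I0 v N) l (line_extension I v N)"
    using layers_Suc layers_dsub[OF layers_Suc(1)] unfolding dsub_def by auto
  have Nc: "N \<subseteq> carrier R" and Nz: "\<zero> \<in> N" using \<open>dsub N\<close> unfolding dsub_def by auto
  have w: "w \<in> carrier R" by fact
  have v: "v \<in> carrier R" by fact
  have eq: "line_extension (line_extension D w I) v N = line_extension D (w \<otimes> v) (line_extension I v N)"
    (is "?l = ?r")
  proof (intro equalityI subsetI)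
    fix x assume "x \<in> ?l"
    then obtain d i n where *: "d \<in> D" "i \<in> I" "n \<in> N" "x = (d \<otimes> w \<oplus> i) \<otimes> v \<oplus> n"
      by (elim line_extensionE) blast
    have c: "d \<in> carrier R" "i \<in> carrier R" "n \<in> carrier R" using * Nc IH(1) by auto
    have "x = d \<otimes> (w \<otimes> v) \<oplus> (i \<otimes> v \<oplus> n)" unfolding *(4) using c w v by algebra
    then show "x \<in> ?r" using *(1-3) by (blast intro: line_extensionI)
  next
    fix x assume "x \<in> ?r"
    then obtain d i n where *: "d \<in> D" "i \<in> I" "n \<in> N" "x = d \<otimes> (w \<otimes> v) \<oplus> (i \<otimes> v \<oplus> n)"
      by (elim line_extensionE) blast
    have c: "d \<in> carrier R" "i \<in> carrier R" "n \<in> carrier R" using * Nc IH(1) by auto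
    have "x = (d \<otimes> w \<oplus> i) \<otimes> v \<oplus> n" unfolding *(4) using c w v by algebra
    then show "x \<in> ?l" using *(1-3) by (blast intro: line_extensionI)
  qed
  have "layers (line_extension I0 v N) (Suc l) ?r"
  proof (rule layers.layers_Suc[OF IH(2)])
    fix e assume e: "e \<in> m"
    have "e \<otimes> (w \<otimes> v) = (e \<otimes> w) \<otimes> v \<oplus> \<zero>" using w v e by (auto simp: m_assoc)
    then show "e \<otimes> (w \<otimes> v) \<in> line_extension I v N"
      unfolding line_extension_mem_iff using layers_Suc(4)[OF e] Nz by blast
  qed (use w v in auto)
  then show ?case unfolding eq .
qed

text \<open>The library's \<open>Span\<close> with base \<open>N\<close> in place of zero: for a
  submodule \<open>N\<close>, \<open>span_over us N = carrier R\<close> says that \<open>us\<close>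
  generates \<open>R / N\<close> over \<open>D\<close>.\<close>

definition span_over :: "'a list \<Rightarrow> 'a set \<Rightarrow> 'a set" where
  "span_over us N = foldr (line_extension D) us N"

lemma dsub_span_over: "set us \<subseteq> carrier R \<Longrightarrow> dsub N \<Longrightarrow> dsub (span_over us N)"
  unfolding span_over_def by (induct us) (auto intro: dsub_line_extension D_ideal)

lemma span_over_incr: "set us \<subseteq> carrier R \<Longrightarrow> dsub N \<Longrightarrow> N \<subseteq> span_over us N"
proof (induct us)
  case (Cons u us)
  then show ?case using line_extension_incr[OF dsub_span_over[of us N] D_ideal, of u]
    unfolding span_over_def by auto
qed (simp add: span_over_def)

lemma span_over_gen: "set us \<subseteq> carrier R \<Longrightarrow> dsub N \<Longrightarrow> set us \<subseteq> span_over us N"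
proof (induct us)
  case (Cons u us)
  then show ?case using line_extension_incr[OF dsub_span_over[of us N] D_ideal, of u]
     line_extension_gen[OF dsub_span_over[of us N], of u]
    unfolding span_over_def by auto
qed simp

lemma span_over_min:
  "set us \<subseteq> F \<Longrightarrow> N \<subseteq> F \<Longrightarrow> dsub F \<Longrightarrow> span_over us N \<subseteq> F"
proof (induct us)
  case (Cons u us)
  then show ?case unfolding span_over_def line_extension_mem_iff
    by (auto simp: line_extension_mem_iff intro!: dsub_add dsub_smult)
qed (simp add: span_over_def)

text \<open>Adjoining one generator \<open>u\<close> adds a quotient of
  \<open>D / (d D + (P \<inter> D))\<close>, which has finite length because \<open>d\<close> lies
  outside \<open>P\<close>.\<close>

lemma layers_module:
  assumes P: "primeideal P R" and d: "d \<in> D" "d \<notin> P"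
    and dimP: "\<And>q. primeideal q DD \<Longrightarrow> P \<inter> D \<subset> q \<Longrightarrow> q = m"
    and us: "set us \<subseteq> carrier R" and N: "dsub N" "P \<subseteq> N" "\<And>u. u \<in> set us \<Longrightarrow> d \<otimes> u \<in> N"
  shows "\<exists>l. layers N l (span_over us N)"
  using us N(3)
proof (induct us)
  case Nil then show ?case unfolding span_over_def using layers_0 by auto
next
  case (Cons u us)
  interpret P: primeideal P R by (rule P)
  let ?I0 = "line_extension D d (P \<inter> D)"
  have PD: "dsub (P \<inter> D)" unfolding dsub_def using P.I_l_closed by auto
  have dI: "dsub ?I0" using dsub_line_extension[OF PD _ D_ideal] d by auto
  have ID: "?I0 \<subseteq> D" by (rule line_extension_sub_D[OF d(1)]) auto
  have I0: "ideal ?I0 DD" using dI ID unfolding dsub_def by (intro DD_idealI) auto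
  have "P \<inter> D \<subset> ?I0"
    using line_extension_incr[OF PD D_ideal, of d] line_extension_gen[OF PD, of d] d by auto
  from layers_of_ideal[OF P I0 this dimP] obtain l where l: "layers ?I0 l D" by blast
  obtain k where k: "layers N k (span_over us N)" using Cons by auto
  let ?N = "span_over us N"
  have dN: "dsub ?N" using dsub_span_over[of us N] Cons N by auto
  have u: "u \<in> carrier R" using Cons by auto
  have NN: "N \<subseteq> ?N" using span_over_incr[of us N] Cons N by auto
  \<comment> \<open>The multiples of \<open>u\<close> by \<open>d\<close> and by elements of
    \<open>P\<close> are already in \<open>?N\<close>, so the chain from \<open>?I0\<close> to
    \<open>D\<close>, scaled by \<open>u\<close>, starts at \<open>?N\<close>.\<close>
  have "line_extension ?I0 u ?N \<subseteq> ?N"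
  proof
    fix x assume "x \<in> line_extension ?I0 u ?N"
    then obtain c p n where *: "c \<in> D" "p \<in> P" "n \<in> ?N" "x = (c \<otimes> d \<oplus> p) \<otimes> u \<oplus> n"
      by (elim line_extensionE) blast
    have 1: "p \<otimes> u \<in> ?N" using P.I_r_closed[OF *(2) u] N(2) NN by auto
    have "d \<otimes> u \<in> ?N" using Cons(3) NN by auto
    then have 2: "c \<otimes> (d \<otimes> u) \<in> ?N" using *(1) dN unfolding dsub_def by auto
    have nc: "n \<in> carrier R" using *(3) dN unfolding dsub_def by auto
    have pc: "p \<in> carrier R" using * P.Icarr by auto
    have "x = (c \<otimes> (d \<otimes> u) \<oplus> p \<otimes> u) \<oplus> n" unfolding *(4) using pc nc u d * by (simp add: l_distr m_assoc)
    then show "x \<in> ?N" using 1 2 *(3) dN unfolding dsub_def by simp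
  qed
  moreover have "?N \<subseteq> line_extension ?I0 u ?N" by (rule line_extension_incr[OF dN I0 u])
  ultimately have "line_extension ?I0 u ?N = ?N" by blast
  then have "layers ?N l (line_extension D u ?N)" using layers_scale[OF l dI u dN] by simp
  then have "layers N (l + k) (line_extension D u ?N)" using layers_trans k by blast
  then show ?case unfolding span_over_def by auto
qed

text \<open>Among \<open>L + 1\<close> elements two have depths congruent modulo \<open>L\<close>. A power of \<open>d\<close> moves the
  shallower one to the depth of the other, and a \<open>D\<close>-multiple of it then pushes the other one deeper.
  The coefficients stay unimodular throughout.\<close>

lemma primitive_combination_deep:
  fixes M :: "nat \<Rightarrow> 'a set"
  assumes sub: "\<And>i. dsub (M i)"
    and simple: "\<And>i y z. y \<in> M i \<Longrightarrow> y \<notin> M (Suc i) \<Longrightarrow> z \<in> M i \<Longrightarrow> \<exists>u\<in>D. z \<ominus> u \<otimes> y \<in> M (Suc i)"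
    and shift: "\<And>i y. y \<in> M i \<Longrightarrow> d \<otimes> y \<in> M (i + L)"
    and unshift: "\<And>i y. y \<in> carrier R \<Longrightarrow> d \<otimes> y \<in> M (i + L) \<Longrightarrow> y \<in> M i"
    and d: "d \<in> D" and L: "0 < L"
    and y: "\<And>j. j \<le> L \<Longrightarrow> y j \<in> M (e j)" and e: "\<And>j. j \<le> L \<Longrightarrow> e j \<le> n"
  shows "\<exists>c. (\<forall>j. c j \<in> D) \<and> (\<exists>j\<le>L. c j \<notin> m) \<and> (\<Oplus>j\<in>{..L}. c j \<otimes> y j) \<in> M n"
  using y e
\<comment> \<open>The measure is the total depth still missing; each round raises one recorded depth
  \<open>e k\<close> by one.\<close>
proof (induct "\<Sum>j\<le>L. n - e j" arbitrary: y e rule: less_induct)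
  case less
  have Mc: "z \<in> M i \<Longrightarrow> z \<in> carrier R" for z i using sub unfolding dsub_def by blast
  have yc: "j \<le> L \<Longrightarrow> y j \<in> carrier R" for j using less(2) Mc by blast
  have decr: "(\<Sum>j\<le>L. n - (e(k := Suc (e k))) j) < (\<Sum>j\<le>L. n - e j)" if "k \<le> L" "e k < n" for k
    by (rule sum_strict_mono_ex1) (use that in auto)
  show ?case
  proof (cases "\<exists>k\<le>L. e k = n")
    case True
    then obtain k where k: "k \<le> L" "e k = n" by blast
    \<comment> \<open>An element recorded at depth \<open>n\<close> is the wanted combination by
      itself, with coefficient \<open>\<one>\<close>.\<close>
    have "(\<Oplus>j\<in>{..L}. (if j = k then \<one> else \<zero>) \<otimes> y j) = (\<Oplus>j\<in>{..L}. if k = j then y j else \<zero>)"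
      by (rule finsum_cong') (use yc in auto)
    also have "\<dots> = y k" by (rule finsum_singleton) (use k yc in auto)
    finally show ?thesis using less(2)[OF k(1)] k one_notin_m
      by (intro exI[of _ "\<lambda>j. if j = k then \<one> else \<zero>"]) auto
  next
    case False
    then have en: "j \<le> L \<Longrightarrow> e j < n" for j using less(3)[of j] le_neq_trans by blast
    show ?thesis
    proof (cases "\<exists>k\<le>L. y k \<in> M (Suc (e k))")
      case True
      then obtain k where k: "k \<le> L" "y k \<in> M (Suc (e k))" by blast
      show ?thesis
        by (rule less(1)[OF decr[OF k(1) en[OF k(1)]]]) (use less(2,3) k en in \<open>auto simp: Suc_leI\<close>)
    next
      case False
      \<comment> \<open>There are \<open>L + 1\<close> recorded depths and only \<open>L\<close>
        residues.\<close>
      have "\<not> inj_on (\<lambda>j. e j mod L) {..L}"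
      proof
        assume "inj_on (\<lambda>j. e j mod L) {..L}"
        moreover have "(\<lambda>j. e j mod L) ` {..L} \<subseteq> {..<L}" using L by auto
        ultimately have "card {..L} \<le> card {..<L}" by (rule card_inj_on_le) simp
        then show False by simp
      qed
      then obtain i k where ik: "i \<le> L" "k \<le> L" "i \<noteq> k" "e i mod L = e k mod L" "e i \<le> e k"
        unfolding inj_on_def by (metis atMost_iff nat_le_linear)
      define r where "r = (e k - e i) div L"
      have "L dvd e k - e i" using mod_eq_dvd_iff_nat[OF ik(5)] ik(4) by metis
      then have er: "e k = e i + r * L" unfolding r_def using ik by simp
      have s1: "z \<in> M a \<Longrightarrow> d [^] r \<otimes> z \<in> M (a + r * L)" for z a r
      proof (induct r)
        case (Suc r)
        have "d [^] Suc r \<otimes> z = d \<otimes> (d [^] r \<otimes> z)" using d Mc[OF Suc(2)] by (simp add: m_ac)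
        then show ?case using shift[OF Suc(1)[OF Suc(2)]] by (simp add: add_ac)
      qed (use Mc in auto)
      have s2: "z \<in> carrier R \<Longrightarrow> d [^] r \<otimes> z \<in> M (a + r * L) \<Longrightarrow> z \<in> M a" for z a r
      proof (induct r)
        case (Suc r)
        have "d [^] Suc r \<otimes> z = d \<otimes> (d [^] r \<otimes> z)" using d Suc(2) by (simp add: m_ac)
        with Suc(3) have "d [^] r \<otimes> z \<in> M (a + r * L)"
          using unshift[of "d [^] r \<otimes> z" "a + r * L"] d Suc(2) by (simp add: add.assoc add.commute[of L])
        then show ?case using Suc by blast
      qed auto
      let ?z = "d [^] r \<otimes> y i"
      have zc: "?z \<in> carrier R" using d yc ik by auto
      have 1: "?z \<in> M (e k)" using s1[OF less(2)[OF ik(1)]] er by simp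
      have 2: "?z \<notin> M (Suc (e k))"
        using s2[OF yc[OF ik(1)], of r "Suc (e i)"] False ik(1) er by auto
      \<comment> \<open>\<open>?z\<close> is \<open>y i\<close> moved to the depth of
        \<open>y k\<close>, and by \<open>unshift\<close> it is no deeper than that; so it generates
        the layer there.\<close>
      obtain u where u: "u \<in> D" "y k \<ominus> u \<otimes> ?z \<in> M (Suc (e k))"
        using simple[OF 1 2 less(2)[OF ik(2)]] by blast
      let ?t = "u \<otimes> d [^] r"
      have t: "?t \<in> D" using u d by auto
      let ?y = "y(k := y k \<ominus> ?t \<otimes> y i)"
      have yk: "?y k \<in> M (Suc (e k))" using u yc[OF ik(1)] d by (simp add: m_assoc)
      obtain c where c: "\<And>j. c j \<in> D" "\<exists>j\<le>L. c j \<notin> m" "(\<Oplus>j\<in>{..L}. c j \<otimes> ?y j) \<in> M n"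
      proof -
        have "\<exists>c. (\<forall>j. c j \<in> D) \<and> (\<exists>j\<le>L. c j \<notin> m) \<and> (\<Oplus>j\<in>{..L}. c j \<otimes> ?y j) \<in> M n"
          by (rule less(1)[OF decr[OF ik(2) en[OF ik(2)]]]) (use less(2,3) yk en[OF ik(2)] in \<open>auto simp: Suc_leI\<close>)
        with that show thesis by blast
      qed
      \<comment> \<open>Undoing the replacement of \<open>y k\<close> by
        \<open>y k \<ominus> ?t \<otimes> y i\<close> changes only the coefficient at
        \<open>i\<close>.\<close>
      let ?c = "c(i := c i \<ominus> c k \<otimes> ?t)"
      have split: "{..L} = insert i (insert k ({..L} - {i,k}))" using ik by auto
      have cong: "(\<Oplus>j\<in>{..L} - {i,k}. c j \<otimes> ?y j) = (\<Oplus>j\<in>{..L} - {i,k}. ?c j \<otimes> y j)"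
        by (rule finsum_cong') (use yc c in auto)
      define S where "S = (\<Oplus>j\<in>{..L} - {i,k}. ?c j \<otimes> y j)"
      have S: "S \<in> carrier R" unfolding S_def by (rule finsum_closed) (use yc c t in auto)
      have "(\<Oplus>j\<in>{..L}. c j \<otimes> ?y j) = c i \<otimes> y i \<oplus> (c k \<otimes> (y k \<ominus> ?t \<otimes> y i) \<oplus> S)"
        apply (subst split)
        using ik yc c t cong unfolding S_def by (subst finsum_insert; (subst finsum_insert)?; auto simp: Pi_def)
      also have "\<dots> = (c i \<ominus> c k \<otimes> ?t) \<otimes> y i \<oplus> (c k \<otimes> y k \<oplus> S)"
        using S yc[OF ik(1)] yc[OF ik(2)] D_carr[OF c(1)] D_carr[OF t] by algebra
      also have "\<dots> = (\<Oplus>j\<in>{..L}. ?c j \<otimes> y j)"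
        apply (subst split)
        using ik yc c t unfolding S_def by (subst finsum_insert; (subst finsum_insert)?; auto simp: Pi_def)
      finally have "(\<Oplus>j\<in>{..L}. ?c j \<otimes> y j) \<in> M n" using c(3) by simp
      \<comment> \<open>The coefficient at \<open>i\<close> changes modulo \<open>m\<close> only if
        \<open>c k\<close> lies outside \<open>m\<close>, and \<open>c k\<close> itself is
        kept.\<close>
      moreover have "\<exists>j\<le>L. ?c j \<notin> m"
      proof (cases "c k \<in> m")
        case True
        then obtain j where j: "j \<le> L" "c j \<notin> m" "j \<noteq> k" using c(2) by auto
        have "c i \<notin> m \<Longrightarrow> c i \<ominus> c k \<otimes> ?t \<notin> m"
        proof
          assume *: "c i \<notin> m" "c i \<ominus> c k \<otimes> ?t \<in> m"
          have "(c i \<ominus> c k \<otimes> ?t) \<oplus> c k \<otimes> ?t \<in> m" using * m_mult_r[OF t True] by auto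
          moreover have "(c i \<ominus> c k \<otimes> ?t) \<oplus> c k \<otimes> ?t = c i"
            using D_carr[OF c(1)] D_carr[OF t] by algebra
          ultimately show False using * by simp
        qed
        then show ?thesis using j by (intro exI[of _ j]) auto
      next
        case False then show ?thesis using ik by (intro exI[of _ k]) auto
      qed
      moreover have "\<forall>j. ?c j \<in> D" using c t by auto
      ultimately show ?thesis by blast
    qed
  qed
qed

end

section \<open>Relations with a unit coefficient\<close>

text \<open>Library polynomials list the leading coefficient first, hence the reversal.\<close>

lemma (in ring) eval_map_rev:
  assumes "\<And>i. c i \<in> carrier R" "x \<in> carrier R"
  shows "eval (map c (rev [0..<n])) x = (\<Oplus>i\<in>{..<n}. c i \<otimes> x [^] i)"
  by (induct n) (use assms in \<open>auto simp: lessThan_Suc finsum_insert Pi_def\<close>)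

section \<open>A periodic filtration of a finitely generated module\<close>

context noeth_local_subring
begin

text \<open>This is the preimage in \<open>R\<close> of \<open>d^k\<close> times the image of
  \<open>H\<close> in \<open>R / P\<close>.\<close>

definition scaled :: "'a set \<Rightarrow> 'a \<Rightarrow> nat \<Rightarrow> 'a set \<Rightarrow> 'a set" where
  "scaled P d k H = {d [^] k \<otimes> g \<oplus> p | g p. g \<in> H \<and> p \<in> P}"

lemma dsub_scaled:
  assumes P: "dsub P" and H: "dsub H" and d: "d \<in> D"
  shows "dsub (scaled P d k H)"
  unfolding dsub_def
proof (intro conjI ballI subsetI)
  note c = dsub_carrier[OF P] dsub_carrier[OF H]
  fix x assume "x \<in> scaled P d k H"
  then show "x \<in> carrier R" using c d by (auto simp: scaled_def)
next
  have "\<zero> = d [^] k \<otimes> \<zero> \<oplus> \<zero>" using d by simp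
  then show "\<zero> \<in> scaled P d k H" unfolding scaled_def using dsub_zero[OF P] dsub_zero[OF H] by blast
next
  note c = dsub_carrier[OF P] dsub_carrier[OF H]
  fix x y assume "x \<in> scaled P d k H" "y \<in> scaled P d k H"
  then obtain g p h q where *: "g \<in> H" "p \<in> P" "h \<in> H" "q \<in> P"
    "x = d [^] k \<otimes> g \<oplus> p" "y = d [^] k \<otimes> h \<oplus> q" unfolding scaled_def by blast
  have "x \<oplus> y = d [^] k \<otimes> (g \<oplus> h) \<oplus> (p \<oplus> q)"
    unfolding *(5,6) using c(1)[OF *(2)] c(1)[OF *(4)] c(2)[OF *(1)] c(2)[OF *(3)] D_carr[OF D_pow[OF d, of k]]
    by algebra
  then show "x \<oplus> y \<in> scaled P d k H"
    unfolding scaled_def using dsub_add[OF H *(1,3)] dsub_add[OF P *(2,4)] by blast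
next
  note c = dsub_carrier[OF P] dsub_carrier[OF H]
  fix e x assume e: "e \<in> D" and "x \<in> scaled P d k H"
  then obtain g p where *: "g \<in> H" "p \<in> P" "x = d [^] k \<otimes> g \<oplus> p" unfolding scaled_def by blast
  have "e \<otimes> x = d [^] k \<otimes> (e \<otimes> g) \<oplus> e \<otimes> p"
    unfolding *(3) using c(1)[OF *(2)] c(2)[OF *(1)] D_carr[OF D_pow[OF d, of k]] D_carr[OF e] by algebra
  then show "e \<otimes> x \<in> scaled P d k H"
    unfolding scaled_def using dsub_smult[OF H e *(1)] dsub_smult[OF P e *(2)] by blast
qed

lemma scaledI: "g \<in> H \<Longrightarrow> p \<in> P \<Longrightarrow> x = d [^] k \<otimes> g \<oplus> p \<Longrightarrow> x \<in> scaled P d k H"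
  unfolding scaled_def by blast

lemma scaledE: assumes "x \<in> scaled P d k H" obtains g p where "g \<in> H" "p \<in> P" "x = d [^] k \<otimes> g \<oplus> p"
  using assms unfolding scaled_def by blast

lemma scaled_Suc:
  assumes P: "ideal P R" and H: "H \<subseteq> carrier R" and d: "d \<in> D"
  shows "scaled P d (Suc k) H = scaled P d k (scaled P d 1 H)"
proof (intro equalityI subsetI)
  interpret P: ideal P R by (rule P)
  fix x assume "x \<in> scaled P d (Suc k) H"
  then obtain g p where *: "g \<in> H" "p \<in> P" "x = d [^] Suc k \<otimes> g \<oplus> p" by (rule scaledE)
  have "d \<otimes> g \<in> scaled P d 1 H" by (rule scaledI[OF *(1) P.zero_closed]) (use * H d in auto)
  moreover have "x = d [^] k \<otimes> (d \<otimes> g) \<oplus> p" using * H d by (auto simp: m_assoc subset_iff)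
  ultimately show "x \<in> scaled P d k (scaled P d 1 H)" by (rule scaledI[OF _ *(2)])
next
  interpret P: ideal P R by (rule P)
  fix x assume "x \<in> scaled P d k (scaled P d 1 H)"
  then obtain h p where 1: "h \<in> scaled P d 1 H" "p \<in> P" "x = d [^] k \<otimes> h \<oplus> p" by (rule scaledE)
  obtain g q where 2: "g \<in> H" "q \<in> P" "h = d [^] (1::nat) \<otimes> g \<oplus> q" using 1(1) by (rule scaledE)
  have c: "p \<in> carrier R" "q \<in> carrier R" "g \<in> carrier R" "d \<in> carrier R" "d [^] k \<in> carrier R"
    using 1 2 P.Icarr H d by auto
  have "x = d [^] k \<otimes> (d \<otimes> g \<oplus> q) \<oplus> p" using 1(3) 2(3) c by simp
  also have "\<dots> = (d [^] k \<otimes> d) \<otimes> g \<oplus> (d [^] k \<otimes> q \<oplus> p)" using c by algebra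
  also have "d [^] k \<otimes> d = d [^] Suc k" by simp
  finally show "x \<in> scaled P d (Suc k) H"
    by (rule scaledI[OF 2(1), rotated]) (use 1(2) P.I_l_closed[OF 2(2) c(5)] in auto)
qed

text \<open>A chain from \<open>d F + P\<close> up to \<open>F\<close> is multiplied by all powers
  of \<open>d\<close> and strung together, so that multiplication by \<open>d\<close> shifts the
  depth by the length \<open>L\<close> of one period. It shifts by exactly \<open>L\<close> because
  \<open>P\<close> is prime and \<open>d\<close> lies outside it.\<close>

lemma exists_filtration:
  assumes P: "primeideal P R" and d: "d \<in> D" "d \<notin> P"
    and dimP: "\<And>q. primeideal q DD \<Longrightarrow> P \<inter> D \<subset> q \<Longrightarrow> q = m"
    and us: "set us \<subseteq> carrier R"
  obtains M :: "nat \<Rightarrow> 'a set" and L where "0 < L" "M 0 = span_over us P" "\<And>i. dsub (M i)"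
    "\<And>i y z. y \<in> M i \<Longrightarrow> y \<notin> M (Suc i) \<Longrightarrow> z \<in> M i \<Longrightarrow> \<exists>u\<in>D. z \<ominus> u \<otimes> y \<in> M (Suc i)"
    "\<And>i y. y \<in> M i \<Longrightarrow> d \<otimes> y \<in> M (i + L)"
    "\<And>i y. y \<in> carrier R \<Longrightarrow> d \<otimes> y \<in> M (i + L) \<Longrightarrow> y \<in> M i"
    "\<And>k. M (k * L) = scaled P d k (span_over us P)"
proof -
  interpret P: primeideal P R by (rule P)
  have dP: "dsub P" unfolding dsub_def using P.I_l_closed P.Icarr by auto
  let ?F = "span_over us P"
  have dF: "dsub ?F" by (rule dsub_span_over[OF us dP])
  have PF: "P \<subseteq> ?F" by (rule span_over_incr[OF us dP])
  have Fc: "?F \<subseteq> carrier R" using dF unfolding dsub_def by blast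
  have dc: "d \<in> carrier R" using d by auto
  let ?N = "scaled P d 1 ?F"
  have dN: "dsub ?N" by (rule dsub_scaled[OF dP dF d(1)])
  have PN: "P \<subseteq> ?N"
  proof
    fix p assume p: "p \<in> P"
    show "p \<in> ?N" by (rule scaledI[OF dsub_zero[OF dF] p]) (use p P.Icarr dc in auto)
  qed
  have NF: "?N \<subseteq> ?F"
  proof
    fix x assume "x \<in> ?N"
    then obtain g p where *: "g \<in> ?F" "p \<in> P" "x = d [^] (1::nat) \<otimes> g \<oplus> p" by (rule scaledE)
    then show "x \<in> ?F" using PF dsub_add[OF dF dsub_smult[OF dF d(1) *(1)]] dc by auto
  qed
  have "span_over us ?N = ?F"
  proof
    show "span_over us ?N \<subseteq> ?F" by (rule span_over_min[OF span_over_gen[OF us dP] NF dF])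
    show "?F \<subseteq> span_over us ?N"
      by (rule span_over_min[OF span_over_gen[OF us dN] order_trans[OF PN span_over_incr[OF us dN]] dsub_span_over[OF us dN]])
  qed
  moreover have "d \<otimes> u \<in> ?N" if "u \<in> set us" for u
    by (rule scaledI[OF _ P.zero_closed, of u]) (use that span_over_gen[OF us dP] us dc in auto)
  ultimately obtain l where l: "layers ?N l ?F"
    using layers_module[OF P d dimP us dN PN] by auto
  \<comment> \<open>A layer with generator zero is added so that \<open>L\<close> is positive even
    when \<open>F = d F + P\<close>.\<close>
  have "line_extension D \<zero> ?F = ?F"
    using line_extension_incr[OF dF D_ideal zero_closed] Fc by (auto elim!: line_extensionE)
  then have "layers ?N (Suc l) ?F"
    using layers.layers_Suc[OF l zero_closed] dsub_zero[OF dF] by auto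
  from layers_exists_fun[OF this dN] obtain G where G: "G 0 = ?N" "G (Suc l) = ?F"
    "\<And>i. i \<le> Suc l \<Longrightarrow> dsub (G i)"
    "\<And>i. i < Suc l \<Longrightarrow> \<exists>w\<in>carrier R. G (Suc i) = line_extension D w (G i) \<and> (\<forall>e\<in>m. e \<otimes> w \<in> G i)" by blast
  define L where "L = Suc l"
  \<comment> \<open>The chain \<open>G\<close> ascends while the filtration descends, hence the
    index \<open>L - i mod L\<close>.\<close>
  define M where "M i = scaled P d (i div L) (G (L - i mod L))" for i
  have L: "0 < L" unfolding L_def by simp
  have sSuc: "scaled P d (Suc q) ?F = scaled P d q (G 0)" for q
    unfolding G(1) by (rule scaled_Suc[OF P.is_ideal Fc d(1)])
  \<comment> \<open>The end \<open>j = L\<close> of one period agrees with the start of the next,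
    since \<open>G 0\<close> is \<open>d F + P\<close>.\<close>
  have key: "M (q * L + j) = scaled P d q (G (L - j))" if "j \<le> L" for q j
  proof (cases "j = L")
    case True
    have "q * L + j = Suc q * L" using True by simp
    then have "M (q * L + j) = scaled P d (Suc q) (G L)" unfolding M_def using L by (simp only: mod_mult_self2_is_0 div_mult_self_is_m) simp
    then show ?thesis using sSuc[of q] G(2) True L_def by simp
  next
    case False
    then have "j < L" using that by simp
    then have "(q * L + j) div L = q" "(q * L + j) mod L = j" by auto
    then show ?thesis unfolding M_def by simp
  qed
  have split: "\<exists>q j. j < L \<and> i = q * L + j" for i
    by (rule exI[of _ "i div L"], rule exI[of _ "i mod L"]) (use L in simp)
  have dM: "dsub (M i)" for i unfolding M_def by (rule dsub_scaled[OF dP _ d(1)]) (use G(3) L_def in auto)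
  have PG: "P \<subseteq> scaled P d k H" if "dsub H" for k H
  proof
    fix p assume "p \<in> P" then show "p \<in> scaled P d k H"
      by (intro scaledI[OF dsub_zero[OF that], of p]) (use P.Icarr dc in auto)
  qed
  have PM: "P \<subseteq> M i" for i unfolding M_def by (rule PG) (use G(3) L_def in auto)
  have simple: "\<exists>u\<in>D. z \<ominus> u \<otimes> y \<in> M (Suc i)" if y: "y \<in> M i" "y \<notin> M (Suc i)" and z: "z \<in> M i" for i y z
  proof -
    obtain q j where qj: "j < L" "i = q * L + j" using split by blast
    let ?k = "L - Suc j"
    have Mi: "M i = scaled P d q (G (Suc ?k))" using key[of j q] qj by (simp add: Suc_diff_Suc)
    have MS: "M (Suc i) = scaled P d q (G ?k)" using key[of "Suc j" q] qj by simp
    obtain w where w: "w \<in> carrier R" "G (Suc ?k) = line_extension D w (G ?k)" "\<And>e. e \<in> m \<Longrightarrow> e \<otimes> w \<in> G ?k"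
    proof -
      have "?k < Suc l" using L_def by simp
      from G(4)[OF this] that show thesis by blast
    qed
    have dG: "dsub (G ?k)" using G(3)[of ?k] L_def by auto
    obtain g p where 1: "g \<in> line_extension D w (G ?k)" "p \<in> P" "y = d [^] q \<otimes> g \<oplus> p"
      using y(1) unfolding Mi w(2) by (rule scaledE)
    obtain h p' where 2: "h \<in> line_extension D w (G ?k)" "p' \<in> P" "z = d [^] q \<otimes> h \<oplus> p'"
      using z unfolding Mi w(2) by (rule scaledE)
    obtain a g' where 3: "a \<in> D" "g' \<in> G ?k" "g = a \<otimes> w \<oplus> g'" using 1(1) by (rule line_extensionE)
    obtain b h' where 4: "b \<in> D" "h' \<in> G ?k" "h = b \<otimes> w \<oplus> h'" using 2(1) by (rule line_extensionE)
    \<comment> \<open>With \<open>a\<close> in \<open>m\<close> the element \<open>y\<close> would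
      lie one layer deeper. So \<open>a\<close> is a unit, and a multiple of \<open>y\<close>
      cancels the \<open>w\<close>-component of \<open>z\<close>.\<close>
    have "a \<notin> m"
    proof
      assume "a \<in> m"
      then have "g \<in> G ?k" unfolding 3(3) using w(3) dsub_add[OF dG _ 3(2)] by blast
      then have "y \<in> M (Suc i)" unfolding MS by (rule scaledI[OF _ 1(2,3)])
      then show False using y by simp
    qed
    then obtain v where v: "v \<in> D" "v \<otimes> a = \<one>" using unit_of_notin_m 3(1) by blast
    let ?u = "b \<otimes> v"
    have u: "?u \<in> D" using v 4 by auto
    have c: "p \<in> carrier R" "p' \<in> carrier R" "g' \<in> carrier R" "h' \<in> carrier R" "a \<in> carrier R" "b \<in> carrier R"
      "v \<in> carrier R" "d [^] q \<in> carrier R"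
      using 1 2 3 4 v d P.Icarr dsub_carrier[OF dG] by auto
    have ua: "?u \<otimes> a = b" using v c by (simp add: m_assoc)
    have uc: "?u \<in> carrier R" using u by simp
    have gh: "g \<in> carrier R" "h \<in> carrier R" unfolding 3(3) 4(3) using c w(1) by auto
    have "h \<ominus> ?u \<otimes> g = (b \<ominus> ?u \<otimes> a) \<otimes> w \<oplus> (h' \<ominus> ?u \<otimes> g')"
      unfolding 3(3) 4(3) using c(3-6) uc w(1) by algebra
    also have "b \<ominus> ?u \<otimes> a = \<zero>" unfolding ua using c by (simp add: a_minus_def r_neg)
    finally have hug: "h \<ominus> ?u \<otimes> g = h' \<ominus> ?u \<otimes> g'" using c w(1) by simp
    have "z \<ominus> ?u \<otimes> y = d [^] q \<otimes> (h \<ominus> ?u \<otimes> g) \<oplus> (p' \<ominus> ?u \<otimes> p)"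
      unfolding 1(3) 2(3) using c(1,2,8) uc gh by algebra
    also note hug
    finally have "z \<ominus> ?u \<otimes> y \<in> M (Suc i)" unfolding MS
      by (rule scaledI[rotated 2]) (use dsub_minus[OF dG 4(2) dsub_smult[OF dG u 3(2)]]
          dsub_minus[OF dP 2(2) dsub_smult[OF dP u 1(2)]] in auto)
    then show ?thesis using u by blast
  qed
  have Gc: "j \<le> L \<Longrightarrow> g \<in> G j \<Longrightarrow> g \<in> carrier R" for j g using G(3) dsub_carrier L_def by blast
  have MaddL: "M (i + L) = scaled P d (Suc (i div L)) (G (L - i mod L))" for i
    unfolding M_def using L by simp
  show thesis
  proof (rule that[of L M, OF L _ dM simple])
    show "M 0 = ?F"
    proof -
      have "M 0 = scaled P d 0 ?F" unfolding M_def using G(2) L_def by simp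
      also have "\<dots> = ?F"
      proof (intro equalityI subsetI)
        fix x assume "x \<in> scaled P d 0 ?F"
        then show "x \<in> ?F" using dsub_add[OF dF] PF Fc by (auto elim!: scaledE simp: subset_iff)
      next
        fix x assume "x \<in> ?F" then show "x \<in> scaled P d 0 ?F"
          by (intro scaledI[OF _ P.zero_closed, of x]) (use Fc in auto)
      qed
      finally show ?thesis .
    qed
  next
    fix i y assume "y \<in> M i"
    then obtain g p where *: "g \<in> G (L - i mod L)" "p \<in> P" "y = d [^] (i div L) \<otimes> g \<oplus> p"
      unfolding M_def by (rule scaledE)
    have c: "g \<in> carrier R" "p \<in> carrier R" "d [^] (i div L) \<in> carrier R" using * Gc[OF _ *(1)] P.Icarr dc by auto
    have "d \<otimes> y = (d [^] (i div L) \<otimes> d) \<otimes> g \<oplus> d \<otimes> p" unfolding *(3) using c dc by algebra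
    then show "d \<otimes> y \<in> M (i + L)" unfolding MaddL
      by (intro scaledI[OF *(1) P.I_l_closed[OF *(2) dc]]) simp
  next
    fix i y assume y: "y \<in> carrier R" "d \<otimes> y \<in> M (i + L)"
    then obtain g p where *: "g \<in> G (L - i mod L)" "p \<in> P" "d \<otimes> y = d [^] Suc (i div L) \<otimes> g \<oplus> p"
      unfolding MaddL by (elim scaledE)
    let ?e = "d [^] (i div L)"
    have c: "g \<in> carrier R" "p \<in> carrier R" "?e \<in> carrier R" using * Gc[OF _ *(1)] P.Icarr dc by auto
    \<comment> \<open>Here \<open>d\<close>, which lies outside the prime \<open>P\<close>, is
      cancelled modulo \<open>P\<close>.\<close>
    have "d \<otimes> (y \<ominus> ?e \<otimes> g) = d \<otimes> y \<ominus> (?e \<otimes> d) \<otimes> g" using c y(1) dc by algebra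
    also have "\<dots> = p" using *(3) c dc by (simp, algebra)
    finally have "y \<ominus> ?e \<otimes> g \<in> P" using P.I_prime[OF dc, of "y \<ominus> ?e \<otimes> g"] *(2) c y d(2) by auto
    moreover have "y = ?e \<otimes> g \<oplus> (y \<ominus> ?e \<otimes> g)" using c y by algebra
    ultimately show "y \<in> M i" unfolding M_def by (intro scaledI[OF *(1)])
  next
    fix k show "M (k * L) = scaled P d k ?F" using key[of 0 k] G(2) L_def by simp
  qed
qed

end

lemma (in abelian_monoid) finsum_extend:
  assumes "\<And>i. f i \<in> carrier G" "\<And>i. n \<le> i \<Longrightarrow> f i = \<zero>" "n \<le> k"
  shows "(\<Oplus>i\<in>{..<k::nat}. f i) = (\<Oplus>i\<in>{..<n}. f i)"
  using assms(3)
proof (induct k rule: dec_induct)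
  case (step k)
  then show ?case using assms by (simp add: lessThan_Suc finsum_insert Pi_def)
qed simp

context noeth_local_subring
begin

text \<open>The coefficients are padded with zeros from \<open>n\<close> on, which lets sums of
  different lengths be compared later.\<close>

lemma span_over_powers_mem:
  assumes P: "ideal P R" and x: "x \<in> carrier R"
  shows "f \<in> span_over (exp_base x n) P \<Longrightarrow>
    \<exists>c. (\<forall>i. c i \<in> D) \<and> (\<forall>i\<ge>n. c i = \<zero>) \<and> (\<exists>p\<in>P. f = (\<Oplus>i\<in>{..<n}. c i \<otimes> x [^] i) \<oplus> p)"
proof (induct n arbitrary: f)
  case 0
  then have "f \<in> P" by (simp add: span_over_def exp_base_def)
  moreover from this have "f \<in> carrier R" using ideal.Icarr[OF P] by auto
  ultimately show ?case by (intro exI[of _ "\<lambda>_. \<zero>"] conjI bexI[of _ f]) auto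
next
  case (Suc n)
  then have "f \<in> line_extension D (x [^] n) (span_over (exp_base x n) P)"
    by (simp add: span_over_def exp_base_def)
  then obtain k v where kv: "k \<in> D" "v \<in> span_over (exp_base x n) P" "f = k \<otimes> x [^] n \<oplus> v"
    by (rule line_extensionE)
  obtain c p where c: "\<And>i. c i \<in> D" "\<And>i. i \<ge> n \<Longrightarrow> c i = \<zero>" "p \<in> P" "v = (\<Oplus>i\<in>{..<n}. c i \<otimes> x [^] i) \<oplus> p"
    using Suc(1)[OF kv(2)] by blast
  have pc: "p \<in> carrier R" using c ideal.Icarr[OF P] by auto
  have "(\<Oplus>i\<in>{..<n}. c i \<otimes> x [^] i) = (\<Oplus>i\<in>{..<n}. (c(n := k)) i \<otimes> x [^] i)"
    by (rule finsum_cong') (use c x in auto)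
  then have "f = (\<Oplus>i\<in>{..<Suc n}. (c(n := k)) i \<otimes> x [^] i) \<oplus> p"
    unfolding kv(3) c(4) using c(1) kv(1) x pc
    by (simp add: lessThan_Suc finsum_insert Pi_def a_assoc)
  then show ?case using c kv by (intro exI[of _ "c(n := k)"] conjI bexI[of _ p]) auto
qed

lemma eval_mem_span_over:
  assumes P: "dsub P" and x: "x \<in> carrier R" and p: "set p \<subseteq> D" "length p \<le> n"
  shows "eval p x \<in> span_over (exp_base x n) P"
  using p
proof (induct p)
  case Nil
  show ?case using dsub_zero[OF dsub_span_over[OF exp_base_closed[OF x] P]] by simp
next
  case (Cons k p)
  have d: "dsub (span_over (exp_base x n) P)" by (rule dsub_span_over[OF exp_base_closed[OF x] P])
  have "x [^] length p \<in> set (exp_base x n)" using Cons(3) by (auto simp: exp_base_def)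
  then have "x [^] length p \<in> span_over (exp_base x n) P" using span_over_gen[OF exp_base_closed[OF x] P] by blast
  then show ?case using Cons d by (auto intro!: dsub_add dsub_smult)
qed

text \<open>The pigeonhole argument behind the Krull--Akizuki theorem, applied to the powers
  \<open>1, x, \<dots>, x^L\<close>, where \<open>L\<close> is the length of \<open>F / d F\<close> for the module \<open>F\<close> of polynomials in \<open>x\<close>
  of degree below \<open>length p\<close>, taken modulo \<open>P\<close>.\<close>

lemma exists_unit_relation:
  assumes P: "primeideal P R" and x: "x \<in> carrier R"
    and p: "set p \<subseteq> D" "\<not> set p \<subseteq> P" "eval p x \<in> P"
    and dimP: "\<And>q. primeideal q DD \<Longrightarrow> P \<inter> D \<subset> q \<Longrightarrow> q = m" and Pm: "P \<inter> D \<subset> m"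
  shows "\<exists>q. set q \<subseteq> D \<and> \<not> set q \<subseteq> m \<and> eval q x \<in> P"
  using p
proof (induct p)
  case (Cons a p)
  interpret P: primeideal P R by (rule P)
  interpret DD: cring DD by (rule DD_cring)
  have dP: "dsub P" unfolding dsub_def using P.I_l_closed P.Icarr by auto
  have a: "a \<in> D" and pD: "set p \<subseteq> D" using Cons by auto
  have ev: "eval p x \<in> carrier R" by (rule eval_in_carrier) (use pD D_carrier x in auto)
  have axp: "a \<otimes> x [^] length p \<oplus> eval p x \<in> P" using Cons(4) by simp
  show ?case
  proof (cases "a \<in> P")
    case True
    then have "a \<otimes> x [^] length p \<in> P" using x P.I_r_closed by auto
    then have "(a \<otimes> x [^] length p \<oplus> eval p x) \<ominus> a \<otimes> x [^] length p \<in> P"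
      using axp dsub_minus[OF dP] by blast
    moreover have "(a \<otimes> x [^] length p \<oplus> eval p x) \<ominus> a \<otimes> x [^] length p = eval p x"
      using a x ev D_carr[OF a] nat_pow_closed[OF x, of "length p"] by algebra
    ultimately show ?thesis using Cons True by auto
  next
    case False
    let ?n = "length p"
    let ?F = "span_over (exp_base x ?n) P"
    have eb: "set (exp_base x ?n) \<subseteq> carrier R" by (rule exp_base_closed[OF x])
    have dF: "dsub ?F" by (rule dsub_span_over[OF eb dP])
    have PF: "P \<subseteq> ?F" by (rule span_over_incr[OF eb dP])
    have powF: "x [^] i \<in> ?F" if "i < ?n" for i
      using span_over_gen[OF eb dP] that by (auto simp: exp_base_def)
    have n: "0 < ?n"
    proof (rule ccontr)
      assume "\<not> ?thesis"
      then have "a \<in> P" using axp a by simp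
      then show False using False by simp
    qed
    have axn: "a \<otimes> x [^] ?n \<in> ?F"
    proof -
      have "(a \<otimes> x [^] ?n \<oplus> eval p x) \<ominus> eval p x \<in> ?F"
        by (rule dsub_minus[OF dF subsetD[OF PF axp] eval_mem_span_over[OF dP x pD order_refl]])
      moreover have "(a \<otimes> x [^] ?n \<oplus> eval p x) \<ominus> eval p x = a \<otimes> x [^] ?n"
        using ev D_carr[OF a] nat_pow_closed[OF x, of ?n] by algebra
      ultimately show ?thesis by simp
    qed
    \<comment> \<open>The relation rewrites \<open>a \<otimes> x [^] ?n\<close> in lower powers
      modulo \<open>P\<close>, so multiplication by \<open>a \<otimes> x\<close> maps
      \<open>?F\<close> into itself and every \<open>a^j x^j\<close> stays in
      \<open>?F\<close>.\<close>
    let ?H = "{f \<in> carrier R. a \<otimes> (x \<otimes> f) \<in> ?F}"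
    have "?F \<subseteq> ?H"
    proof (rule span_over_min)
      show "set (exp_base x ?n) \<subseteq> ?H"
      proof
        fix f assume "f \<in> set (exp_base x ?n)"
        then obtain i where i: "i < ?n" "f = x [^] i" by (auto simp: exp_base_def)
        have "x \<otimes> f = x [^] Suc i" unfolding i(2) using x by (simp add: m_comm)
        then show "f \<in> ?H" using i x axn dsub_smult[OF dF a] powF[of "Suc i"] by (cases "Suc i = ?n") auto
      qed
      show "P \<subseteq> ?H" using PF P.Icarr P.I_l_closed x a by auto
      show "dsub ?H" unfolding dsub_def
      proof (intro conjI ballI)
        fix f g assume fg: "f \<in> ?H" "g \<in> ?H"
        have "a \<otimes> (x \<otimes> (f \<oplus> g)) = a \<otimes> (x \<otimes> f) \<oplus> a \<otimes> (x \<otimes> g)" using fg x a by (simp add: r_distr)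
        then show "f \<oplus> g \<in> ?H" using fg dsub_add[OF dF] by auto
      next
        fix e f assume ef: "e \<in> D" "f \<in> ?H"
        have "a \<otimes> (x \<otimes> (e \<otimes> f)) = e \<otimes> (a \<otimes> (x \<otimes> f))" using ef x a by (simp add: m_lcomm)
        then show "e \<otimes> f \<in> ?H" using ef dsub_smult[OF dF ef(1)] by auto
      qed (use x a dsub_zero[OF dF] in auto)
    qed
    then have axF: "f \<in> ?F \<Longrightarrow> a \<otimes> (x \<otimes> f) \<in> ?F" for f by blast
    have pw: "a [^] j \<otimes> x [^] j \<in> ?F" for j :: nat
    proof (induct j)
      case 0 then show ?case using powF[OF n] by simp
    next
      case (Suc j)
      have "a [^] Suc j \<otimes> x [^] Suc j = a \<otimes> (x \<otimes> (a [^] j \<otimes> x [^] j))" using x a by (simp add: m_ac)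
      then show ?case using axF[OF Suc] by simp
    qed
    obtain d where d: "d \<in> m" "d \<notin> P" using Pm by blast
    have dD: "d \<in> D" using d by auto
    obtain L M where M: "0 < L" "M 0 = ?F" "\<And>i. dsub (M i)"
      "\<And>i y z. y \<in> M i \<Longrightarrow> y \<notin> M (Suc i) \<Longrightarrow> z \<in> M i \<Longrightarrow> \<exists>u\<in>D. z \<ominus> u \<otimes> y \<in> M (Suc i)"
      "\<And>i y. y \<in> M i \<Longrightarrow> d \<otimes> y \<in> M (i + L)"
      "\<And>i y. y \<in> carrier R \<Longrightarrow> d \<otimes> y \<in> M (i + L) \<Longrightarrow> y \<in> M i"
      "\<And>k. M (k * L) = scaled P d k ?F"
      by (rule exists_filtration[OF P dD d(2) dimP eb]) (assumption | rule that)+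
    \<comment> \<open>A single multiplier that brings all of 1, x, ..., x^L into
      \<open>?F\<close>.\<close>
    define b where "b = a [^] L"
    have bD: "b \<in> D" and bP: "b \<notin> P"
    proof -
      show "b \<in> D" unfolding b_def using a by auto
      have "a [^] (k::nat) \<notin> P" for k
      proof (induct k)
        case 0 then show ?case using P.I_notcarr P.one_imp_carrier by auto
      next
        case (Suc k) then show ?case using P.I_prime[of "a [^] k" a] False a by auto
      qed
      then show "b \<notin> P" unfolding b_def .
    qed
    \<comment> \<open>Every prime over \<open>b D + (P \<inter> D)\<close> is \<open>m\<close>,
      which contains \<open>d\<close>; so some power of \<open>d\<close> is a multiple of
      \<open>b\<close> modulo \<open>P\<close>.\<close>
    have "\<exists>r::nat. d [^]\<^bsub>DD\<^esub> r \<in> line_extension D b (P \<inter> D)"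
    proof (rule DD.power_mem_of_primes[OF noethD])
      have PD: "dsub (P \<inter> D)" unfolding dsub_def using P.I_l_closed by auto
      have 1: "dsub (line_extension D b (P \<inter> D))" using dsub_line_extension[OF PD _ D_ideal] bD by auto
      have 2: "line_extension D b (P \<inter> D) \<subseteq> D" by (rule line_extension_sub_D) (use bD in auto)
      show "ideal (line_extension D b (P \<inter> D)) DD" using 1 2 unfolding dsub_def by (intro DD_idealI) auto
      fix Q assume Q: "primeideal Q DD" "line_extension D b (P \<inter> D) \<subseteq> Q"
      have "P \<inter> D \<subset> Q"
        using line_extension_incr[OF PD D_ideal, of b] line_extension_gen[OF PD, of b] bD bP Q by auto
      from dimP[OF Q(1) this] show "d \<in> Q" using d by simp
    qed (use dD in auto)
    then obtain r b' p0 where r: "b' \<in> D" "p0 \<in> P \<inter> D" "d [^] (r::nat) = b' \<otimes> b \<oplus> p0"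
      unfolding DD_pow by (auto elim: line_extensionE)
    \<comment> \<open>All elements start at depth zero. The target lies one period beyond that of
      \<open>d [^] r\<close>, the power divisible by \<open>b\<close> modulo \<open>P\<close>; the
      spare factor \<open>d\<close> puts \<open>t\<close> below into \<open>m\<close>.\<close>
    have "\<exists>c. (\<forall>j. c j \<in> D) \<and> (\<exists>j\<le>L. c j \<notin> m) \<and> (\<Oplus>j\<in>{..L}. c j \<otimes> (b \<otimes> x [^] j)) \<in> M (Suc r * L)"
    proof (rule primitive_combination_deep[where M = M, OF M(3-6) dD M(1)])
      fix j assume "j \<le> L"
      then have "b \<otimes> x [^] j = a [^] (L - j) \<otimes> (a [^] j \<otimes> x [^] j)"
        unfolding b_def using a x by (simp add: m_assoc[symmetric] nat_pow_mult)
      then show "b \<otimes> x [^] j \<in> M 0" unfolding M(2) using dsub_smult[OF dF _ pw, of "a [^] (L - j)"] a by auto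
    qed auto
    then obtain c where c: "\<And>j. c j \<in> D" "\<exists>j\<le>L. c j \<notin> m"
      "(\<Oplus>j\<in>{..L}. c j \<otimes> (b \<otimes> x [^] j)) \<in> scaled P d (Suc r) ?F" unfolding M(7) by blast
    from c(3) obtain f p1 where f: "f \<in> ?F" "p1 \<in> P" "(\<Oplus>j\<in>{..L}. c j \<otimes> (b \<otimes> x [^] j)) = d [^] Suc r \<otimes> f \<oplus> p1"
      by (rule scaledE)
    obtain g p2 where g: "\<And>i. g i \<in> D" "\<And>i. i \<ge> ?n \<Longrightarrow> g i = \<zero>" "p2 \<in> P"
      "f = (\<Oplus>i\<in>{..<?n}. g i \<otimes> x [^] i) \<oplus> p2"
      using span_over_powers_mem[OF P.is_ideal x f(1)] by blast
    \<comment> \<open>A common length for the combination, of degree at most \<open>L\<close>, and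
      the polynomial \<open>f\<close>, of degree below \<open>?n\<close>.\<close>
    define K where "K = max ?n (Suc L)"
    define c' where "c' j = (if j \<le> L then c j else \<zero>)" for j
    have c': "c' j \<in> D" for j unfolding c'_def using c by auto
    let ?s = "\<lambda>c. \<Oplus>i\<in>{..<K}. c i \<otimes> x [^] i"
    have sc: "?s h \<in> carrier R" if "\<And>i. h i \<in> D" for h by (rule finsum_closed) (use that x in auto)
    have f_eq: "f = ?s g \<oplus> p2" unfolding g(4)
      using finsum_extend[of "\<lambda>i. g i \<otimes> x [^] i" ?n K] g(1,2) x K_def by auto
    have "(\<Oplus>j\<in>{..L}. c j \<otimes> (b \<otimes> x [^] j)) = (\<Oplus>j\<in>{..<Suc L}. b \<otimes> (c' j \<otimes> x [^] j))"
      unfolding lessThan_Suc_atMost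
      by (rule finsum_cong') (use c(1) c' bD x in \<open>auto simp: m_lcomm c'_def\<close>)
    also have "\<dots> = b \<otimes> (\<Oplus>j\<in>{..<Suc L}. c' j \<otimes> x [^] j)"
      by (rule finsum_rdistr[symmetric]) (use c' bD x in auto)
    also have "(\<Oplus>j\<in>{..<Suc L}. c' j \<otimes> x [^] j) = ?s c'"
      by (rule finsum_extend[symmetric]) (use c' x K_def in \<open>auto simp: c'_def\<close>)
    finally have e1: "b \<otimes> ?s c' = d [^] Suc r \<otimes> f \<oplus> p1" using f(3) by simp
    define t where "t = b' \<otimes> d"
    have tm: "t \<in> m" and tD: "t \<in> D" unfolding t_def using r(1) d(1) by auto
    define s1 s2 where s1: "s1 = ?s c'" and s2: "s2 = ?s g"
    have s1c: "s1 \<in> carrier R" unfolding s1 by (rule sc[OF c'])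
    have s2c: "s2 \<in> carrier R" unfolding s2 by (rule sc[OF g(1)])
    note e1 = e1[folded s1] and f_eq = f_eq[folded s2]
    have cc: "b \<in> carrier R" "t \<in> carrier R" "d \<in> carrier R" "b' \<in> carrier R" "p0 \<in> carrier R" "p1 \<in> carrier R" "p2 \<in> carrier R"
      "s1 \<in> carrier R" "s2 \<in> carrier R" "f \<in> carrier R"
      using bD tD dD r f g P.Icarr dsub_carrier[OF dF f(1)] s1c s2c by blast+
    \<comment> \<open>Modulo \<open>P\<close> the element \<open>b \<otimes> s1\<close> equals
      \<open>b \<otimes> t \<otimes> s2\<close>; cancelling \<open>b\<close>, which is outside
      \<open>P\<close>, leaves a relation.\<close>
    have "b \<otimes> (s1 \<ominus> t \<otimes> s2) = b \<otimes> s1 \<ominus> b \<otimes> (t \<otimes> s2)" using cc by algebra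
    also have "b \<otimes> s1 = (b' \<otimes> b \<oplus> p0) \<otimes> d \<otimes> f \<oplus> p1" using e1 r(3) by simp
    also have "\<dots> \<ominus> b \<otimes> (t \<otimes> s2) = b \<otimes> t \<otimes> p2 \<oplus> (d \<otimes> f) \<otimes> p0 \<oplus> p1"
      unfolding t_def f_eq using cc unfolding t_def by algebra
    also have "\<dots> \<in> P" using cc g(3) f(2) r(2) by (auto intro!: P.a_closed P.I_l_closed)
    finally have rel: "s1 \<ominus> t \<otimes> s2 \<in> P" using P.I_prime[of b "s1 \<ominus> t \<otimes> s2"] bP cc by auto
    let ?q = "\<lambda>j. c' j \<ominus> t \<otimes> g j"
    have q: "?q j \<in> D" for j using c' g tD by auto
    have "?s ?q \<oplus> t \<otimes> ?s g = ?s c'"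
    proof -
      have "t \<otimes> ?s g = (\<Oplus>i\<in>{..<K}. t \<otimes> (g i \<otimes> x [^] i))"
        by (rule finsum_rdistr) (use g tD x in auto)
      then have "?s ?q \<oplus> t \<otimes> ?s g = (\<Oplus>i\<in>{..<K}. ?q i \<otimes> x [^] i \<oplus> t \<otimes> (g i \<otimes> x [^] i))"
        using finsum_addf[of "\<lambda>i. ?q i \<otimes> x [^] i" "{..<K}" "\<lambda>i. t \<otimes> (g i \<otimes> x [^] i)"] q g tD x by auto
      also have "\<dots> = ?s c'"
      proof (rule finsum_cong')
        fix i assume "i \<in> {..<K}"
        have "x [^] i \<in> carrier R" using x by simp
        then show "?q i \<otimes> x [^] i \<oplus> t \<otimes> (g i \<otimes> x [^] i) = c' i \<otimes> x [^] i"
          using D_carr[OF c', of i] D_carr[OF g(1), of i] cc(2) by algebra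
      qed (use c' x in auto)
      finally show ?thesis .
    qed
    then have s3: "?s ?q \<oplus> t \<otimes> s2 = s1" unfolding s1 s2 .
    have "?s ?q = (?s ?q \<oplus> t \<otimes> s2) \<ominus> t \<otimes> s2"
      using cc sc[OF q] by (simp add: a_minus_def a_assoc r_neg)
    then have "?s ?q \<in> P" using rel s3 by simp
    then have "eval (map ?q (rev [0..<K])) x \<in> P" using eval_map_rev[of ?q x K] q x by auto
    moreover have "set (map ?q (rev [0..<K])) \<subseteq> D" using q by auto
    \<comment> \<open>Since \<open>t\<close> lies in \<open>m\<close>, the coefficients up to index
      \<open>L\<close> agree with those of \<open>c\<close> modulo \<open>m\<close>, and one of the
      latter is a unit.\<close>
    moreover have "\<not> set (map ?q (rev [0..<K])) \<subseteq> m"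
    proof -
      obtain j where j: "j \<le> L" "c j \<notin> m" using c(2) by blast
      have "?q j \<notin> m"
      proof
        assume "?q j \<in> m"
        then have "?q j \<oplus> t \<otimes> g j \<in> m" using tm g by auto
        moreover have "?q j \<oplus> t \<otimes> g j = c j" using D_carr[OF c(1)[of j]] D_carr[OF g(1)[of j]] cc(2) j(1)
          unfolding c'_def by (simp, algebra)
        ultimately show False using j by simp
      qed
      moreover have "j < K" using j unfolding K_def by simp
      ultimately show ?thesis by (auto simp: image_subset_iff)
    qed
    ultimately show ?thesis by blast
  qed
qed simp

end

section \<open>Finiteness over the residue field\<close>

text \<open>The adjoined element goes to a root in \<open>L\<close> of the image of its minimal
  polynomial.\<close>

lemma (in field) extend_hom_to_simple_extension:
  fixes L :: "('c, 'd) ring_scheme"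
  assumes S: "subfield S R" and \<phi>: "\<phi> \<in> ring_hom (R\<lparr>carrier := S\<rparr>) L" and L: "algebraically_closed L"
    and x: "x \<in> carrier R" "(algebraic over S) x"
  shows "\<exists>\<psi>\<in>ring_hom (R\<lparr>carrier := simple_extension S x\<rparr>) L. \<forall>s\<in>S. \<psi> s = \<phi> s"
proof -
  interpret L: algebraically_closed L by (rule L)
  have Sr: "subring S R" using S by (rule subfieldE)
  have Sc: "S \<subseteq> carrier R" using S by (rule subfieldE)
  have fS: "field (R\<lparr>carrier := S\<rparr>)" using subfield_iff(2)[OF S] .
  interpret SS: field "R\<lparr>carrier := S\<rparr>" by (rule fS)
  interpret H: ring_hom_ring "R\<lparr>carrier := S\<rparr>" L \<phi>
    by (rule ring_hom_ringI2[OF SS.ring_axioms L.ring_axioms \<phi>])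
  let ?f = "Irr S x"
  have f: "?f \<in> carrier (S[X])" "pirreducible S ?f" "eval ?f x = \<zero>" using IrrE[OF S x] by auto
  have fL: "map \<phi> ?f \<in> carrier (poly_ring L)"
    using polynomial_hom[OF \<phi> fS L.field_axioms, of ?f] f(1) univ_poly_consistent[OF Sr] by simp
  have deg: "degree (map \<phi> ?f) \<ge> 1" using pirreducible_degree[OF S f(1,2)] by simp
  have "L.splitted (map \<phi> ?f)" using L.roots_over_carrier[OF fL] .
  then have "L.roots (map \<phi> ?f) \<noteq> {#}" using deg unfolding L.splitted_def by auto
  then obtain y where "y \<in># L.roots (map \<phi> ?f)" by blast
  then have y: "y \<in> carrier L" "L.eval (map \<phi> ?f) y = \<zero>\<^bsub>L\<^esub>"
    using L.roots_mem_iff_is_root[OF fL] unfolding L.is_root_def by auto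
  define ev where "ev p = L.eval (map \<phi> p) y" for p
  have pS: "set p \<subseteq> S" if "p \<in> carrier (S[X])" for p
    using that polynomial_incl unfolding univ_poly_carrier[symmetric] by blast
  have pL: "set (map \<phi> p) \<subseteq> carrier L" if "set p \<subseteq> S" for p using that H.hom_closed by auto
  have evc: "ev p \<in> carrier L" if "p \<in> carrier (S[X])" for p
    unfolding ev_def by (rule L.eval_in_carrier[OF pL[OF pS[OF that]] y(1)])
  interpret UP: domain "S[X]" using univ_poly_is_domain[OF Sr] .
  interpret T: ring_hom_ring "S[X]" L ev
  proof (rule ring_hom_ringI[OF UP.ring_axioms L.ring_axioms evc])
    fix p q assume p: "p \<in> carrier (S[X])" and q: "q \<in> carrier (S[X])"
    note S = pS[OF p] pS[OF q]
    have "ev (poly_mult p q) = L.eval (L.normalize (map \<phi> (poly_mult p q))) y"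
      unfolding ev_def by (rule L.eval_normalize[symmetric])
        (use pL[OF pS[OF UP.m_closed[OF p q]]] y in \<open>auto simp: univ_poly_mult\<close>)
    also have "L.normalize (map \<phi> (poly_mult p q)) = L.poly_mult (map \<phi> p) (map \<phi> q)"
      using H.poly_mult_hom'[of p q] S poly_mult_consistent[OF Sr] by simp
    also have "L.eval \<dots> y = ev p \<otimes>\<^bsub>L\<^esub> ev q"
      unfolding ev_def by (rule L.eval_poly_mult[OF pL[OF S(1)] pL[OF S(2)] y(1)])
    finally show "ev (p \<otimes>\<^bsub>S[X]\<^esub> q) = ev p \<otimes>\<^bsub>L\<^esub> ev q" by (simp add: univ_poly_mult)
    have "ev (poly_add p q) = L.eval (L.normalize (map \<phi> (poly_add p q))) y"
      unfolding ev_def by (rule L.eval_normalize[symmetric])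
        (use pL[OF pS[OF UP.a_closed[OF p q]]] y in \<open>auto simp: univ_poly_add\<close>)
    also have "L.normalize (map \<phi> (poly_add p q)) = L.poly_add (map \<phi> p) (map \<phi> q)"
      using H.poly_add_hom'[of p q] S poly_add_consistent[OF Sr] by simp
    also have "L.eval \<dots> y = ev p \<oplus>\<^bsub>L\<^esub> ev q"
      unfolding ev_def by (rule L.eval_poly_add[OF pL[OF S(1)] pL[OF S(2)] y(1)])
    finally show "ev (p \<oplus>\<^bsub>S[X]\<^esub> q) = ev p \<oplus>\<^bsub>L\<^esub> ev q" by (simp add: univ_poly_add)
  next
    show "ev \<one>\<^bsub>S[X]\<^esub> = \<one>\<^bsub>L\<^esub>" unfolding ev_def univ_poly_one using H.hom_one y by auto
  qed
  interpret E: ring_hom_ring "S[X]" R "\<lambda>p. eval p x" by (rule eval_ring_hom[OF Sr x(1)])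
  have ker: "ev p = \<zero>\<^bsub>L\<^esub>" if p: "p \<in> carrier (S[X])" "eval p x = \<zero>" for p
  proof -
    have "?f pdivides p" by (rule Irr_minimal[OF S x p])
    then obtain q where q: "q \<in> carrier (S[X])" "p = ?f \<otimes>\<^bsub>S[X]\<^esub> q"
      using pdivides_iff_shell[OF S f(1) p(1)] by (auto elim: dividesE)
    have "ev ?f = \<zero>\<^bsub>L\<^esub>" unfolding ev_def by (rule y(2))
    then show ?thesis unfolding q(2) T.hom_mult[OF f(1) q(1)] using evc[OF q(1)] by simp
  qed
  have wd: "ev p = ev q" if p: "p \<in> carrier (S[X])" "q \<in> carrier (S[X])" "eval p x = eval q x" for p q
  proof -
    have "eval (p \<ominus>\<^bsub>S[X]\<^esub> q) x = eval p x \<ominus> eval q x"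
      unfolding a_minus_def using p by simp
    also have "\<dots> = \<zero>" using p E.hom_closed by simp
    finally have "ev (p \<ominus>\<^bsub>S[X]\<^esub> q) = \<zero>\<^bsub>L\<^esub>" using ker p by auto
    moreover have "ev (p \<ominus>\<^bsub>S[X]\<^esub> q) = ev p \<ominus>\<^bsub>L\<^esub> ev q" unfolding a_minus_def using p by simp
    ultimately show ?thesis using evc p by simp
  qed
  \<comment> \<open>\<open>\<psi>\<close> evaluates a chosen polynomial representative;
    \<open>wd\<close> makes the choice harmless.\<close>
  define \<psi> where "\<psi> z = ev (SOME p. p \<in> carrier (S[X]) \<and> eval p x = z)" for z
  have \<psi>: "\<psi> (eval p x) = ev p" if "p \<in> carrier (S[X])" for p
  proof -
    have "\<exists>q. q \<in> carrier (S[X]) \<and> eval q x = eval p x" using that by blast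
    from someI_ex[OF this] show ?thesis unfolding \<psi>_def using wd that by blast
  qed
  have ext: "simple_extension S x = (\<lambda>p. eval p x) ` carrier (S[X])"
    by (rule simple_extension_as_eval_img[OF Sc x(1)])
  have "\<psi> \<in> ring_hom (R\<lparr>carrier := simple_extension S x\<rparr>) L"
  proof (rule ring_hom_memI)
    fix a assume "a \<in> carrier (R\<lparr>carrier := simple_extension S x\<rparr>)"
    then show "\<psi> a \<in> carrier L" using \<psi> evc unfolding ext by auto
  next
    fix a b assume "a \<in> carrier (R\<lparr>carrier := simple_extension S x\<rparr>)"
      "b \<in> carrier (R\<lparr>carrier := simple_extension S x\<rparr>)"
    then obtain p q where pq: "p \<in> carrier (S[X])" "q \<in> carrier (S[X])" "a = eval p x" "b = eval q x"
      unfolding ext by auto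
    have "a \<otimes> b = eval (p \<otimes>\<^bsub>S[X]\<^esub> q) x" "a \<oplus> b = eval (p \<oplus>\<^bsub>S[X]\<^esub> q) x" using pq by auto
    then show "\<psi> (a \<otimes>\<^bsub>R\<lparr>carrier := simple_extension S x\<rparr>\<^esub> b) = \<psi> a \<otimes>\<^bsub>L\<^esub> \<psi> b"
      "\<psi> (a \<oplus>\<^bsub>R\<lparr>carrier := simple_extension S x\<rparr>\<^esub> b) = \<psi> a \<oplus>\<^bsub>L\<^esub> \<psi> b"
      using \<psi>[OF UP.m_closed[OF pq(1,2)]] \<psi>[OF UP.a_closed[OF pq(1,2)]] \<psi>[OF pq(1)] \<psi>[OF pq(2)] pq by auto
  next
    have "\<psi> (eval \<one>\<^bsub>S[X]\<^esub> x) = \<one>\<^bsub>L\<^esub>" using \<psi>[OF UP.one_closed] by (simp only: T.hom_one)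
    then show "\<psi> \<one>\<^bsub>R\<lparr>carrier := simple_extension S x\<rparr>\<^esub> = \<one>\<^bsub>L\<^esub>" by simp
  qed
  moreover have "\<psi> s = \<phi> s" if s: "s \<in> S" for s
  proof (cases "s = \<zero>")
    case True
    have "\<psi> (eval \<zero>\<^bsub>S[X]\<^esub> x) = \<zero>\<^bsub>L\<^esub>" using \<psi>[of "\<zero>\<^bsub>S[X]\<^esub>"] by simp
    moreover have "\<phi> \<zero> = \<zero>\<^bsub>L\<^esub>" using H.hom_zero by simp
    ultimately show ?thesis using True by simp
  next
    case False
    then have c: "[s] \<in> carrier (S[X])" using s unfolding univ_poly_carrier[symmetric] polynomial_def by auto
    have "eval [s] x = s" using s Sc x by auto
    moreover have "ev [s] = \<phi> s" unfolding ev_def using y H.hom_closed[of s] s by simp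
    ultimately show ?thesis using \<psi>[OF c] by simp
  qed
  ultimately show ?thesis by blast
qed

text \<open>An independent family inside an intermediate field that embeds into \<open>L\<close>
  stays independent there, so its length is at most \<open>N\<close>. A longest such family spans:
  an element outside its span could be adjoined to the intermediate field and the embedding
  extended. Thus one simple extension at a time suffices, with no embedding of the whole
  field.\<close>

lemma (in field) finite_dimension_of_closure:
  fixes L :: "('c, 'd) ring_scheme"
  assumes K: "subfield K R" and \<phi>: "\<phi> \<in> ring_hom (R\<lparr>carrier := K\<rparr>) L" and L: "algebraically_closed L"
    and alg: "\<And>x. x \<in> carrier R \<Longrightarrow> (algebraic over K) x"
    and fin: "ring.finite_dimension L (\<phi> ` K) (carrier L)"
  shows "\<exists>us. set us \<subseteq> carrier R \<and> Span K us = carrier R"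
proof -
  interpret L: algebraically_closed L by (rule L)
  have Kr: "subring K R" using K by (rule subfieldE)
  have Kc: "K \<subseteq> carrier R" using K by (rule subfieldE)
  interpret KK: field "R\<lparr>carrier := K\<rparr>" using subfield_iff(2)[OF K] .
  interpret H: ring_hom_ring "R\<lparr>carrier := K\<rparr>" L \<phi>
    by (rule ring_hom_ringI2[OF KK.ring_axioms L.ring_axioms \<phi>])
  have \<phi>K: "subfield (\<phi> ` K) L"
    using H.img_is_subfield(2)[OF KK.carrier_is_subfield L.one_not_zero] by simp
  obtain N where N: "L.dimension N (\<phi> ` K) (carrier L)" using fin by auto
  define Q where "Q n \<longleftrightarrow> (\<exists>S \<psi> us. subfield S R \<and> K \<subseteq> S \<and> \<psi> \<in> ring_hom (R\<lparr>carrier := S\<rparr>) L \<and>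
      (\<forall>s\<in>K. \<psi> s = \<phi> s) \<and> set us \<subseteq> S \<and> independent K us \<and> length us = n)" for n
  have bound: "n \<le> N" if "Q n" for n
  proof -
    obtain S \<psi> us where S: "subfield S R" "K \<subseteq> S" "\<psi> \<in> ring_hom (R\<lparr>carrier := S\<rparr>) L"
      "\<And>s. s \<in> K \<Longrightarrow> \<psi> s = \<phi> s" "set us \<subseteq> S" "independent K us" "length us = n"
      using \<open>Q n\<close> unfolding Q_def by blast
    have Sr: "subring S R" using S(1) by (rule subfieldE)
    have fS: "field (R\<lparr>carrier := S\<rparr>)" using subfield_iff(2)[OF S(1)] .
    interpret SS: field "R\<lparr>carrier := S\<rparr>" by (rule fS)
    interpret P: ring_hom_ring "R\<lparr>carrier := S\<rparr>" L \<psi>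
      by (rule ring_hom_ringI2[OF SS.ring_axioms L.ring_axioms S(3)])
    have KS: "subfield K (R\<lparr>carrier := S\<rparr>)"
      using SS.subfield_iff(1) subfield_iff(2)[OF K] S(2) by simp
    have indS: "SS.independent K us"
      using S(5,6)
    proof (induct us)
      case (Cons u us)
      then have "u \<notin> Span K us" "independent K us" by (auto elim: independent.cases)
      then show ?case using Cons by (intro SS.li_Cons) (auto simp: Span_consistent[OF Sr])
    qed simp
    have inj: "inj_on \<psi> (carrier (R\<lparr>carrier := S\<rparr>))"
      using non_trivial_field_hom_is_inj[OF S(3) fS L.field_axioms] .
    have "SS.Span K us \<subseteq> carrier (R\<lparr>carrier := S\<rparr>)"
      by (rule SS.Span_in_carrier) (use S Kc in auto)
    then have "inj_on \<psi> (SS.Span K us)" using inj inj_on_subset by blast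
    then have "L.independent (\<psi> ` K) (map \<psi> us)"
      using P.inj_hom_preserves_independent[OF KS L.one_not_zero _ indS] by blast
    moreover have "\<psi> ` K = \<phi> ` K" using S(4) by auto
    ultimately have "L.independent (\<phi> ` K) (map \<psi> us)" by simp
    then have "length (map \<psi> us) \<le> N"
      by (rule L.independent_length_le_dimension[OF \<phi>K N])
        (use S(5) P.hom_closed in auto)
    then show ?thesis using S by simp
  qed
  have "Q 0" unfolding Q_def using K \<phi>
    by (intro exI[of _ K] exI[of _ \<phi>] exI[of _ "[]"]) auto
  define n where "n = (GREATEST n. Q n)"
  have "Q n" unfolding n_def by (rule GreatestI_nat[where P = Q and k = 0 and b = N]) (use \<open>Q 0\<close> bound in auto)
  have max: "k \<le> n" if "Q k" for k unfolding n_def by (rule Greatest_le_nat[where P = Q and b = N]) (use that bound in auto)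
  obtain S \<psi> us where S: "subfield S R" "K \<subseteq> S" "\<psi> \<in> ring_hom (R\<lparr>carrier := S\<rparr>) L"
    "\<And>s. s \<in> K \<Longrightarrow> \<psi> s = \<phi> s" "set us \<subseteq> S" "independent K us" "length us = n"
    using \<open>Q n\<close> unfolding Q_def by blast
  have Sc: "S \<subseteq> carrier R" using S(1) by (rule subfieldE)
  have "carrier R \<subseteq> Span K us"
  proof
    fix x assume x: "x \<in> carrier R"
    show "x \<in> Span K us"
    proof (rule ccontr)
      assume nx: "x \<notin> Span K us"
      have algS: "(algebraic over S) x" using algebraic_mono[OF S(2) alg[OF x]] .
      obtain \<psi>' where \<psi>': "\<psi>' \<in> ring_hom (R\<lparr>carrier := simple_extension S x\<rparr>) L"
        "\<And>s. s \<in> S \<Longrightarrow> \<psi>' s = \<psi> s"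
        using extend_hom_to_simple_extension[OF S(1,3) L x algS] by blast
      let ?E = "simple_extension S x"
      have "subfield ?E R" using simple_extension_is_subfield[OF S(1) x] algS by simp
      moreover have SE: "S \<subseteq> ?E" using simple_extension_incl[OF Sc x] .
      moreover have xE: "x \<in> ?E" using simple_extension_mem[OF subfieldE(1)[OF S(1)] x] .
      moreover have "independent K (x # us)" using li_Cons[OF x nx S(6)] .
      moreover have "\<forall>s\<in>K. \<psi>' s = \<phi> s" using \<psi>'(2) S(2,4) by auto
      ultimately have "Q (Suc n)" unfolding Q_def using \<psi>'(1) S
        by (intro exI[of _ ?E] exI[of _ \<psi>'] exI[of _ "x # us"]) auto
      from max[OF this] show False by simp
    qed
  qed
  moreover have "Span K us \<subseteq> carrier R" by (rule Span_in_carrier[OF Kc order_trans[OF S(5) Sc]])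
  ultimately show ?thesis using order_trans[OF S(5) Sc] by blast
qed

text \<open>The inverse of a nonzero algebraic element lies in the simple extension that it
  generates.\<close>

lemma (in domain) field_of_algebraic:
  assumes K: "subfield K R" and alg: "\<And>x. x \<in> carrier R \<Longrightarrow> (algebraic over K) x"
  shows "field R"
proof -
  have "x \<in> Units R" if x: "x \<in> carrier R" "x \<noteq> \<zero>" for x
  proof -
    have sub: "subfield (simple_extension K x) R" using simple_extension_is_subfield[OF K x(1)] alg[OF x(1)] by simp
    have "x \<in> simple_extension K x" using simple_extension_mem[OF subfieldE(1)[OF K] x(1)] .
    then have "inv x \<in> simple_extension K x - {\<zero>}" "x \<otimes> inv x = \<one>"
      using subfield_m_inv[OF sub, of x] x by auto
    then show ?thesis using x subfieldE(3)[OF sub]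
      unfolding Units_def by (auto simp: m_comm intro!: bexI[of _ "inv x"])
  qed
  moreover have "\<zero> \<notin> Units R" unfolding Units_def by auto
  ultimately have "Units R = carrier R - {\<zero>}" by auto
  then show ?thesis using domain_axioms by (intro field.intro field_axioms.intro) auto
qed

section \<open>Finite generation over the local subring\<close>

context noeth_local_subring
begin

definition fin_over :: "'a set \<Rightarrow> bool" where
  "fin_over I \<longleftrightarrow> (\<exists>us. set us \<subseteq> carrier R \<and> span_over us I = carrier R)"

lemma dsub_ideal: "ideal I R \<Longrightarrow> dsub I"
  unfolding dsub_def
  by (intro conjI ballI subsetI; (elim ideal.Icarr | intro additive_subgroup.zero_closed[OF ideal.axioms(1)]
    | erule additive_subgroup.a_closed[OF ideal.axioms(1)] | erule ideal.I_l_closed); simp)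

text \<open>A maximal exception \<open>M\<close> is not prime, so it contains some
  \<open>a \<otimes> b\<close> with neither factor in it. Then \<open>M + R a\<close> and the colon
  ideal \<open>(M : a)\<close> are both larger, and \<open>R / M\<close> is an extension of
  \<open>R / (M + R a)\<close> by a copy of \<open>R / (M : a)\<close>.\<close>

lemma fin_over_of_primes:
  assumes fg: "\<And>J. ideal J R \<Longrightarrow> I0 \<subseteq> J \<Longrightarrow> fg_ideal R J" and I0: "ideal I0 R"
    and primes: "\<And>Q. primeideal Q R \<Longrightarrow> I0 \<subseteq> Q \<Longrightarrow> fin_over Q"
  shows "fin_over I0"
proof (rule ccontr)
  assume no: "\<not> ?thesis"
  let ?C = "{I. ideal I R \<and> I0 \<subseteq> I \<and> \<not> fin_over I}"
  have "?C \<noteq> {}" using I0 no by blast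
  then obtain M where M: "M \<in> ?C" "\<And>J. J \<in> ?C \<Longrightarrow> M \<subseteq> J \<Longrightarrow> J = M"
    by (rule maximal_condition[of I0 ?C, rotated]) (use fg in auto)
  then have Mi: "ideal M R" and IM: "I0 \<subseteq> M" and nM: "\<not> fin_over M" by auto
  interpret M: ideal M R by (rule Mi)
  have "carrier R \<noteq> M"
  proof
    assume "carrier R = M"
    then have "fin_over M" unfolding fin_over_def span_over_def by (intro exI[of _ "[]"]) auto
    with nM show False by simp
  qed
  moreover have "\<not> primeideal M R" using primes[OF _ IM] nM by blast
  ultimately obtain a b where ab: "a \<in> carrier R" "b \<in> carrier R" "a \<otimes> b \<in> M" "a \<notin> M" "b \<notin> M"
    using primeidealI[OF Mi cring_axioms] by blast
  let ?J1 = "line_extension (carrier R) a M"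
  let ?J2 = "{c \<in> carrier R. a \<otimes> c \<in> M}"
  have J1: "ideal ?J1 R"
  proof (rule ideal_of_closed)
    show "?J1 \<subseteq> carrier R" using ab M.Icarr by (auto elim!: line_extensionE)
    show "\<zero> \<in> ?J1" by (rule line_extensionI[of \<zero> _ \<zero>]) (use ab M.zero_closed in auto)
  next
    fix x y assume "x \<in> ?J1" "y \<in> ?J1"
    then obtain c i e j where *: "c \<in> carrier R" "i \<in> M" "x = c \<otimes> a \<oplus> i" "e \<in> carrier R" "j \<in> M" "y = e \<otimes> a \<oplus> j"
      by (elim line_extensionE) blast
    have "x \<oplus> y = (c \<oplus> e) \<otimes> a \<oplus> (i \<oplus> j)" unfolding *(3,6) using * ab(1) M.Icarr[OF *(2)] M.Icarr[OF *(5)] by algebra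
    then show "x \<oplus> y \<in> ?J1" by (rule line_extensionI[rotated 2]) (use * M.a_closed in auto)
  next
    fix d x assume d: "d \<in> carrier R" and "x \<in> ?J1"
    then obtain c i where *: "c \<in> carrier R" "i \<in> M" "x = c \<otimes> a \<oplus> i" by (elim line_extensionE) blast
    have "d \<otimes> x = (d \<otimes> c) \<otimes> a \<oplus> d \<otimes> i" unfolding *(3) using * ab(1) M.Icarr[OF *(2)] d by algebra
    then show "d \<otimes> x \<in> ?J1" by (rule line_extensionI[rotated 2]) (use * d M.I_l_closed in auto)
  qed
  have J2: "ideal ?J2 R"
    by (rule ideal_of_closed) (use ab M.zero_closed M.a_closed M.I_l_closed in \<open>auto simp: r_distr m_lcomm[of a]\<close>)
  have MJ1: "M \<subseteq> ?J1"
  proof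
    fix i assume "i \<in> M" then show "i \<in> ?J1"
      by (intro line_extensionI[of \<zero> _ i]) (use ab M.Icarr in auto)
  qed
  have "a \<in> ?J1" by (rule line_extensionI[of \<one> _ \<zero>]) (use ab M.zero_closed in auto)
  then have f1: "fin_over ?J1" using M(2)[of ?J1] MJ1 J1 IM ab(4) by blast
  have MJ2: "M \<subseteq> ?J2" using M.Icarr M.I_l_closed ab(1) by auto
  have "b \<in> ?J2" using ab by auto
  then have f2: "fin_over ?J2" using M(2)[of ?J2] MJ2 J2 IM ab(5) by blast
  obtain us1 us2 where us: "set us1 \<subseteq> carrier R" "span_over us1 ?J1 = carrier R"
    "set us2 \<subseteq> carrier R" "span_over us2 ?J2 = carrier R" using f1 f2 unfolding fin_over_def by blast
  \<comment> \<open>\<open>us1\<close> generates modulo \<open>M + R a\<close>, and the multiples of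
    \<open>us2\<close> by \<open>a\<close> generate \<open>a R\<close> modulo
    \<open>M\<close>.\<close>
  let ?us = "us1 @ map ((\<otimes>) a) us2"
  let ?F = "span_over ?us M"
  have usc: "set ?us \<subseteq> carrier R" using us ab by auto
  have dM: "dsub M" by (rule dsub_ideal[OF Mi])
  have dF: "dsub ?F" by (rule dsub_span_over[OF usc dM])
  have gen: "set ?us \<subseteq> ?F" by (rule span_over_gen[OF usc dM])
  have MF: "M \<subseteq> ?F" by (rule span_over_incr[OF usc dM])
  let ?H = "{c \<in> carrier R. a \<otimes> c \<in> ?F}"
  have "span_over us2 ?J2 \<subseteq> ?H"
  proof (rule span_over_min)
    show "set us2 \<subseteq> ?H" using gen us by auto
    show "?J2 \<subseteq> ?H" using MF by auto
    show "dsub ?H" unfolding dsub_def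
      using ab(1) dsub_zero[OF dF] dsub_add[OF dF] dsub_smult[OF dF] by (auto simp: r_distr m_lcomm[of a])
  qed
  then have aF: "a \<otimes> c \<in> ?F" if "c \<in> carrier R" for c using us(4) that by blast
  have "span_over us1 ?J1 \<subseteq> ?F"
  proof (rule span_over_min[OF _ _ dF])
    show "set us1 \<subseteq> ?F" using gen by auto
    show "?J1 \<subseteq> ?F"
    proof
      fix x assume "x \<in> ?J1"
      then obtain c i where *: "c \<in> carrier R" "i \<in> M" "x = c \<otimes> a \<oplus> i" by (elim line_extensionE) blast
      then show "x \<in> ?F" using dsub_add[OF dF aF[OF *(1)]] MF ab(1) by (auto simp: m_comm)
    qed
  qed
  then have "fin_over M" unfolding fin_over_def using us(2) usc dF unfolding dsub_def by blast
  with nM show False by simp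
qed

text \<open>A relation with a unit coefficient stays nontrivial modulo \<open>Q\<close>, so
  \<open>R / Q\<close> is algebraic over the residue field of \<open>D\<close>. Hence it is a field,
  and its degree is bounded by that of the algebraic closure.\<close>

lemma fin_over_residue:
  assumes Q: "primeideal Q R" and mQ: "m \<subseteq> Q"
    and rel: "\<And>x. x \<in> carrier R \<Longrightarrow> \<exists>q. set q \<subseteq> D \<and> \<not> set q \<subseteq> m \<and> eval q x \<in> Q"
    and clos: "finite_closure_degree (DD Quot m)"
  shows "fin_over Q"
proof -
  interpret Q: primeideal Q R by (rule Q)
  interpret DD: cring DD by (rule DD_cring)
  interpret m: maximalideal m DD by (rule m_max)
  interpret k: field "DD Quot m" by (rule m.quotient_is_field[OF DD_cring])
  let ?E = "R Quot Q"
  let ?h = "(+>) Q"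
  interpret E: domain ?E by (rule Q.quotient_is_domain)
  interpret h: ring_hom_ring R ?E ?h by (rule Q.rcos_ring_hom_ring)
  let ?g = "(+>\<^bsub>DD\<^esub>) m"
  interpret g: ring_hom_ring DD "DD Quot m" ?g by (rule m.rcos_ring_hom_ring)
  have one: "\<one> \<notin> Q" using Q.I_notcarr Q.one_imp_carrier by blast
  \<comment> \<open>Together with \<open>mQ\<close> this gives \<open>Q \<inter> D = m\<close>, so
    the image \<open>?K\<close> of \<open>D\<close> in \<open>R / Q\<close> is a copy of the residue
    field.\<close>
  have Qm: "x \<in> m" if xD: "x \<in> D" and xQ: "x \<in> Q" for x
  proof (rule ccontr)
    assume "x \<notin> m"
    then obtain v where v: "v \<in> D" "v \<otimes> x = \<one>" by (rule unit_of_notin_m[OF xD])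
    show False using Q.I_l_closed[OF xQ D_carr[OF v(1)]] v(2) one by simp
  qed
  have hsurj: "\<exists>x\<in>carrier R. y = ?h x" if "y \<in> carrier ?E" for y
    using that unfolding FactRing_def A_RCOSETS_def' by auto
  have gsurj: "\<exists>x\<in>D. y = ?g x" if "y \<in> carrier (DD Quot m)" for y
    using that unfolding FactRing_def A_RCOSETS_def' by auto
  have heq: "?h x = ?h y \<longleftrightarrow> x \<ominus> y \<in> Q" if "x \<in> carrier R" "y \<in> carrier R" for x y
    using quotient_eq_iff_same_a_r_cos[OF Q.is_ideal that] by simp
  have h0: "?h x = \<zero>\<^bsub>?E\<^esub> \<longleftrightarrow> x \<in> Q" if "x \<in> carrier R" for x
    using heq[OF that zero_closed] that by (simp add: a_minus_def)
  have minus: "x \<ominus>\<^bsub>DD\<^esub> y = x \<ominus> y" if "x \<in> D" "y \<in> D" for x y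
  proof -
    have "\<ominus>\<^bsub>DD\<^esub> y = \<ominus> y" using DD.minus_equality[of "\<ominus> y" y] that by (simp add: l_neg)
    then show ?thesis by (simp add: a_minus_def)
  qed
  have geq: "?g x = ?g y \<longleftrightarrow> x \<ominus> y \<in> m" if "x \<in> D" "y \<in> D" for x y
    using DD.quotient_eq_iff_same_a_r_cos[OF m.is_ideal, of x y] that minus by simp
  let ?K = "?h ` D"
  have hD: "?h x \<in> carrier ?E" if "x \<in> D" for x using h.hom_closed that by auto
  have Ksub: "subring ?K ?E" by (rule h.img_is_subring[OF D])
  have K: "subfield ?K ?E"
  proof (rule E.subfieldI)
    show "subcring ?K ?E" using E.subcringI'[OF Ksub] .
    have unit: "z \<in> Units (?E\<lparr>carrier := ?K\<rparr>)" if z: "z \<in> ?K" "z \<noteq> \<zero>\<^bsub>?E\<^esub>" for z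
    proof -
      obtain x where x: "x \<in> D" "z = ?h x" using z by blast
      then have "x \<notin> m" using h0[of x] z mQ by auto
      then obtain v where v: "v \<in> D" "v \<otimes> x = \<one>" using unit_of_notin_m x by blast
      have "?h v \<otimes>\<^bsub>?E\<^esub> z = \<one>\<^bsub>?E\<^esub>" unfolding x(2) using v x by (metis D_carr h.hom_mult h.hom_one)
      moreover have "z \<otimes>\<^bsub>?E\<^esub> ?h v = \<one>\<^bsub>?E\<^esub>" using calculation E.m_comm hD v x by simp
      ultimately show ?thesis unfolding Units_def using z v by auto
    qed
    moreover have "\<zero>\<^bsub>?E\<^esub> \<notin> Units (?E\<lparr>carrier := ?K\<rparr>)"
      using hD by (auto simp: Units_def)
    moreover have "Units (?E\<lparr>carrier := ?K\<rparr>) \<subseteq> ?K" unfolding Units_def by auto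
    ultimately show "Units (?E\<lparr>carrier := ?K\<rparr>) = ?K - {\<zero>\<^bsub>?E\<^esub>}" by blast
  qed
  have alg: "(E.algebraic over ?K) z" if z: "z \<in> carrier ?E" for z
  proof -
    obtain x where x: "x \<in> carrier R" "z = ?h x" using hsurj[OF z] by blast
    obtain q where q: "set q \<subseteq> D" "\<not> set q \<subseteq> m" "eval q x \<in> Q" using rel[OF x(1)] by blast
    let ?q = "map ?h q"
    have qE: "set ?q \<subseteq> ?K" using q by auto
    have qc: "set q \<subseteq> carrier R" using q D_carrier by blast
    have ev: "E.eval ?q z = \<zero>\<^bsub>?E\<^esub>"
      unfolding x(2) h.eval_hom'[OF x(1) qc, symmetric] using h0 q(3) Q.Icarr by auto
    have "E.eval (E.normalize ?q) z = \<zero>\<^bsub>?E\<^esub>"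
      using E.eval_normalize[of ?q z] ev z subset_trans[OF qE image_subsetI[OF hD]] by simp
    moreover have "E.normalize ?q \<in> carrier (?K [X]\<^bsub>?E\<^esub>)"
      using E.normalize_gives_polynomial[OF qE] unfolding univ_poly_carrier .
    moreover have "E.normalize ?q \<noteq> []"
    proof
      assume "E.normalize ?q = []"
      then have "set ?q \<subseteq> {\<zero>\<^bsub>?E\<^esub>}" by (induct q) (auto split: if_splits)
      moreover obtain c where c: "c \<in> set q" "c \<notin> m" using q by blast
      ultimately have "?h c = \<zero>\<^bsub>?E\<^esub>" by auto
      then have "c \<in> Q" using h0 c qc by blast
      then show False using Qm c q by blast
    qed
    ultimately show ?thesis by (intro E.algebraicI) auto
  qed
  interpret E: field ?E by (rule E.field_of_algebraic[OF K alg])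
  let ?L = "k.alg_closure"
  interpret L: algebraic_closure ?L "k.indexed_const ` carrier (DD Quot m)" by (rule k.alg_closureE(1))
  interpret c: ring_hom_ring "DD Quot m" ?L "k.indexed_const"
    by (rule ring_hom_ringI2[OF k.ring_axioms L.ring_axioms k.alg_closureE(2)])
  \<comment> \<open>\<open>\<phi>\<close> is the isomorphism from \<open>?K\<close> to
    \<open>DD Quot m\<close> followed by the inclusion into the closure, given through
    representatives in \<open>D\<close>.\<close>
  define \<phi> :: "'a set \<Rightarrow> ('a set list \<times> nat) multiset \<Rightarrow> 'a set"
    where "\<phi> z = k.indexed_const (?g (SOME d. d \<in> D \<and> ?h d = z))" for z
  have \<phi>: "\<phi> (?h d) = k.indexed_const (?g d)" if d: "d \<in> D" for d
  proof -
    have "\<exists>e. e \<in> D \<and> ?h e = ?h d" using d by blast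
    from someI_ex[OF this] have s: "(SOME e. e \<in> D \<and> ?h e = ?h d) \<in> D" "?h (SOME e. e \<in> D \<and> ?h e = ?h d) = ?h d" by auto
    have "?g (SOME e. e \<in> D \<and> ?h e = ?h d) = ?g d"
      unfolding geq[OF s(1) d] using s(2) heq[OF D_carr[OF s(1)] D_carr[OF d]] Qm D_minus[OF s(1) d] by blast
    then show ?thesis unfolding \<phi>_def by simp
  qed
  have "\<phi> \<in> ring_hom (?E\<lparr>carrier := ?K\<rparr>) ?L"
  proof (rule ring_hom_memI)
    fix a b assume "a \<in> carrier (?E\<lparr>carrier := ?K\<rparr>)" "b \<in> carrier (?E\<lparr>carrier := ?K\<rparr>)"
    then obtain x y where xy: "x \<in> D" "y \<in> D" "a = ?h x" "b = ?h y" by auto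
    have "?h x \<otimes>\<^bsub>?E\<^esub> ?h y = ?h (x \<otimes> y)" "?h x \<oplus>\<^bsub>?E\<^esub> ?h y = ?h (x \<oplus> y)" using xy by auto
    moreover have "?g (x \<otimes> y) = ?g x \<otimes>\<^bsub>DD Quot m\<^esub> ?g y" "?g (x \<oplus> y) = ?g x \<oplus>\<^bsub>DD Quot m\<^esub> ?g y"
      using g.hom_mult[of x y] g.hom_add[of x y] xy by auto
    moreover have "?g x \<in> carrier (DD Quot m)" "?g y \<in> carrier (DD Quot m)" using g.hom_closed xy by auto
    ultimately show "\<phi> (a \<otimes>\<^bsub>?E\<lparr>carrier := ?K\<rparr>\<^esub> b) = \<phi> a \<otimes>\<^bsub>?L\<^esub> \<phi> b"
      "\<phi> (a \<oplus>\<^bsub>?E\<lparr>carrier := ?K\<rparr>\<^esub> b) = \<phi> a \<oplus>\<^bsub>?L\<^esub> \<phi> b"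
      using \<phi>[of "x \<otimes> y"] \<phi>[of "x \<oplus> y"] \<phi>[of x] \<phi>[of y] xy by (auto simp del: h.hom_mult h.hom_add)
  next
    fix a assume "a \<in> carrier (?E\<lparr>carrier := ?K\<rparr>)"
    then obtain x where "x \<in> D" "a = ?h x" by auto
    then show "\<phi> a \<in> carrier ?L" using \<phi> g.hom_closed c.hom_closed by auto
  next
    have "\<phi> (?h \<one>) = \<one>\<^bsub>?L\<^esub>" using \<phi>[OF D_one] g.hom_one c.hom_one by simp
    then show "\<phi> \<one>\<^bsub>?E\<lparr>carrier := ?K\<rparr>\<^esub> = \<one>\<^bsub>?L\<^esub>" by simp
  qed
  moreover have "\<phi> ` ?K = k.indexed_const ` carrier (DD Quot m)"
  proof -
    have "\<phi> ` ?K = (\<lambda>d. k.indexed_const (?g d)) ` D" unfolding image_image using \<phi> by (rule image_cong[OF refl])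
    also have "\<dots> = k.indexed_const ` (?g ` D)" unfolding image_image ..
    also have "?g ` D = carrier (DD Quot m)" using gsurj g.hom_closed by auto
    finally show ?thesis .
  qed
  ultimately obtain vs where vs: "set vs \<subseteq> carrier ?E" "E.Span ?K vs = carrier ?E"
    using E.finite_dimension_of_closure[OF K _ L.algebraically_closed_axioms alg, of \<phi>] clos
    unfolding finite_closure_degree_def by auto
  \<comment> \<open>Generators over \<open>?K\<close> are lifted to \<open>R\<close>, with
    \<open>Q\<close> absorbing the ambiguity.\<close>
  have lift: "\<exists>us. set us \<subseteq> carrier R \<and> (\<forall>a\<in>carrier R. ?h a \<in> E.Span ?K vs \<longrightarrow> a \<in> span_over us Q)"
    using vs(1)
  proof (induct vs)
    case Nil
    have "a \<in> span_over [] Q" if "a \<in> carrier R" "?h a \<in> E.Span ?K []" for a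
      using that h0 unfolding span_over_def by simp
    then show ?case by (intro exI[of _ "[]"]) auto
  next
    case (Cons v vs)
    then obtain us where us: "set us \<subseteq> carrier R" "\<And>a. a \<in> carrier R \<Longrightarrow> ?h a \<in> E.Span ?K vs \<Longrightarrow> a \<in> span_over us Q"
      by auto
    obtain u where u: "u \<in> carrier R" "v = ?h u" using hsurj[of v] Cons by auto
    have dQ: "dsub (span_over (u # us) Q)"
      by (rule dsub_span_over[OF _ dsub_ideal[OF Q.is_ideal]]) (use us u in auto)
    have QS: "Q \<subseteq> span_over (u # us) Q"
      by (rule span_over_incr[OF _ dsub_ideal[OF Q.is_ideal]]) (use us u in auto)
    have "a \<in> span_over (u # us) Q" if a: "a \<in> carrier R" "?h a \<in> E.Span ?K (v # vs)" for a
    proof -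
      obtain d w where dw: "d \<in> D" "w \<in> E.Span ?K vs" "?h a = ?h d \<otimes>\<^bsub>?E\<^esub> v \<oplus>\<^bsub>?E\<^esub> w"
        using a(2) by (auto simp: E.line_extension_mem_iff simp del: h.hom_closed)
      have "E.Span ?K vs \<subseteq> carrier ?E" by (rule E.Span_in_carrier) (use Cons(2) hD in auto)
      then have "w \<in> carrier ?E" using dw(2) by blast
      then obtain b where b: "b \<in> carrier R" "w = ?h b" using hsurj by blast
      have "?h a = ?h (d \<otimes> u \<oplus> b)" unfolding dw(3) u(2) b(2) using u b dw(1) by auto
      then have "a \<ominus> (d \<otimes> u \<oplus> b) \<in> Q" using heq[OF a(1), of "d \<otimes> u \<oplus> b"] u b dw(1) by auto
      moreover have "d \<otimes> u \<oplus> b \<in> span_over (u # us) Q"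
        using us(2)[OF b(1)] dw b unfolding span_over_def by (auto intro!: line_extensionI)
      ultimately have "(a \<ominus> (d \<otimes> u \<oplus> b)) \<oplus> (d \<otimes> u \<oplus> b) \<in> span_over (u # us) Q"
        using QS dsub_add[OF dQ] by blast
      moreover have "(a \<ominus> (d \<otimes> u \<oplus> b)) \<oplus> (d \<otimes> u \<oplus> b) = a"
        using a(1) u(1) b(1) D_carr[OF dw(1)] by algebra
      ultimately show ?thesis by simp
    qed
    then show ?case using us u by (intro exI[of _ "u # us"]) auto
  qed
  then obtain us where us: "set us \<subseteq> carrier R" "\<And>a. a \<in> carrier R \<Longrightarrow> a \<in> span_over us Q"
    using vs(2) h.hom_closed by auto
  have "span_over us Q \<subseteq> carrier R"
    using dsub_span_over[OF us(1) dsub_ideal[OF Q.is_ideal]] unfolding dsub_def by blast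
  then show ?thesis unfolding fin_over_def using us by blast
qed

end

section \<open>Krull intersection and completeness\<close>

text \<open>The choice of \<open>M\<close>, maximal among the ideals meeting \<open>R x\<close> inside \<open>I0 + J x\<close>, replaces the
  Artin--Rees lemma.\<close>

lemma (in cring) krull_intersection:
  assumes fg: "\<And>K. ideal K R \<Longrightarrow> I0 \<subseteq> K \<Longrightarrow> fg_ideal R K" and I0: "ideal I0 R"
    and J: "ideal J R" and x: "x \<in> carrier R" "\<And>n::nat. x \<in> J [^]\<^bsub>ideals_set R\<^esub> n"
  shows "\<exists>e\<in>J. x \<ominus> e \<otimes> x \<in> I0"
proof -
  interpret I0: ideal I0 R by (rule I0)
  interpret J: ideal J R by (rule J)
  let ?B = "line_extension J x I0"
  have C0: "ideal ?B R"
  proof (rule ideal_of_closed)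
    show "?B \<subseteq> carrier R" using x J.Icarr I0.Icarr by (auto simp: line_extension_mem_iff)
    show "\<zero> \<in> ?B" unfolding line_extension_mem_iff by (intro bexI[of _ \<zero>]) (use x in auto)
  next
    fix a b assume "a \<in> ?B" "b \<in> ?B"
    then obtain c i e j where *: "c \<in> J" "i \<in> I0" "a = c \<otimes> x \<oplus> i" "e \<in> J" "j \<in> I0" "b = e \<otimes> x \<oplus> j"
      unfolding line_extension_mem_iff by blast
    have "a \<oplus> b = (c \<oplus> e) \<otimes> x \<oplus> (i \<oplus> j)" unfolding *(3,6)
      using J.Icarr[OF *(1)] J.Icarr[OF *(4)] x(1) I0.Icarr[OF *(2)] I0.Icarr[OF *(5)] by algebra
    then show "a \<oplus> b \<in> ?B" unfolding line_extension_mem_iff using I0.a_closed[OF *(2,5)] J.a_closed[OF *(1,4)] by blast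
  next
    fix d a assume d: "d \<in> carrier R" and "a \<in> ?B"
    then obtain c i where *: "c \<in> J" "i \<in> I0" "a = c \<otimes> x \<oplus> i" unfolding line_extension_mem_iff by blast
    have "d \<otimes> a = (d \<otimes> c) \<otimes> x \<oplus> d \<otimes> i" unfolding *(3)
      using J.Icarr[OF *(1)] x(1) I0.Icarr[OF *(2)] d by algebra
    then show "d \<otimes> a \<in> ?B" unfolding line_extension_mem_iff using I0.I_l_closed[OF *(2) d] J.I_l_closed[OF *(1) d] by blast
  qed
  have IC0: "I0 \<subseteq> ?B"
  proof
    fix i assume i: "i \<in> I0"
    then have "i = \<zero> \<otimes> x \<oplus> i" using x I0.Icarr by simp
    then show "i \<in> ?B" unfolding line_extension_mem_iff using i J.zero_closed by blast
  qed
  have JC0: "e \<otimes> x \<in> ?B" if "e \<in> J" for e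
  proof -
    have "e \<otimes> x = e \<otimes> x \<oplus> \<zero>" using that x J.Icarr by simp
    then show ?thesis unfolding line_extension_mem_iff using that I0.zero_closed by blast
  qed
  let ?C = "{C. ideal C R \<and> ?B \<subseteq> C \<and> (\<forall>r\<in>carrier R. r \<otimes> x \<in> C \<longrightarrow> r \<otimes> x \<in> ?B)}"
  have "?C \<noteq> {}" using C0 by blast
  then obtain M where M: "M \<in> ?C" "\<And>K. K \<in> ?C \<Longrightarrow> M \<subseteq> K \<Longrightarrow> K = M"
    by (rule maximal_condition[of I0 ?C, rotated]) (use fg IC0 in auto)
  then have Mi: "ideal M R" and CM: "?B \<subseteq> M" and Mx: "\<And>r. r \<in> carrier R \<Longrightarrow> r \<otimes> x \<in> M \<Longrightarrow> r \<otimes> x \<in> ?B" by auto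
  interpret M: ideal M R by (rule Mi)
  \<comment> \<open>The colon ideals \<open>(M : e^n)\<close> become stationary. For such an
    \<open>n\<close> the ideal \<open>M + R e^n\<close> still meets \<open>R x\<close> inside
    \<open>?B\<close>, so by maximality it equals \<open>M\<close>.\<close>
  have "\<exists>n::nat. e [^] n \<in> M" if e: "e \<in> J" for e
  proof -
    have ec: "e \<in> carrier R" using e J.Icarr by auto
    let ?q = "\<lambda>n::nat. {b \<in> carrier R. e [^] n \<otimes> b \<in> M}"
    have q: "ideal (?q n) R" for n
      by (rule ideal_of_closed) (use ec M.zero_closed M.a_closed M.I_l_closed in \<open>auto simp: r_distr m_lcomm[of "e [^] n"]\<close>)
    have Mq: "M \<subseteq> ?q n" for n using M.Icarr M.I_l_closed ec by auto
    obtain Z where Z: "Z \<in> range ?q" "\<And>K. K \<in> range ?q \<Longrightarrow> Z \<subseteq> K \<Longrightarrow> K = Z"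
    proof (rule maximal_condition[of I0 "range ?q"])
      fix K assume "K \<in> range ?q"
      then obtain n where "K = ?q n" by (elim rangeE)
      then show "ideal K R \<and> I0 \<subseteq> K" using q[of n] order_trans[OF order_trans[OF IC0 CM] Mq[of n]] by simp
    qed (use fg in auto)
    then obtain n where n: "Z = ?q n" by blast
    have "?q n \<subseteq> ?q (Suc n)"
    proof
      fix b assume b: "b \<in> ?q n"
      have "e [^] Suc n \<otimes> b = e \<otimes> (e [^] n \<otimes> b)" using b ec by (simp add: m_ac)
      then show "b \<in> ?q (Suc n)" using b ec M.I_l_closed[of "e [^] n \<otimes> b" e] by auto
    qed
    then have st: "?q (Suc n) = ?q n" using Z(2)[of "?q (Suc n)"] n by blast
    let ?K = "line_extension (carrier R) (e [^] n) M"
    have enc: "e [^] n \<in> carrier R" using ec by simp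
    have "?K \<in> ?C"
    proof (intro CollectI conjI ballI impI)
      show "ideal ?K R" by (rule ideal_add_principal(1)[OF Mi enc])
      show "?B \<subseteq> ?K" using CM ideal_add_principal(2)[OF Mi enc] by blast
      fix r assume r: "r \<in> carrier R" "r \<otimes> x \<in> ?K"
      then obtain b c where *: "b \<in> carrier R" "c \<in> M" "r \<otimes> x = b \<otimes> e [^] n \<oplus> c"
        unfolding line_extension_mem_iff by blast
      have cc: "c \<in> carrier R" using * M.Icarr by auto
      have "e \<otimes> (r \<otimes> x) = r \<otimes> (e \<otimes> x)" using ec r x by (simp add: m_lcomm)
      then have 1: "e \<otimes> (r \<otimes> x) \<in> M" using JC0[OF e] CM M.I_l_closed r(1) by auto
      have "e [^] Suc n \<otimes> b = e \<otimes> (r \<otimes> x) \<ominus> e \<otimes> c"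
        unfolding *(3) nat_pow_Suc using cc enc ec *(1) by algebra
      also have "\<dots> \<in> M" using 1 M.I_l_closed[OF *(2) ec] by (simp add: a_minus_def)
      finally have "b \<in> ?q (Suc n)" using *(1) by simp
      then have "e [^] n \<otimes> b \<in> M" using st by blast
      then have "r \<otimes> x \<in> M" unfolding *(3) using *(1,2) enc by (simp add: m_comm)
      then show "r \<otimes> x \<in> ?B" by (rule Mx[OF r(1)])
    qed
    then have "?K = M" using M(2) ideal_add_principal(2)[OF Mi enc] by blast
    then show ?thesis using ideal_add_principal(3)[OF Mi enc] by blast
  qed
  \<comment> \<open>Lying in every power of \<open>J\<close>, the element \<open>x\<close> lies in
    \<open>M\<close>, and the choice of \<open>M\<close> pushes it into \<open>?B\<close>.\<close>
  from power_subset_of_nil[OF fg Mi _ J this] obtain n :: nat where "J [^]\<^bsub>ideals_set R\<^esub> n \<subseteq> M"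
    using IC0 CM by blast
  then have "x \<in> M" using x(2) by blast
  then have "x \<in> ?B" using Mx[of \<one>] x(1) by simp
  then obtain e i where *: "e \<in> J" "i \<in> I0" "x = e \<otimes> x \<oplus> i" unfolding line_extension_mem_iff by blast
  have c: "e \<in> carrier R" "i \<in> carrier R" using * J.Icarr I0.Icarr by auto
  have "(e \<otimes> x \<oplus> i) \<ominus> e \<otimes> x = i" using c x(1) by algebra
  then have "x \<ominus> e \<otimes> x = i" using *(3) by simp
  then show ?thesis using * by auto
qed

lemma (in abelian_monoid) finsum_lessThan_Suc:
  assumes "\<And>i. f i \<in> carrier G"
  shows "(\<Oplus>i\<in>{..<Suc n}. f i) = f n \<oplus> (\<Oplus>i\<in>{..<n}. f i)"
  using assms by (simp add: lessThan_Suc finsum_insert Pi_def)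

lemma (in cring) minus_minus_minus:
  assumes "a \<in> carrier R" "b \<in> carrier R" "c \<in> carrier R"
  shows "(a \<ominus> c) \<ominus> (b \<ominus> c) = a \<ominus> b" "(c \<ominus> b) \<ominus> (c \<ominus> a) = a \<ominus> b"
  using assms by algebra+

section \<open>Successive approximation over a complete subring\<close>

context noeth_local_subring
begin

lemma dsub_singleton_zero: "dsub {\<zero>}"
  unfolding dsub_def by auto

lemma DD_minus: "x \<in> D \<Longrightarrow> y \<in> D \<Longrightarrow> x \<ominus>\<^bsub>DD\<^esub> y = x \<ominus> y"
proof -
  interpret DD: cring DD by (rule DD_cring)
  assume "x \<in> D" "y \<in> D"
  then have "\<ominus>\<^bsub>DD\<^esub> y = \<ominus> y" using DD.minus_equality[of "\<ominus> y" y] by (simp add: l_neg)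
  then show ?thesis by (simp add: a_minus_def)
qed

lemma dsub_of_DD_ideal: "ideal I DD \<Longrightarrow> dsub I"
proof -
  interpret DD: cring DD by (rule DD_cring)
  assume I: "ideal I DD"
  interpret I: ideal I DD by (rule I)
  show ?thesis unfolding dsub_def using I.Icarr I.zero_closed I.a_closed I.I_l_closed by auto
qed

lemma Span_Cons: "Span C (u # us) = line_extension C u (Span C us)"
  by simp

lemma dsub_Span: "ideal C DD \<Longrightarrow> set us \<subseteq> carrier R \<Longrightarrow> dsub (Span C us)"
  by (induct us) (auto intro: dsub_line_extension dsub_singleton_zero)

lemma Span_smult_gen:
  assumes "ideal C DD" "set us \<subseteq> carrier R" "u \<in> set us" "g \<in> C"
  shows "g \<otimes> u \<in> Span C us"
  using assms(2,3)
proof (induct us)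
  case (Cons v us)
  have C: "dsub C" by (rule dsub_of_DD_ideal[OF assms(1)])
  have d: "dsub (Span C us)" using dsub_Span[OF assms(1)] Cons by auto
  show ?case
  proof (cases "u = v")
    case True
    then show ?thesis using Cons assms(4) dsub_zero[OF d] dsub_carrier[OF C]
      by (auto intro!: line_extensionI[of g _ \<zero>])
  next
    case False
    then have "g \<otimes> u \<in> Span C us" using Cons by auto
    then show ?thesis using line_extension_incr[OF d assms(1), of v] Cons by auto
  qed
qed simp

text \<open>Completeness stated for series, the form that successive approximation produces: the
  remainder after \<open>n\<close> terms lies in \<open>C n\<close> itself. The notion covers the
  powers of \<open>m\<close> and the ideals \<open>p^n D\<close> alike.\<close>

definition complete_filtration :: "(nat \<Rightarrow> 'a set) \<Rightarrow> bool" where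
  "complete_filtration C \<longleftrightarrow> (\<forall>n. ideal (C n) DD) \<and>
     (\<forall>r. (\<forall>n. r n \<in> C n) \<longrightarrow> (\<exists>s\<in>D. \<forall>n. s \<ominus> (\<Oplus>i\<in>{..<n}. r i) \<in> C n))"

text \<open>A series in the span is summed coefficient by coefficient.\<close>

lemma Span_limit:
  assumes C: "complete_filtration C" and us: "set us \<subseteq> carrier R" and y: "\<And>n. y n \<in> Span (C n) us"
  shows "\<exists>s\<in>Span D us. \<forall>n. s \<ominus> (\<Oplus>i\<in>{..<n}. y i) \<in> Span (C n) us"
  using us y
proof (induct us arbitrary: y)
  case Nil
  then have "y n = \<zero>" for n by simp
  then have "(\<Oplus>i\<in>{..<n}. y i) = \<zero>" for n by (simp add: finsum_zero)
  then show ?case by (intro bexI[of _ \<zero>]) (auto simp: a_minus_def)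
next
  case (Cons u us)
  have Ci: "ideal (C n) DD" for n using C unfolding complete_filtration_def by blast
  have CD: "C n \<subseteq> D" for n using ideal.Icarr[OF Ci] by auto
  have u: "u \<in> carrier R" and us: "set us \<subseteq> carrier R" using Cons by auto
  have "\<exists>r v. r \<in> C n \<and> v \<in> Span (C n) us \<and> y n = r \<otimes> u \<oplus> v" for n
    using Cons(3)[of n] by (auto simp: line_extension_mem_iff)
  then obtain r v where rv: "\<And>n. r n \<in> C n" "\<And>n. v n \<in> Span (C n) us" "\<And>n. y n = r n \<otimes> u \<oplus> v n" by metis
  obtain s where s: "s \<in> D" "\<And>n. s \<ominus> (\<Oplus>i\<in>{..<n}. r i) \<in> C n"
    using C rv(1) unfolding complete_filtration_def by blast
  obtain t where t: "t \<in> Span D us" "\<And>n. t \<ominus> (\<Oplus>i\<in>{..<n}. v i) \<in> Span (C n) us"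
    using Cons(1)[OF us rv(2)] by blast
  have rc: "r n \<in> carrier R" for n using rv(1) CD by blast
  have vc: "v n \<in> carrier R" for n using dsub_carrier[OF dsub_Span[OF Ci us] rv(2)] .
  have sc: "s \<in> carrier R" "t \<in> carrier R" using s dsub_carrier[OF dsub_Span[OF D_ideal us] t(1)] by auto
  have "(s \<otimes> u \<oplus> t) \<ominus> (\<Oplus>i\<in>{..<n}. y i) \<in> Span (C n) (u # us)" for n
  proof -
    define a b where "a = (\<Oplus>i\<in>{..<n}. r i)" and "b = (\<Oplus>i\<in>{..<n}. v i)"
    have ab: "a \<in> carrier R" "b \<in> carrier R" unfolding a_def b_def using rc vc by (auto intro: finsum_closed)
    have "(\<Oplus>i\<in>{..<n}. y i) = (\<Oplus>i\<in>{..<n}. r i \<otimes> u) \<oplus> b"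
      unfolding b_def rv(3) by (rule finsum_addf) (use rc vc u in auto)
    also have "(\<Oplus>i\<in>{..<n}. r i \<otimes> u) = a \<otimes> u"
      unfolding a_def by (rule finsum_ldistr[symmetric]) (use rc u in auto)
    finally have "(\<Oplus>i\<in>{..<n}. y i) = a \<otimes> u \<oplus> b" .
    then have "(s \<otimes> u \<oplus> t) \<ominus> (\<Oplus>i\<in>{..<n}. y i) = (s \<ominus> a) \<otimes> u \<oplus> (t \<ominus> b)"
      using ab sc u by (simp only:) algebra
    then show ?thesis using s(2)[of n] t(2)[of n] unfolding a_def b_def Span_Cons
      by (intro line_extensionI)
  qed
  moreover have "s \<otimes> u \<oplus> t \<in> Span D (u # us)" using s t unfolding Span_Cons by (intro line_extensionI[OF _ _ refl])
  ultimately show ?case by blast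
qed

text \<open>The corrections chosen at each stage form a series, and \<open>a\<close> differs from
  its sum by an element of every \<open>E n\<close>. The \<open>E n\<close> are abstract sets closed
  under subtraction because they stand once for the powers of \<open>mA\<close> and once for sets
  defined through denominators.\<close>

lemma successive_approximation:
  assumes C: "complete_filtration C" and us: "set us \<subseteq> carrier R"
    and E0: "E 0 = carrier R" and E: "\<And>n. E n \<subseteq> carrier R"
    and Em: "\<And>n a b. a \<in> E n \<Longrightarrow> b \<in> E n \<Longrightarrow> a \<ominus> b \<in> E n"
    and SE: "\<And>n. Span (C n) us \<subseteq> E n"
    and step: "\<And>n a. a \<in> E n \<Longrightarrow> \<exists>y\<in>Span (C n) us. a \<ominus> y \<in> E (Suc n)"
    and a: "a \<in> carrier R"
  shows "\<exists>s\<in>Span D us. \<forall>n. a \<ominus> s \<in> E n"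
proof -
  define f where "f n b = (SOME y. y \<in> Span (C n) us \<and> b \<ominus> y \<in> E (Suc n))" for n b
  have f: "f n b \<in> Span (C n) us \<and> b \<ominus> f n b \<in> E (Suc n)" if "b \<in> E n" for n b
    unfolding f_def by (rule someI_ex) (use step[OF that] in blast)
  define rem where "rem = rec_nat a (\<lambda>n b. b \<ominus> f n b)"
  have rem: "rem 0 = a" "\<And>n. rem (Suc n) = rem n \<ominus> f n (rem n)" unfolding rem_def by auto
  have remE: "rem n \<in> E n" for n by (induct n) (use rem f a E0 in auto)
  let ?y = "\<lambda>n. f n (rem n)"
  have y: "?y n \<in> Span (C n) us" for n using f[OF remE] by blast
  have yc: "?y n \<in> carrier R" for n using y SE E by blast
  have sumc: "(\<Oplus>i\<in>{..<n}. ?y i) \<in> carrier R" for n by (rule finsum_closed) (use yc in auto)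
  have rem_eq: "rem n = a \<ominus> (\<Oplus>i\<in>{..<n}. ?y i)" for n
  proof (induct n)
    case 0 then show ?case using rem a by (simp add: a_minus_def)
  next
    case (Suc n)
    have "rem (Suc n) = (a \<ominus> (\<Oplus>i\<in>{..<n}. ?y i)) \<ominus> ?y n" using rem(2) Suc by simp
    also have "\<dots> = a \<ominus> (?y n \<oplus> (\<Oplus>i\<in>{..<n}. ?y i))"
      using a yc[of n] sumc[of n] by (simp add: a_minus_def minus_add a_ac)
    also have "?y n \<oplus> (\<Oplus>i\<in>{..<n}. ?y i) = (\<Oplus>i\<in>{..<Suc n}. ?y i)"
      using yc by (simp add: lessThan_Suc finsum_insert Pi_def)
    finally show ?case .
  qed
  obtain s where s: "s \<in> Span D us" "\<And>n. s \<ominus> (\<Oplus>i\<in>{..<n}. ?y i) \<in> Span (C n) us"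
    using Span_limit[OF C us, of ?y] y by blast
  have sc: "s \<in> carrier R" using dsub_carrier[OF dsub_Span[OF D_ideal us] s(1)] .
  have "a \<ominus> s \<in> E n" for n
  proof -
    have "rem n \<ominus> (s \<ominus> (\<Oplus>i\<in>{..<n}. ?y i)) \<in> E n" using Em[OF remE] s(2) SE by blast
    moreover have "rem n \<ominus> (s \<ominus> (\<Oplus>i\<in>{..<n}. ?y i)) = a \<ominus> s"
    proof -
      define b where "b = (\<Oplus>i\<in>{..<n}. ?y i)"
      have "b \<in> carrier R" unfolding b_def by (rule sumc)
      then show ?thesis unfolding rem_eq[of n] b_def[symmetric] using a sc by algebra
    qed
    ultimately show ?thesis by simp
  qed
  then show ?thesis using s(1) by blast
qed

section \<open>Adic filtrations of the complete local ring\<close>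

abbreviation mpow :: "nat \<Rightarrow> 'a set" where "mpow n \<equiv> m [^]\<^bsub>ideals_set DD\<^esub> n"

lemma mpow_ideal: "ideal (mpow n) DD"
  by (rule cring.ideal_pow(3)[OF DD_cring m_ideal])

lemma mpow_Suc: "mpow (Suc n) = ideal_prod DD (mpow n) m"
  by (rule cring.ideal_pow(2)[OF DD_cring m_ideal])

lemma mpow_decr: "n \<le> k \<Longrightarrow> mpow k \<subseteq> mpow n"
proof (induct k rule: dec_induct)
  case (step k)
  have "mpow (Suc k) \<subseteq> mpow k" unfolding mpow_Suc
    by (rule cring.ideal_prod_subset[OF DD_cring mpow_ideal]) (use ideal.I_r_closed[OF mpow_ideal] in auto)
  then show ?case using step by blast
qed simp

lemma mpow_add: "x \<in> mpow n \<Longrightarrow> y \<in> mpow n \<Longrightarrow> x \<oplus> y \<in> mpow n"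
  using dsub_add[OF dsub_of_DD_ideal[OF mpow_ideal]] .

lemma mpow_minus: "x \<in> mpow n \<Longrightarrow> y \<in> mpow n \<Longrightarrow> x \<ominus> y \<in> mpow n"
  using dsub_minus[OF dsub_of_DD_ideal[OF mpow_ideal]] .

lemma mpow_smult: "d \<in> D \<Longrightarrow> x \<in> mpow n \<Longrightarrow> d \<otimes> x \<in> mpow n"
  using dsub_smult[OF dsub_of_DD_ideal[OF mpow_ideal]] .

lemma mpow_D: "x \<in> mpow n \<Longrightarrow> x \<in> D"
  using ideal.Icarr[OF mpow_ideal] by auto

lemma pow_mem_mpow: "x \<in> m \<Longrightarrow> x [^] n \<in> mpow n"
proof (induct n)
  case 0 then show ?case using cring.ideal_pow(1)[OF DD_cring m_ideal] by simp
next
  case (Suc n) then show ?case unfolding mpow_Suc using ideal_prod.prod[of "x [^] n" "mpow n" x m DD] by simp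
qed

text \<open>The partial sums form a Cauchy sequence. The sharp bound for the remainder comes from
  comparing the limit with a partial sum far beyond \<open>n\<close>.\<close>

lemma complete_filtration_mpow:
  assumes "adically_complete DD m"
  shows "complete_filtration mpow"
  unfolding complete_filtration_def
proof (intro conjI allI impI)
  fix r :: "nat \<Rightarrow> 'a" assume r: "\<forall>n. r n \<in> mpow n"
  let ?s = "\<lambda>n. \<Oplus>i\<in>{..<n}. r i"
  have rD: "r n \<in> D" for n using r mpow_D by blast
  have sD: "?s n \<in> D" for n
  proof (induct n)
    case (Suc n) then show ?case using rD by (simp add: lessThan_Suc finsum_insert Pi_def)
  qed simp
  have diff: "?s i \<ominus> ?s k \<in> mpow k" if "k \<le> i" for i k
    using that
  proof (induct i rule: dec_induct)
    case base then show ?case using D_carr[OF sD] dsub_zero[OF dsub_of_DD_ideal[OF mpow_ideal]] by (simp add: a_minus_def r_neg)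
  next
    case (step i)
    have "?s (Suc i) \<ominus> ?s k = r i \<oplus> (?s i \<ominus> ?s k)"
      using rD D_carr[OF sD] by (simp add: lessThan_Suc finsum_insert Pi_def a_minus_def a_assoc)
    moreover have "r i \<in> mpow k" using r mpow_decr[OF step(1)] by blast
    ultimately show ?case using mpow_add step by simp
  qed
  have "\<forall>k. \<exists>N. \<forall>i\<ge>N. \<forall>j\<ge>N. ?s i \<ominus>\<^bsub>DD\<^esub> ?s j \<in> mpow k"
  proof (intro allI exI impI)
    fix k i j :: nat assume ij: "k \<le> i" "k \<le> j"
    have "?s i \<ominus> ?s j = (?s i \<ominus> ?s k) \<ominus> (?s j \<ominus> ?s k)"
      using minus_minus_minus(1)[OF D_carr[OF sD[of i]] D_carr[OF sD[of j]] D_carr[OF sD[of k]]] by simp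
    then show "?s i \<ominus>\<^bsub>DD\<^esub> ?s j \<in> mpow k" using mpow_minus[OF diff[OF ij(1)] diff[OF ij(2)]] sD by (simp add: DD_minus)
  qed
  moreover have "range ?s \<subseteq> carrier DD" using sD by auto
  ultimately have "\<exists>l\<in>carrier DD. \<forall>k. \<exists>N. \<forall>i\<ge>N. ?s i \<ominus>\<^bsub>DD\<^esub> l \<in> mpow k"
    using assms[unfolded adically_complete_def, THEN conjunct2, THEN spec[of _ ?s]] by blast
  then obtain l where l: "l \<in> D" "\<forall>k. \<exists>N. \<forall>i\<ge>N. ?s i \<ominus>\<^bsub>DD\<^esub> l \<in> mpow k" by auto
  have "l \<ominus> ?s n \<in> mpow n" for n
  proof -
    obtain N where N: "\<And>i. i \<ge> N \<Longrightarrow> ?s i \<ominus>\<^bsub>DD\<^esub> l \<in> mpow n" using l(2) by blast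
    let ?i = "max N n"
    have "l \<ominus> ?s n = (?s ?i \<ominus> ?s n) \<ominus> (?s ?i \<ominus> l)"
      using minus_minus_minus(2)[OF D_carr[OF l(1)] D_carr[OF sD[of n]] D_carr[OF sD[of ?i]]] by simp
    moreover have "?s ?i \<ominus> l \<in> mpow n" using N[of ?i] sD l by (simp add: DD_minus)
    ultimately show ?thesis using mpow_minus[OF diff[of n ?i]] by simp
  qed
  then show "\<exists>s\<in>D. \<forall>n. s \<ominus> ?s n \<in> mpow n" using l(1) by blast
qed (rule mpow_ideal)

definition powD :: "'a \<Rightarrow> nat \<Rightarrow> 'a set" where "powD p n = (\<lambda>d. p [^] n \<otimes> d) ` D"

text \<open>The tails \<open>t n\<close>, each divided by \<open>p^n\<close>, exist by
  \<open>m\<close>-adic completeness, and separatedness turns congruences modulo all powers of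
  \<open>m\<close> into the equation \<open>t 0 \<ominus> ?s 0 n = p [^] n \<otimes> t n\<close>. So
  the remainder is divisible by \<open>p^n\<close> without an appeal to closedness of the ideal
  \<open>p^n D\<close>.\<close>

lemma complete_filtration_powD:
  assumes compl: "adically_complete DD m" and p: "p \<in> m"
  shows "complete_filtration (powD p)"
  unfolding complete_filtration_def
proof (intro conjI allI impI)
  have pD: "p \<in> D" using p by auto
  fix n show "ideal (powD p n) DD"
  proof (rule DD_idealI)
    show "\<zero> \<in> powD p n" unfolding powD_def by (rule image_eqI[of _ _ \<zero>]) (use pD in auto)
  next
    fix x y assume "x \<in> powD p n" "y \<in> powD p n"
    then obtain d e where "d \<in> D" "e \<in> D" "x = p [^] n \<otimes> d" "y = p [^] n \<otimes> e" unfolding powD_def by blast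
    then show "x \<oplus> y \<in> powD p n" unfolding powD_def using pD by (intro image_eqI[of _ _ "d \<oplus> e"]) (auto simp: r_distr)
  next
    fix c x assume "c \<in> D" "x \<in> powD p n"
    then obtain d where "c \<in> D" "d \<in> D" "x = p [^] n \<otimes> d" unfolding powD_def by blast
    then show "c \<otimes> x \<in> powD p n" unfolding powD_def using pD by (intro image_eqI[of _ _ "c \<otimes> d"]) (auto simp: m_lcomm)
  qed (use pD in \<open>auto simp: powD_def\<close>)
next
  have pD: "p \<in> D" using p by auto
  fix r :: "nat \<Rightarrow> 'a" assume r: "\<forall>n. r n \<in> powD p n"
  then have "\<exists>b. b \<in> D \<and> r n = p [^] n \<otimes> b" for n unfolding powD_def by blast
  then obtain b where b: "\<And>n. b n \<in> D" "\<And>n. r n = p [^] n \<otimes> b n" by metis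
  have bc: "b n \<in> carrier R" for n using b by auto
  have pc: "p [^] (n::nat) \<in> carrier R" for n using pD by auto
  let ?s = "\<lambda>n k. \<Oplus>i\<in>{..<k}. p [^] i \<otimes> b (n + i)"
  have sc: "?s n k \<in> carrier R" for n k by (rule finsum_closed) (use pc bc in auto)
  have "\<exists>t\<in>D. \<forall>k. t \<ominus> ?s n k \<in> mpow k" for n
  proof -
    have "p [^] i \<otimes> b (n + i) \<in> mpow i" for i
      using mpow_smult[OF b(1) pow_mem_mpow[OF p], of "n + i" i] pc bc by (simp add: m_comm)
    then show ?thesis
      using complete_filtration_mpow[OF compl, unfolded complete_filtration_def, THEN conjunct2, THEN spec[of _ "\<lambda>i. p [^] i \<otimes> b (n + i)"]] by blast
  qed
  then have ex: "\<exists>t. t \<in> D \<and> (\<forall>k. t \<ominus> ?s n k \<in> mpow k)" for n by blast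
  define t where "t n = (SOME t. t \<in> D \<and> (\<forall>k. t \<ominus> ?s n k \<in> mpow k))" for n
  have t: "t n \<in> D" "t n \<ominus> ?s n k \<in> mpow k" for n k
    using someI_ex[OF ex[of n]] unfolding t_def by auto
  have tc: "t n \<in> carrier R" for n using t by auto
  have split: "?s 0 (n + k) = ?s 0 n \<oplus> p [^] n \<otimes> ?s n k" for n k
  proof (induct k)
    case 0 then show ?case using sc[of 0 n] pc[of n] by simp
  next
    case (Suc k)
    have "?s 0 (n + Suc k) = p [^] (n + k) \<otimes> b (n + k) \<oplus> ?s 0 (n + k)"
      using finsum_lessThan_Suc[of "\<lambda>i. p [^] i \<otimes> b (0 + i)" "n + k"] m_closed[OF pc bc] by simp
    also have "p [^] (n + k) = p [^] n \<otimes> p [^] k" using pD by (simp add: nat_pow_mult)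
    also have "(p [^] n \<otimes> p [^] k) \<otimes> b (n + k) \<oplus> ?s 0 (n + k) =
       ?s 0 n \<oplus> p [^] n \<otimes> (p [^] k \<otimes> b (n + k) \<oplus> ?s n k)"
      unfolding Suc using sc[of 0 n] sc[of n k] pc[of n] pc[of k] bc[of "n + k"] by (simp add: r_distr m_assoc a_ac)
    also have "p [^] k \<otimes> b (n + k) \<oplus> ?s n k = ?s n (Suc k)"
      by (rule finsum_lessThan_Suc[symmetric]) (rule m_closed[OF pc bc])
    finally show ?case .
  qed
  have eq: "t 0 \<ominus> ?s 0 n = p [^] n \<otimes> t n" for n
  proof -
    have "(t 0 \<ominus> ?s 0 n) \<ominus> p [^] n \<otimes> t n \<in> mpow k" for k
    proof -
      define u v where "u = ?s 0 n" and "v = ?s n k"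
      have uv: "u \<in> carrier R" "v \<in> carrier R" unfolding u_def v_def by (rule sc)+
      have 1: "t 0 \<ominus> (u \<oplus> p [^] n \<otimes> v) \<in> mpow k"
        unfolding u_def v_def split[symmetric] using t(2)[of 0 "n + k"] mpow_decr[of k "n + k"] by auto
      have 2: "p [^] n \<otimes> (t n \<ominus> v) \<in> mpow k" unfolding v_def using mpow_smult[OF D_pow[OF pD] t(2)] .
      have "(t 0 \<ominus> u) \<ominus> p [^] n \<otimes> t n = (t 0 \<ominus> (u \<oplus> p [^] n \<otimes> v)) \<ominus> p [^] n \<otimes> (t n \<ominus> v)"
        using tc[of 0] tc[of n] uv pc[of n] by algebra
      then show ?thesis unfolding u_def[symmetric] using mpow_minus[OF 1 2] by simp
    qed
    then have "(t 0 \<ominus> ?s 0 n) \<ominus> p [^] n \<otimes> t n \<in> (\<Inter>k. mpow k)" by blast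
    then have "(t 0 \<ominus> ?s 0 n) \<ominus> p [^] n \<otimes> t n = \<zero>" using compl unfolding adically_complete_def by auto
    then show ?thesis using tc[of 0] tc[of n] sc[of 0 n] pc[of n] by simp
  qed
  have "(\<Oplus>i\<in>{..<n}. r i) = ?s 0 n" for n by (rule finsum_cong') (use b pc bc in auto)
  then have "t 0 \<ominus> (\<Oplus>i\<in>{..<n}. r i) \<in> powD p n" for n using eq t unfolding powD_def by auto
  then show "\<exists>s\<in>D. \<forall>n. s \<ominus> (\<Oplus>i\<in>{..<n}. r i) \<in> powD p n" using t(1) by blast
qed

section \<open>Powers of the extended maximal ideal\<close>

abbreviation "mA \<equiv> genideal R m"
abbreviation mApow :: "nat \<Rightarrow> 'a set" where "mApow n \<equiv> mA [^]\<^bsub>ideals_set R\<^esub> n"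

lemma m_carrier: "m \<subseteq> carrier R" using D_carrier by auto
lemma mA_ideal: "ideal mA R" by (rule genideal_ideal[OF m_carrier])
lemma m_mA: "m \<subseteq> mA" by (rule genideal_self[OF m_carrier])
lemma mApow_ideal: "ideal (mApow n) R" by (rule ideal_pow(3)[OF mA_ideal])
lemma mApow_Suc: "mApow (Suc n) = ideal_prod R (mApow n) mA" by (rule ideal_pow(2)[OF mA_ideal])

text \<open>Induction through a colon ideal: the elements that multiply \<open>mA\<close> into
  \<open>T\<close> form an ideal containing \<open>m^n\<close>. In effect the powers of
  \<open>mA\<close> are generated by those of \<open>m\<close>.\<close>

lemma mApow_min: "ideal T R \<Longrightarrow> mpow n \<subseteq> T \<Longrightarrow> mApow n \<subseteq> T"
proof (induct n arbitrary: T)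
  case 0
  have "\<one> \<in> T" using 0(2) cring.ideal_pow(1)[OF DD_cring m_ideal] by auto
  then have "T = carrier R" by (rule ideal.one_imp_carrier[OF 0(1)])
  then show ?case using ideal.Icarr[OF mApow_ideal[of 0]] by blast
next
  case (Suc n)
  interpret T: ideal T R by (rule Suc(2))
  let ?T = "{i \<in> carrier R. \<forall>j\<in>mA. i \<otimes> j \<in> T}"
  have mAc: "j \<in> carrier R" if "j \<in> mA" for j using ideal.Icarr[OF mA_ideal that] .
  have "mApow n \<subseteq> ?T"
  proof (rule Suc(1))
    show "ideal ?T R"
      by (rule ideal_of_closed) (use mAc T.a_closed T.I_l_closed in \<open>auto simp: l_distr m_assoc\<close>)
    show "mpow n \<subseteq> ?T"
    proof
      fix i assume i: "i \<in> mpow n"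
      then have ic: "i \<in> carrier R" using mpow_D by auto
      have "ideal {j \<in> carrier R. i \<otimes> j \<in> T} R"
        by (rule ideal_of_closed) (use ic T.a_closed T.I_l_closed in \<open>auto simp: r_distr m_lcomm[of i]\<close>)
      moreover have "m \<subseteq> {j \<in> carrier R. i \<otimes> j \<in> T}"
      proof
        fix j assume j: "j \<in> m"
        have "i \<otimes> j \<in> mpow (Suc n)" unfolding mpow_Suc using ideal_prod.prod[OF i j, of DD] by simp
        then show "j \<in> {j \<in> carrier R. i \<otimes> j \<in> T}" using Suc(3) j by auto
      qed
      ultimately have "mA \<subseteq> {j \<in> carrier R. i \<otimes> j \<in> T}" by (rule genideal_minimal)
      then show "i \<in> ?T" using ic by blast
    qed
  qed
  then show ?case unfolding mApow_Suc by (intro ideal_prod_subset[OF Suc(2)]) blast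
qed

lemma mpow_sub_mApow: "mpow n \<subseteq> mApow n"
proof (induct n)
  case 0 show ?case unfolding ideal_pow(1)[OF mA_ideal] using mpow_D D_carr by blast
next
  case (Suc n)
  have *: "ideal (I \<inter> D) DD" if "ideal I R" for I
  proof -
    interpret I: ideal I R by (rule that)
    show ?thesis by (rule DD_idealI) (use I.a_closed I.I_l_closed in auto)
  qed
  have "ideal (mApow (Suc n) \<inter> D) DD" by (rule *[OF mApow_ideal])
  then have "mpow (Suc n) \<subseteq> mApow (Suc n) \<inter> D" unfolding mpow_Suc
  proof (rule cring.ideal_prod_subset[OF DD_cring])
    fix i j assume "i \<in> mpow n" "j \<in> m"
    then show "i \<otimes>\<^bsub>DD\<^esub> j \<in> mApow (Suc n) \<inter> D"
      unfolding mApow_Suc using Suc m_mA mpow_D by (auto intro!: ideal_prod.prod)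
  qed
  then show ?case by blast
qed

lemma Span_sub_ideal:
  assumes I: "ideal I R" and C: "C \<subseteq> I" and us: "set us \<subseteq> carrier R"
  shows "Span C us \<subseteq> I"
  using us
proof (induct us)
  case Nil then show ?case using dsub_zero[OF dsub_ideal[OF I]] by simp
next
  case (Cons u us)
  then show ?case unfolding Span_Cons using C ideal.I_r_closed[OF I] dsub_add[OF dsub_ideal[OF I]]
    by (intro subsetI, elim line_extensionE) (simp add: subset_iff)
qed

text \<open>Multiplying \<open>R = D us + mA\<close> by \<open>m^n\<close> shows that
  \<open>(mA)^n\<close> lies in \<open>m^n us + (mA)^(n+1)\<close>; completeness of \<open>D\<close>
  sums the corrections.\<close>

lemma approx_mA:
  assumes compl: "adically_complete DD m"
    and us: "set us \<subseteq> carrier R" "span_over us mA = carrier R" and a: "a \<in> carrier R"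
  shows "\<exists>s\<in>Span D us. \<forall>n. a \<ominus> s \<in> mApow n"
proof (rule successive_approximation[OF complete_filtration_mpow[OF compl] us(1) _ _ _ _ _ a])
  show "mApow 0 = carrier R" by (rule ideal_pow(1)[OF mA_ideal])
  fix n
  interpret I: ideal "mApow n" R by (rule mApow_ideal)
  define K where "K = mApow (Suc n)"
  interpret IS: ideal K R unfolding K_def by (rule mApow_ideal)
  show "mApow n \<subseteq> carrier R" using I.Icarr by blast
  show "a \<ominus> b \<in> mApow n" if "a \<in> mApow n" "b \<in> mApow n" for a b
    using that by (simp add: a_minus_def)
  show "Span (mpow n) us \<subseteq> mApow n" by (rule Span_sub_ideal[OF mApow_ideal mpow_sub_mApow us(1)])
  have dS: "dsub (Span (mpow n) us)" by (rule dsub_Span[OF mpow_ideal us(1)])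
  have Sc: "y \<in> carrier R" if "y \<in> Span (mpow n) us" for y by (rule dsub_carrier[OF dS that])
  \<comment> \<open>All multiples \<open>b \<otimes> x\<close> are included so that
    \<open>?T\<close> is an ideal of \<open>R\<close>; the span alone is stable only under
    \<open>D\<close>.\<close>
  let ?T = "{x \<in> carrier R. \<forall>b\<in>carrier R. \<exists>y\<in>Span (mpow n) us. b \<otimes> x \<ominus> y \<in> K}"
  have "mApow n \<subseteq> ?T"
  proof (rule mApow_min)
    show "ideal ?T R"
    proof (rule ideal_of_closed)
      show "\<zero> \<in> ?T" using dsub_zero[OF dS] IS.zero_closed by (auto intro!: bexI[of _ \<zero>] simp: a_minus_def)
    next
      fix x z assume xz: "x \<in> ?T" "z \<in> ?T"
      have "\<exists>y\<in>Span (mpow n) us. b \<otimes> (x \<oplus> z) \<ominus> y \<in> K" if b: "b \<in> carrier R" for b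
      proof -
        obtain y where y: "y \<in> Span (mpow n) us" "b \<otimes> x \<ominus> y \<in> K" using xz(1) b by blast
        obtain w where w: "w \<in> Span (mpow n) us" "b \<otimes> z \<ominus> w \<in> K" using xz(2) b by blast
        have c: "x \<in> carrier R" "z \<in> carrier R" using xz by auto
        have "b \<otimes> (x \<oplus> z) \<ominus> (y \<oplus> w) = (b \<otimes> x \<ominus> y) \<oplus> (b \<otimes> z \<ominus> w)"
          using c b Sc[OF y(1)] Sc[OF w(1)] by algebra
        then show ?thesis using IS.a_closed[OF y(2) w(2)] dsub_add[OF dS y(1) w(1)] by metis
      qed
      then show "x \<oplus> z \<in> ?T" using xz by auto
    next
      fix d x assume dx: "d \<in> carrier R" "x \<in> ?T"
      then have "\<exists>y\<in>Span (mpow n) us. (b \<otimes> d) \<otimes> x \<ominus> y \<in> K" if "b \<in> carrier R" for b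
        using that by blast
      then show "d \<otimes> x \<in> ?T" using dx by (simp add: m_assoc)
    qed auto
    show "mpow n \<subseteq> ?T"
    proof
      fix g assume g: "g \<in> mpow n"
      then have gD: "g \<in> D" by (rule mpow_D)
      let ?H = "{b \<in> carrier R. \<exists>y\<in>Span (mpow n) us. b \<otimes> g \<ominus> y \<in> K}"
      have "span_over us mA \<subseteq> ?H"
      proof (rule span_over_min)
        show "set us \<subseteq> ?H"
        proof
          fix u assume u: "u \<in> set us"
          then have "u \<in> carrier R" using us by auto
          moreover from this have "u \<otimes> g \<ominus> g \<otimes> u = \<zero>" using gD by (simp add: m_comm a_minus_def r_neg)
          ultimately show "u \<in> ?H" using Span_smult_gen[OF mpow_ideal us(1) u g] by (intro CollectI conjI bexI[of _ "g \<otimes> u"]) auto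
        qed
        show "mA \<subseteq> ?H"
        proof
          fix j assume j: "j \<in> mA"
          then have jc: "j \<in> carrier R" using ideal.Icarr[OF mA_ideal] by auto
          have "g \<otimes> j \<in> K" unfolding K_def mApow_Suc using mpow_sub_mApow g j by (intro ideal_prod.prod) auto
          moreover have "j \<otimes> g \<ominus> \<zero> = g \<otimes> j" using jc gD by (simp add: m_comm a_minus_def)
          ultimately show "j \<in> ?H" using jc dsub_zero[OF dS] by (intro CollectI conjI bexI[of _ \<zero>]) auto
        qed
        show "dsub ?H" unfolding dsub_def
        proof (intro conjI ballI)
          show "\<zero> \<in> ?H" using dsub_zero[OF dS] gD IS.zero_closed by (auto intro!: bexI[of _ \<zero>] simp: a_minus_def)
        next
          fix x z assume "x \<in> ?H" "z \<in> ?H"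
          then obtain y w where *: "x \<in> carrier R" "z \<in> carrier R" "y \<in> Span (mpow n) us" "w \<in> Span (mpow n) us"
            "x \<otimes> g \<ominus> y \<in> K" "z \<otimes> g \<ominus> w \<in> K" by blast
          have "(x \<oplus> z) \<otimes> g \<ominus> (y \<oplus> w) = (x \<otimes> g \<ominus> y) \<oplus> (z \<otimes> g \<ominus> w)"
            using *(1,2) D_carr[OF gD] Sc[OF *(3)] Sc[OF *(4)] by algebra
          then have "(x \<oplus> z) \<otimes> g \<ominus> (y \<oplus> w) \<in> K" using IS.a_closed[OF *(5,6)] by simp
          then show "x \<oplus> z \<in> ?H" using * dsub_add[OF dS *(3,4)] by blast
        next
          fix d x assume d: "d \<in> D" and "x \<in> ?H"
          then obtain y where *: "x \<in> carrier R" "y \<in> Span (mpow n) us" "x \<otimes> g \<ominus> y \<in> K" by blast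
          have "(d \<otimes> x) \<otimes> g \<ominus> d \<otimes> y = d \<otimes> (x \<otimes> g \<ominus> y)"
            using *(1) D_carr[OF gD] D_carr[OF d] Sc[OF *(2)] by algebra
          then have "(d \<otimes> x) \<otimes> g \<ominus> d \<otimes> y \<in> K" using IS.I_l_closed[OF *(3) D_carr[OF d]] by simp
          then show "d \<otimes> x \<in> ?H" using * d dsub_smult[OF dS d *(2)] by blast
        qed auto
      qed
      then show "g \<in> ?T" unfolding us(2) using gD by auto
    qed
  qed
  then show "\<exists>y\<in>Span (mpow n) us. a \<ominus> y \<in> mApow (Suc n)" if "a \<in> mApow n" for a
  proof -
    assume "mApow n \<subseteq> ?T"
    then have "a \<in> ?T" using that by blast
    then have "a \<in> carrier R" "\<exists>y\<in>Span (mpow n) us. \<one> \<otimes> a \<ominus> y \<in> K" by blast+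
    then show ?thesis unfolding K_def[symmetric] by simp
  qed
qed

text \<open>Passing to \<open>1 + mA\<close> inside the congruences replaces a localization: modulo \<open>mA\<close> the
  factors \<open>1 - e\<close> are invisible, so they may be absorbed into the generators.\<close>

lemma span_of_separated:
  assumes compl: "adically_complete DD m" and p: "p \<in> m"
    and fg: "\<And>J. ideal J R \<Longrightarrow> PIdl p \<subseteq> J \<Longrightarrow> fg_ideal R J"
    and us: "set us \<subseteq> carrier R" "span_over us mA = carrier R"
    and sep: "\<And>x. x \<in> carrier R \<Longrightarrow>
      (\<And>n::nat. \<exists>e\<in>mA. \<exists>b\<in>carrier R. (\<one> \<ominus> e) \<otimes> x = p [^] n \<otimes> b) \<Longrightarrow> x = \<zero>"
  shows "Span D us = carrier R"
proof
  have pc: "p \<in> carrier R" using p by auto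
  have ppc: "p [^] (n::nat) \<in> carrier R" for n using pc by simp
  interpret J: ideal mA R by (rule mA_ideal)
  have PI: "ideal (PIdl p) R" by (rule cgenideal_ideal[OF pc])
  show "Span D us \<subseteq> carrier R" using dsub_Span[OF D_ideal us(1)] unfolding dsub_def by blast
  \<comment> \<open>Divisibility by \<open>p^n\<close> after inverting \<open>1 + mA\<close>,
    expressed without a localization.\<close>
  define E where "E n = {x \<in> carrier R. \<exists>e\<in>mA. \<exists>b\<in>carrier R. (\<one> \<ominus> e) \<otimes> x = p [^] n \<otimes> b}" for n :: nat
  have E_comb: "e \<oplus> f \<ominus> e \<otimes> f \<in> mA" "\<one> \<ominus> (e \<oplus> f \<ominus> e \<otimes> f) = (\<one> \<ominus> e) \<otimes> (\<one> \<ominus> f)"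
    if "e \<in> mA" "f \<in> mA" for e f
  proof -
    have c: "e \<in> carrier R" "f \<in> carrier R" using that J.Icarr by auto
    show "e \<oplus> f \<ominus> e \<otimes> f \<in> mA" unfolding a_minus_def
      by (intro J.a_closed J.a_inv_closed that J.I_l_closed c)
    show "\<one> \<ominus> (e \<oplus> f \<ominus> e \<otimes> f) = (\<one> \<ominus> e) \<otimes> (\<one> \<ominus> f)" using c by algebra
  qed
  \<comment> \<open>Krull's intersection theorem converts congruence modulo every power of
    \<open>mA\<close> into divisibility by \<open>p\<close> up to a factor. The generating list is
    arbitrary here because the step is applied to rescaled generators below.\<close>
  have step1: "\<exists>s\<in>Span D vs. a \<ominus> s \<in> E 1"
    if vs: "set vs \<subseteq> carrier R" "span_over vs mA = carrier R" and a: "a \<in> carrier R" for vs a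
  proof -
    obtain s where s: "s \<in> Span D vs" "\<And>n. a \<ominus> s \<in> mApow n" using approx_mA[OF compl vs a] by blast
    have sc: "s \<in> carrier R" using dsub_carrier[OF dsub_Span[OF D_ideal vs(1)] s(1)] .
    obtain e where e: "e \<in> mA" "(a \<ominus> s) \<ominus> e \<otimes> (a \<ominus> s) \<in> PIdl p"
      using krull_intersection[OF fg PI mA_ideal _ s(2)] a sc by auto
    have ec: "e \<in> carrier R" using e J.Icarr by auto
    obtain b where b: "b \<in> carrier R" "(a \<ominus> s) \<ominus> e \<otimes> (a \<ominus> s) = b \<otimes> p" using e(2) unfolding cgenideal_def by blast
    have "(\<one> \<ominus> e) \<otimes> (a \<ominus> s) = (a \<ominus> s) \<ominus> e \<otimes> (a \<ominus> s)" using ec a sc by algebra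
    also have "\<dots> = p [^] (1::nat) \<otimes> b" using b pc by (simp add: m_comm)
    finally show ?thesis unfolding E_def using s(1) e(1) b(1) a sc by blast
  qed
  show "carrier R \<subseteq> Span D us"
  proof
    fix a assume a: "a \<in> carrier R"
    have "\<exists>s\<in>Span D us. \<forall>n. a \<ominus> s \<in> E n"
    proof (rule successive_approximation[OF complete_filtration_powD[OF compl p] us(1) _ _ _ _ _ a])
      show "E 0 = carrier R"
      proof -
        have "x \<in> E 0" if "x \<in> carrier R" for x
          unfolding E_def using that J.zero_closed
          by (intro CollectI conjI bexI[of _ \<zero>] bexI[of _ x]) (auto simp: a_minus_def)
        then show ?thesis unfolding E_def by blast
      qed
      fix n
      show "E n \<subseteq> carrier R" unfolding E_def by blast
      show "x \<ominus> y \<in> E n" if xy: "x \<in> E n" "y \<in> E n" for x y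
      proof -
        obtain e b where 1: "e \<in> mA" "b \<in> carrier R" "(\<one> \<ominus> e) \<otimes> x = p [^] n \<otimes> b" using xy(1) unfolding E_def by blast
        obtain f c where 2: "f \<in> mA" "c \<in> carrier R" "(\<one> \<ominus> f) \<otimes> y = p [^] n \<otimes> c" using xy(2) unfolding E_def by blast
        have c: "e \<in> carrier R" "f \<in> carrier R" "x \<in> carrier R" "y \<in> carrier R" using 1 2 xy J.Icarr unfolding E_def by auto
        have "((\<one> \<ominus> e) \<otimes> (\<one> \<ominus> f)) \<otimes> (x \<ominus> y) = (\<one> \<ominus> f) \<otimes> ((\<one> \<ominus> e) \<otimes> x) \<ominus> (\<one> \<ominus> e) \<otimes> ((\<one> \<ominus> f) \<otimes> y)"
          using c by algebra
        also have "\<dots> = p [^] n \<otimes> ((\<one> \<ominus> f) \<otimes> b \<ominus> (\<one> \<ominus> e) \<otimes> c)"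
          unfolding 1(3) 2(3) using c 1(2) 2(2) ppc[of n] by algebra
        finally show ?thesis unfolding E_def using E_comb[OF 1(1) 2(1)] c 1(2) 2(2)
          by (intro CollectI conjI bexI[of _ "e \<oplus> f \<ominus> e \<otimes> f"] bexI[of _ "(\<one> \<ominus> f) \<otimes> b \<ominus> (\<one> \<ominus> e) \<otimes> c"]) auto
      qed
      show "Span (powD p n) us \<subseteq> E n"
      proof -
        let ?I = "{x. \<exists>b\<in>carrier R. x = p [^] n \<otimes> b}"
        have "ideal ?I R"
        proof (rule ideal_of_closed)
          show "\<zero> \<in> ?I" using ppc by (auto intro!: bexI[of _ \<zero>])
        next
          fix x y assume "x \<in> ?I" "y \<in> ?I"
          then obtain b c where "b \<in> carrier R" "c \<in> carrier R" "x = p [^] n \<otimes> b" "y = p [^] n \<otimes> c" by blast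
          then show "x \<oplus> y \<in> ?I" using ppc by (auto intro!: bexI[of _ "b \<oplus> c"] simp: r_distr)
        next
          fix d x assume "d \<in> carrier R" "x \<in> ?I"
          then obtain b where "d \<in> carrier R" "b \<in> carrier R" "x = p [^] n \<otimes> b" by blast
          then show "d \<otimes> x \<in> ?I" using ppc by (auto intro!: bexI[of _ "d \<otimes> b"] simp: m_lcomm)
        qed (use ppc in auto)
        then have "Span (powD p n) us \<subseteq> ?I" by (rule Span_sub_ideal[OF _ _ us(1)]) (auto simp: powD_def)
        moreover have "?I \<subseteq> E n"
        proof
          fix x assume "x \<in> ?I"
          then obtain b where "b \<in> carrier R" "x = p [^] n \<otimes> b" by blast
          then show "x \<in> E n" unfolding E_def using ppc J.zero_closed
            by (intro CollectI conjI bexI[of _ \<zero>] bexI[of _ b]) (auto simp: a_minus_def)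
        qed
        ultimately show ?thesis by blast
      qed
      show "\<exists>y\<in>Span (powD p n) us. x \<ominus> y \<in> E (Suc n)" if x: "x \<in> E n" for x
      proof -
        obtain e b where 1: "e \<in> mA" "b \<in> carrier R" "(\<one> \<ominus> e) \<otimes> x = p [^] n \<otimes> b" using x unfolding E_def by blast
        have c: "e \<in> carrier R" "x \<in> carrier R" using 1 x J.Icarr unfolding E_def by auto
        let ?g = "\<one> \<ominus> e"
        have gc: "?g \<in> carrier R" using c by simp
        \<comment> \<open>The rescaled list still generates modulo \<open>mA\<close>, as
          \<open>u\<close> and \<open>?g \<otimes> u\<close> differ by \<open>e \<otimes> u\<close>.
          Approximating \<open>b\<close> in it makes the correction a multiple of \<open>?g\<close>,
          so that it can be transferred to \<open>x\<close>.\<close>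
        let ?vs = "map ((\<otimes>) ?g) us"
        have vsc: "set ?vs \<subseteq> carrier R" using us gc by auto
        have dJ: "dsub mA" by (rule dsub_ideal[OF mA_ideal])
        have dv: "dsub (span_over ?vs mA)" by (rule dsub_span_over[OF vsc dJ])
        have "span_over us mA \<subseteq> span_over ?vs mA"
        proof (rule span_over_min[OF _ span_over_incr[OF vsc dJ] dv])
          show "set us \<subseteq> span_over ?vs mA"
          proof
            fix u assume u: "u \<in> set us"
            then have uc: "u \<in> carrier R" using us by auto
            have "?g \<otimes> u \<in> span_over ?vs mA" using span_over_gen[OF vsc dJ] u by auto
            moreover have "e \<otimes> u \<in> span_over ?vs mA"
              using span_over_incr[OF vsc dJ] J.I_r_closed[OF 1(1) uc] by blast
            ultimately have "?g \<otimes> u \<oplus> e \<otimes> u \<in> span_over ?vs mA" by (rule dsub_add[OF dv])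
            moreover have "?g \<otimes> u \<oplus> e \<otimes> u = u" using c uc by algebra
            ultimately show "u \<in> span_over ?vs mA" by simp
          qed
        qed
        then have "span_over ?vs mA = carrier R" using us(2) dv unfolding dsub_def by blast
        from step1[OF vsc this 1(2)] obtain t where t: "t \<in> Span D ?vs" "b \<ominus> t \<in> E 1" by blast
        have "\<exists>s\<in>Span D us. t = ?g \<otimes> s" using t(1) us(1)
        proof (induct us arbitrary: t)
          case Nil then show ?case using gc by auto
        next
          case (Cons u us)
          then obtain d t' where *: "d \<in> D" "t' \<in> Span D (map ((\<otimes>) ?g) us)" "t = d \<otimes> (?g \<otimes> u) \<oplus> t'"
            by (auto elim!: line_extensionE)
          obtain s where s: "s \<in> Span D us" "t' = ?g \<otimes> s" using Cons(1)[OF *(2)] Cons(3) by auto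
          have sc: "s \<in> carrier R" using dsub_carrier[OF dsub_Span[OF D_ideal] s(1)] Cons(3) by auto
          have "t = ?g \<otimes> (d \<otimes> u \<oplus> s)" unfolding *(3) s(2)
            using gc sc Cons(3) *(1) by (simp add: r_distr m_lcomm)
          moreover have "d \<otimes> u \<oplus> s \<in> Span D (u # us)" unfolding Span_Cons using *(1) s(1) by (intro line_extensionI) auto
          ultimately show ?case by blast
        qed
        then obtain s where s: "s \<in> Span D us" "t = ?g \<otimes> s" by blast
        have sc: "s \<in> carrier R" using dsub_carrier[OF dsub_Span[OF D_ideal us(1)] s(1)] .
        obtain f w where f: "f \<in> mA" "w \<in> carrier R" "(\<one> \<ominus> f) \<otimes> (b \<ominus> t) = p [^] (1::nat) \<otimes> w"
          using t(2) unfolding E_def by blast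
        have fc: "f \<in> carrier R" using f J.Icarr by auto
        have tc: "t \<in> carrier R" unfolding s(2) using gc sc by simp
        have "((\<one> \<ominus> e) \<otimes> (\<one> \<ominus> f)) \<otimes> (x \<ominus> p [^] n \<otimes> s) = (\<one> \<ominus> f) \<otimes> (((\<one> \<ominus> e) \<otimes> x) \<ominus> p [^] n \<otimes> (?g \<otimes> s))"
          using c fc sc ppc[of n] by algebra
        also have "\<dots> = p [^] n \<otimes> ((\<one> \<ominus> f) \<otimes> (b \<ominus> t))"
          unfolding 1(3) s(2)[symmetric] using fc 1(2) tc ppc[of n] by algebra
        also have "\<dots> = p [^] Suc n \<otimes> w" unfolding f(3) using f(2) pc by (simp add: m_assoc)
        finally have "x \<ominus> p [^] n \<otimes> s \<in> E (Suc n)" unfolding E_def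
          using E_comb[OF 1(1) f(1)] c sc ppc f(2)
          by (intro CollectI conjI bexI[of _ "e \<oplus> f \<ominus> e \<otimes> f"] bexI[of _ w]) auto
        moreover have "p [^] n \<otimes> s \<in> Span (powD p n) us" using s(1) us(1)
        proof (induct us arbitrary: s)
          case Nil then show ?case using ppc by simp
        next
          case (Cons u us)
          then obtain d s' where *: "d \<in> D" "s' \<in> Span D us" "s = d \<otimes> u \<oplus> s'" by (auto elim!: line_extensionE)
          have sc: "s' \<in> carrier R" using dsub_carrier[OF dsub_Span[OF D_ideal] *(2)] Cons(3) by auto
          have "p [^] n \<otimes> s = (p [^] n \<otimes> d) \<otimes> u \<oplus> p [^] n \<otimes> s'"
            unfolding *(3) using sc Cons(3) *(1) ppc[of n] by (simp add: r_distr m_assoc)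
          then show ?case unfolding Span_Cons using Cons(1)[OF *(2)] Cons(3) *(1)
            by (intro line_extensionI) (auto simp: powD_def)
        qed
        ultimately show ?thesis by blast
      qed
    qed
    then obtain s where s: "s \<in> Span D us" "\<And>n. a \<ominus> s \<in> E n" by blast
    have sc: "s \<in> carrier R" using dsub_carrier[OF dsub_Span[OF D_ideal us(1)] s(1)] .
    have "a \<ominus> s = \<zero>" by (rule sep) (use s(2) in \<open>auto simp: E_def\<close>)
    then have "a = s" using a sc by simp
    then show "a \<in> Span D us" using s(1) by simp
  qed
qed

end

section \<open>Fractions and transcendence degree\<close>

text \<open>Collapses the unions over representatives in \<open>localization\<close> once the value
  is independent of them.\<close>

lemma UN_pairs_const:
  assumes "p \<in> A" "q \<in> B" "\<And>a s b t. (a, s) \<in> A \<Longrightarrow> (b, t) \<in> B \<Longrightarrow> f a s b t = C"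
  shows "(\<Union>(a, s)\<in>A. \<Union>(b, t)\<in>B. f a s b t) = C"
proof -
  have "(\<Union>(a, s)\<in>A. \<Union>(b, t)\<in>B. f a s b t) = (\<Union>x\<in>A. \<Union>y\<in>B. C)"
    by (intro SUP_cong refl) (auto simp: assms(3) split: prod.split)
  also have "\<dots> = C" using assms(1,2) by auto
  finally show ?thesis .
qed

text \<open>With nonzero denominators in a domain the factor \<open>u\<close> in
  \<open>loc_rel\<close> cancels, and equality of fractions becomes cross-multiplication.\<close>

locale domain_localization = domain R for R (structure) +
  fixes S :: "'a set"
  assumes S_sub: "S \<subseteq> carrier R - {\<zero>}" and S_one: "\<one> \<in> S"
    and S_mult: "s \<in> S \<Longrightarrow> t \<in> S \<Longrightarrow> s \<otimes> t \<in> S"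
begin

abbreviation "fr \<equiv> loc_frac R S"
abbreviation "LR \<equiv> localization R S"

lemma S_carr [simp, intro]: "s \<in> S \<Longrightarrow> s \<in> carrier R" and S_nz: "s \<in> S \<Longrightarrow> s \<noteq> \<zero>"
  using S_sub by auto

lemma loc_rel_iff:
  assumes "a \<in> carrier R" "b \<in> carrier R" "s \<in> S" "t \<in> S"
  shows "((a, s), (b, t)) \<in> loc_rel R S \<longleftrightarrow> a \<otimes> t = b \<otimes> s"
proof
  assume "((a, s), (b, t)) \<in> loc_rel R S"
  then obtain u where u: "u \<in> S" "u \<otimes> (a \<otimes> t \<ominus> b \<otimes> s) = \<zero>" unfolding loc_rel_def by auto
  then have "a \<otimes> t \<ominus> b \<otimes> s = \<zero>" using S_nz[OF u(1)] assms integral[of u "a \<otimes> t \<ominus> b \<otimes> s"] by auto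
  then show "a \<otimes> t = b \<otimes> s" using assms by simp
next
  assume "a \<otimes> t = b \<otimes> s"
  then have "\<one> \<otimes> (a \<otimes> t \<ominus> b \<otimes> s) = \<zero>" using assms by (simp add: a_minus_def r_neg)
  then show "((a, s), (b, t)) \<in> loc_rel R S" unfolding loc_rel_def using assms S_one by blast
qed

lemma frac_mem_iff:
  assumes "a \<in> carrier R" "s \<in> S"
  shows "p \<in> fr a s \<longleftrightarrow> (\<exists>b t. p = (b, t) \<and> b \<in> carrier R \<and> t \<in> S \<and> a \<otimes> t = b \<otimes> s)"
proof
  assume p: "p \<in> fr a s"
  obtain b t where bt: "p = (b, t)" by (cases p)
  then have "((a, s), (b, t)) \<in> loc_rel R S" using p unfolding loc_frac_def by simp
  moreover from this have "b \<in> carrier R" "t \<in> S" unfolding loc_rel_def by auto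
  ultimately show "\<exists>b t. p = (b, t) \<and> b \<in> carrier R \<and> t \<in> S \<and> a \<otimes> t = b \<otimes> s"
    using bt loc_rel_iff[OF assms(1) _ assms(2)] by blast
next
  assume "\<exists>b t. p = (b, t) \<and> b \<in> carrier R \<and> t \<in> S \<and> a \<otimes> t = b \<otimes> s"
  then show "p \<in> fr a s" unfolding loc_frac_def using loc_rel_iff[OF assms(1) _ assms(2)] by auto
qed

lemma frac_eq_iff:
  assumes "a \<in> carrier R" "b \<in> carrier R" "s \<in> S" "t \<in> S"
  shows "fr a s = fr b t \<longleftrightarrow> a \<otimes> t = b \<otimes> s"
proof
  assume "fr a s = fr b t"
  moreover have "(b, t) \<in> fr b t" using assms by (simp add: frac_mem_iff)
  ultimately have "(b, t) \<in> fr a s" by simp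
  then show "a \<otimes> t = b \<otimes> s" using assms by (simp add: frac_mem_iff)
next
  assume eq: "a \<otimes> t = b \<otimes> s"
  have "a \<otimes> v = c \<otimes> s \<longleftrightarrow> b \<otimes> v = c \<otimes> t" if "c \<in> carrier R" "v \<in> S" for c v
  proof -
    have vc: "v \<in> carrier R" "s \<in> carrier R" "t \<in> carrier R" using that assms by auto
    have "t \<otimes> (a \<otimes> v) = (a \<otimes> t) \<otimes> v" using assms vc by (simp add: m_ac)
    also have "\<dots> = s \<otimes> (b \<otimes> v)" unfolding eq using assms vc by (simp add: m_ac)
    finally have 1: "t \<otimes> (a \<otimes> v) = s \<otimes> (b \<otimes> v)" .
    have 2: "t \<otimes> (c \<otimes> s) = s \<otimes> (c \<otimes> t)" using that assms vc by (simp add: m_ac)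
    have "a \<otimes> v = c \<otimes> s \<longleftrightarrow> t \<otimes> (a \<otimes> v) = t \<otimes> (c \<otimes> s)"
      using m_lcancel[of t] S_nz[OF assms(4)] assms vc that by simp
    also have "\<dots> \<longleftrightarrow> s \<otimes> (b \<otimes> v) = s \<otimes> (c \<otimes> t)" unfolding 1 2 ..
    also have "\<dots> \<longleftrightarrow> b \<otimes> v = c \<otimes> t"
      using m_lcancel[of s] S_nz[OF assms(3)] assms vc that by simp
    finally show ?thesis .
  qed
  then show "fr a s = fr b t" using assms by (auto simp: frac_mem_iff set_eq_iff)
qed

lemma LR_mult:
  assumes "a \<in> carrier R" "b \<in> carrier R" "s \<in> S" "t \<in> S"
  shows "fr a s \<otimes>\<^bsub>LR\<^esub> fr b t = fr (a \<otimes> b) (s \<otimes> t)"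
proof -
  have eq: "fr (a' \<otimes> b') (s' \<otimes> t') = fr (a \<otimes> b) (s \<otimes> t)"
    if "(a', s') \<in> fr a s" "(b', t') \<in> fr b t" for a' s' b' t'
  proof -
    have *: "a' \<in> carrier R" "s' \<in> S" "a \<otimes> s' = a' \<otimes> s" "b' \<in> carrier R" "t' \<in> S" "b \<otimes> t' = b' \<otimes> t"
      using that assms by (auto simp: frac_mem_iff)
    have c: "s \<in> carrier R" "t \<in> carrier R" "s' \<in> carrier R" "t' \<in> carrier R" using assms * by auto
    have "(a' \<otimes> b') \<otimes> (s \<otimes> t) = (a' \<otimes> s) \<otimes> (b' \<otimes> t)" using * c by (simp add: m_ac)
    also have "\<dots> = (a \<otimes> s') \<otimes> (b \<otimes> t')" using * by simp
    also have "\<dots> = (a \<otimes> b) \<otimes> (s' \<otimes> t')" using assms c by (simp add: m_ac)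
    finally show ?thesis using * assms S_mult by (subst frac_eq_iff) auto
  qed
  have mem: "(a, s) \<in> fr a s" "(b, t) \<in> fr b t" using assms by (auto simp: frac_mem_iff)
  show ?thesis unfolding localization_def
    using UN_pairs_const[OF mem, of "\<lambda>a s b t. fr (a \<otimes> b) (s \<otimes> t)", OF eq] by simp
qed

lemma LR_add:
  assumes "a \<in> carrier R" "b \<in> carrier R" "s \<in> S" "t \<in> S"
  shows "fr a s \<oplus>\<^bsub>LR\<^esub> fr b t = fr (a \<otimes> t \<oplus> b \<otimes> s) (s \<otimes> t)"
proof -
  have eq: "fr (a' \<otimes> t' \<oplus> b' \<otimes> s') (s' \<otimes> t') = fr (a \<otimes> t \<oplus> b \<otimes> s) (s \<otimes> t)"
    if "(a', s') \<in> fr a s" "(b', t') \<in> fr b t" for a' s' b' t'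
  proof -
    have *: "a' \<in> carrier R" "s' \<in> S" "a \<otimes> s' = a' \<otimes> s" "b' \<in> carrier R" "t' \<in> S" "b \<otimes> t' = b' \<otimes> t"
      using that assms by (auto simp: frac_mem_iff)
    have c: "s \<in> carrier R" "t \<in> carrier R" "s' \<in> carrier R" "t' \<in> carrier R" using assms * by auto
    have "(a' \<otimes> t' \<oplus> b' \<otimes> s') \<otimes> (s \<otimes> t) = (a' \<otimes> s) \<otimes> (t' \<otimes> t) \<oplus> (b' \<otimes> t) \<otimes> (s' \<otimes> s)"
      using *(1,4) c by algebra
    also have "\<dots> = (a \<otimes> s') \<otimes> (t' \<otimes> t) \<oplus> (b \<otimes> t') \<otimes> (s' \<otimes> s)" using * by simp
    also have "\<dots> = (a \<otimes> t \<oplus> b \<otimes> s) \<otimes> (s' \<otimes> t')" using assms(1,2) c by algebra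
    finally show ?thesis using * assms S_mult by (subst frac_eq_iff) auto
  qed
  have mem: "(a, s) \<in> fr a s" "(b, t) \<in> fr b t" using assms by (auto simp: frac_mem_iff)
  show ?thesis unfolding localization_def
    using UN_pairs_const[OF mem, of "\<lambda>a s b t. fr (a \<otimes> t \<oplus> b \<otimes> s) (s \<otimes> t)", OF eq] by simp
qed

lemma LR_carrier: "carrier LR = {fr a s | a s. a \<in> carrier R \<and> s \<in> S}"
  and LR_one: "\<one>\<^bsub>LR\<^esub> = fr \<one> \<one>" and LR_zero: "\<zero>\<^bsub>LR\<^esub> = fr \<zero> \<one>"
  unfolding localization_def by auto

lemma LR_closed [simp, intro]: "a \<in> carrier R \<Longrightarrow> s \<in> S \<Longrightarrow> fr a s \<in> carrier LR"
  unfolding LR_carrier by blast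

lemma LR_cring: "cring LR"
proof (rule cringI)
  note S = S_one S_mult
  show "abelian_group LR"
  proof (rule abelian_groupI)
    fix x y assume "x \<in> carrier LR" "y \<in> carrier LR"
    then obtain a b s t where *: "a \<in> carrier R" "b \<in> carrier R" "s \<in> S" "t \<in> S" "x = fr a s" "y = fr b t"
      unfolding LR_carrier by blast
    show "x \<oplus>\<^bsub>LR\<^esub> y \<in> carrier LR" using * S by (auto simp: LR_add)
    have "a \<otimes> t \<oplus> b \<otimes> s = b \<otimes> s \<oplus> a \<otimes> t" "s \<otimes> t = t \<otimes> s" using * by (auto simp: a_comm m_comm)
    then show "x \<oplus>\<^bsub>LR\<^esub> y = y \<oplus>\<^bsub>LR\<^esub> x" using * S by (simp add: LR_add)
  next
    fix x y z assume "x \<in> carrier LR" "y \<in> carrier LR" "z \<in> carrier LR"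
    then obtain a b c s t u where *: "a \<in> carrier R" "b \<in> carrier R" "c \<in> carrier R" "s \<in> S" "t \<in> S" "u \<in> S"
      "x = fr a s" "y = fr b t" "z = fr c u"
      unfolding LR_carrier by blast
    have "(a \<otimes> t \<oplus> b \<otimes> s) \<otimes> u \<oplus> c \<otimes> (s \<otimes> t) = a \<otimes> (t \<otimes> u) \<oplus> (b \<otimes> u \<oplus> c \<otimes> t) \<otimes> s"
      using *(1-3) S_carr[OF *(4)] S_carr[OF *(5)] S_carr[OF *(6)] by algebra
    then show "x \<oplus>\<^bsub>LR\<^esub> y \<oplus>\<^bsub>LR\<^esub> z = x \<oplus>\<^bsub>LR\<^esub> (y \<oplus>\<^bsub>LR\<^esub> z)" using * S by (simp add: LR_add m_assoc)
  next
    show "\<zero>\<^bsub>LR\<^esub> \<in> carrier LR" using S by (simp add: LR_zero)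
  next
    fix x assume "x \<in> carrier LR"
    then obtain a s where *: "a \<in> carrier R" "s \<in> S" "x = fr a s" unfolding LR_carrier by blast
    then show "\<zero>\<^bsub>LR\<^esub> \<oplus>\<^bsub>LR\<^esub> x = x" using S by (simp add: LR_zero LR_add)
    have "fr (\<ominus> a) s \<oplus>\<^bsub>LR\<^esub> x = fr (\<ominus> a \<otimes> s \<oplus> a \<otimes> s) (s \<otimes> s)" using * by (simp add: LR_add)
    also have "\<dots> = \<zero>\<^bsub>LR\<^esub>" using * S by (simp add: LR_zero frac_eq_iff l_minus l_neg)
    finally show "\<exists>y\<in>carrier LR. y \<oplus>\<^bsub>LR\<^esub> x = \<zero>\<^bsub>LR\<^esub>" using * by (intro bexI[of _ "fr (\<ominus> a) s"]) auto
  qed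
  show "comm_monoid LR"
  proof (rule comm_monoidI)
    fix x y assume "x \<in> carrier LR" "y \<in> carrier LR"
    then obtain a b s t where *: "a \<in> carrier R" "b \<in> carrier R" "s \<in> S" "t \<in> S" "x = fr a s" "y = fr b t"
      unfolding LR_carrier by blast
    then show "x \<otimes>\<^bsub>LR\<^esub> y \<in> carrier LR" "x \<otimes>\<^bsub>LR\<^esub> y = y \<otimes>\<^bsub>LR\<^esub> x" using S by (auto simp: LR_mult m_comm)
  next
    fix x y z assume "x \<in> carrier LR" "y \<in> carrier LR" "z \<in> carrier LR"
    then obtain a b c s t u where *: "a \<in> carrier R" "b \<in> carrier R" "c \<in> carrier R" "s \<in> S" "t \<in> S" "u \<in> S"
      "x = fr a s" "y = fr b t" "z = fr c u"
      unfolding LR_carrier by blast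
    then show "x \<otimes>\<^bsub>LR\<^esub> y \<otimes>\<^bsub>LR\<^esub> z = x \<otimes>\<^bsub>LR\<^esub> (y \<otimes>\<^bsub>LR\<^esub> z)" using S by (simp add: LR_mult m_assoc)
  next
    fix x assume "x \<in> carrier LR"
    then obtain a s where *: "a \<in> carrier R" "s \<in> S" "x = fr a s" unfolding LR_carrier by blast
    then show "\<one>\<^bsub>LR\<^esub> \<otimes>\<^bsub>LR\<^esub> x = x" using S by (simp add: LR_one LR_mult)
  qed (use S in \<open>simp add: LR_one\<close>)
  fix x y z assume "x \<in> carrier LR" "y \<in> carrier LR" "z \<in> carrier LR"
  then obtain a b c s t u where *: "a \<in> carrier R" "b \<in> carrier R" "c \<in> carrier R" "s \<in> S" "t \<in> S" "u \<in> S"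
    "x = fr a s" "y = fr b t" "z = fr c u"
    unfolding LR_carrier by blast
  have "((a \<otimes> t \<oplus> b \<otimes> s) \<otimes> c) \<otimes> ((s \<otimes> u) \<otimes> (t \<otimes> u)) = ((a \<otimes> c) \<otimes> (t \<otimes> u) \<oplus> (b \<otimes> c) \<otimes> (s \<otimes> u)) \<otimes> ((s \<otimes> t) \<otimes> u)"
    using *(1-3) S_carr[OF *(4)] S_carr[OF *(5)] S_carr[OF *(6)] by algebra
  then show "(x \<oplus>\<^bsub>LR\<^esub> y) \<otimes>\<^bsub>LR\<^esub> z = x \<otimes>\<^bsub>LR\<^esub> z \<oplus>\<^bsub>LR\<^esub> y \<otimes>\<^bsub>LR\<^esub> z"
    using * S by (simp add: LR_add LR_mult frac_eq_iff)
qed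

abbreviation incl :: "'a \<Rightarrow> ('a \<times> 'a) set" where "incl a \<equiv> fr a \<one>"

lemma incl_hom: "ring_hom_ring R LR incl"
proof -
  interpret LR: cring LR by (rule LR_cring)
  show ?thesis
    by (rule ring_hom_ringI[OF ring_axioms LR.ring_axioms])
      (use S_one in \<open>auto simp: LR_mult LR_add LR_one\<close>)
qed

lemma incl_eq_iff: "a \<in> carrier R \<Longrightarrow> b \<in> carrier R \<Longrightarrow> incl a = incl b \<longleftrightarrow> a = b"
  using S_one by (simp add: frac_eq_iff)

lemma incl_eq_zero_iff: "a \<in> carrier R \<Longrightarrow> incl a = \<zero>\<^bsub>LR\<^esub> \<longleftrightarrow> a = \<zero>"
  unfolding LR_zero by (rule incl_eq_iff) auto

lemma frac_eq_zero_iff: "a \<in> carrier R \<Longrightarrow> s \<in> S \<Longrightarrow> fr a s = \<zero>\<^bsub>LR\<^esub> \<longleftrightarrow> a = \<zero>"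
  unfolding LR_zero using S_one by (simp add: frac_eq_iff)

lemma incl_mult_frac: "a \<in> carrier R \<Longrightarrow> s \<in> S \<Longrightarrow> incl s \<otimes>\<^bsub>LR\<^esub> fr a s = incl a"
  using S_one by (simp add: LR_mult frac_eq_iff m_comm)

end

lemma (in domain) frac_domain_localization: "domain_localization R (carrier R - {\<zero>})"
  by unfold_locales (auto simp: integral_iff)

lemma (in domain) frac_field_is_field: "field (frac_field R)"
proof -
  interpret F: domain_localization R "carrier R - {\<zero>}" by (rule frac_domain_localization)
  interpret C: cring "frac_field R" unfolding frac_field_def by (rule F.LR_cring)
  show ?thesis
  proof (rule C.cring_fieldI)
    show "Units (frac_field R) = carrier (frac_field R) - {\<zero>\<^bsub>frac_field R\<^esub>}" (is "?U = ?V")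
    proof
      have ne: "\<zero>\<^bsub>frac_field R\<^esub> \<noteq> \<one>\<^bsub>frac_field R\<^esub>"
        unfolding frac_field_def F.LR_one F.LR_zero using F.S_one by (simp add: F.frac_eq_iff)
      show "?U \<subseteq> ?V"
      proof
        fix x assume x: "x \<in> ?U"
        have "x \<noteq> \<zero>\<^bsub>frac_field R\<^esub>"
        proof
          assume "x = \<zero>\<^bsub>frac_field R\<^esub>"
          then show False using C.Units_r_inv[OF x] C.l_null[OF C.Units_inv_closed[OF x]] ne by metis
        qed
        then show "x \<in> ?V" using C.Units_closed[OF x] by blast
      qed
      show "?V \<subseteq> ?U"
      proof
        fix x assume x: "x \<in> ?V"
        then obtain a s where *: "a \<in> carrier R" "s \<in> carrier R - {\<zero>}" "x = F.fr a s"
          unfolding frac_field_def F.LR_carrier by blast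
        then have a: "a \<in> carrier R - {\<zero>}" using x F.frac_eq_zero_iff[of a s] unfolding frac_field_def by auto
        have "F.fr s a \<otimes>\<^bsub>frac_field R\<^esub> x = \<one>\<^bsub>frac_field R\<^esub>"
        proof -
          have "F.fr s a \<otimes>\<^bsub>F.LR\<^esub> F.fr a s = F.fr (s \<otimes> a) (a \<otimes> s)" using F.LR_mult[of s a a s] * a by blast
          also have "\<dots> = F.fr \<one> \<one>"
            using F.frac_eq_iff[OF _ one_closed F.S_mult[OF a *(2)] F.S_one, of "s \<otimes> a"] * a by (simp add: m_comm)
          finally show ?thesis unfolding frac_field_def F.LR_one *(3) .
        qed
        moreover have "F.fr s a \<in> carrier (frac_field R)" unfolding frac_field_def using * a by (intro F.LR_closed) auto
        ultimately show "x \<in> ?U" using x C.m_comm[of x "F.fr s a"] unfolding Units_def by auto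
      qed
    qed
  qed
qed

section \<open>Polynomials in one variable among the indexed polynomials, and transcendence
  degree\<close>

lemma set_mset_subset_singleton: "set_mset M \<subseteq> {x} \<longleftrightarrow> M = replicate_mset (size M) x"
proof
  assume "set_mset M \<subseteq> {x}"
  then show "M = replicate_mset (size M) x"
    by (induct M) auto
next
  assume "M = replicate_mset (size M) x"
  then have "set_mset M = set_mset (replicate_mset (size M) x)" by simp
  then show "set_mset M \<subseteq> {x}" by (auto split: if_splits)
qed

context ring
begin

text \<open>The polynomial with coefficients \<open>c\<close> in the single indeterminate
  \<open>x\<close>: a monomial in \<open>x\<close> alone is a multiset of copies of
  \<open>x\<close>, and its size is the exponent.\<close>

definition upoly :: "'c \<Rightarrow> (nat \<Rightarrow> 'a) \<Rightarrow> 'c multiset \<Rightarrow> 'a" where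
  "upoly x c = (\<lambda>M. if set_mset M \<subseteq> {x} then c (size M) else \<zero>)"

text \<open>Horner's scheme: splitting off the constant term leaves \<open>x\<close> times a
  polynomial of lower degree, which matches the constructors of \<open>indexed_pset\<close>.\<close>

lemma upoly_mem:
  assumes K: "K \<subseteq> carrier R" "\<zero> \<in> K" and x: "x \<in> T" and c: "\<And>i. c i \<in> K" "\<And>i. i > k \<Longrightarrow> c i = \<zero>"
  shows "upoly x c \<in> indexed_pset T K"
  using c
proof (induct k arbitrary: c)
  case 0
  have "upoly x c = indexed_const (c 0)"
  proof
    fix M show "upoly x c M = indexed_const (c 0) M"
      using 0(2)[of "size M"] unfolding upoly_def indexed_const_def by (cases "M = {#}") (auto simp: nonempty_has_size)
  qed
  then show ?case using indexed_pset.indexed_const[of "c 0" K T] 0(1)[of 0] by simp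
next
  case (Suc k)
  have "upoly x (\<lambda>i. c (Suc i)) \<in> indexed_pset T K" using Suc by auto
  then have 1: "indexed_pmult (upoly x (\<lambda>i. c (Suc i))) x \<in> indexed_pset T K" using x by (rule indexed_pset.indexed_pmult)
  have "upoly x c = indexed_padd (indexed_pmult (upoly x (\<lambda>i. c (Suc i))) x) (indexed_const (c 0))"
  proof
    fix M
    have cc: "c i \<in> carrier R" for i using Suc K by blast
    show "upoly x c M = indexed_padd (indexed_pmult (upoly x (\<lambda>i. c (Suc i))) x) (indexed_const (c 0)) M"
    proof (cases "x \<in># M")
      case True
      then obtain N where N: "M = add_mset x N" by (metis multi_member_split)
      then show ?thesis unfolding upoly_def indexed_padd_def indexed_pmult_def indexed_const_def
        using cc by auto
    next
      case False
      then show ?thesis unfolding upoly_def indexed_padd_def indexed_pmult_def indexed_const_def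
        using cc by (cases "M = {#}") auto
    qed
  qed
  then show ?case using indexed_pset.indexed_padd[OF 1 indexed_pset.indexed_const[OF Suc(2)[of 0]]] by simp
qed

lemma indexed_pset_upoly:
  assumes K: "K \<subseteq> carrier R" "\<zero> \<in> K" "\<And>a b. a \<in> K \<Longrightarrow> b \<in> K \<Longrightarrow> a \<oplus> b \<in> K"
    and p: "p \<in> indexed_pset {x} K"
  shows "\<exists>c k. (\<forall>i. c i \<in> K) \<and> (\<forall>i>k. c i = \<zero>) \<and> p = upoly x c"
  using p
proof induct
  case (indexed_const a)
  have "indexed_const a = upoly x (\<lambda>i. if i = 0 then a else \<zero>)"
    unfolding upoly_def indexed_const_def by (rule ext) auto
  then show ?case using indexed_const K by (intro exI[of _ "\<lambda>i. if i = 0 then a else \<zero>"] exI[of _ 0]) auto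
next
  case (indexed_padd P Q)
  then obtain c k d l where *: "\<And>i. c i \<in> K" "\<And>i. i > k \<Longrightarrow> c i = \<zero>" "P = upoly x c"
    "\<And>i. d i \<in> K" "\<And>i. i > l \<Longrightarrow> d i = \<zero>" "Q = upoly x d" by blast
  have "indexed_padd P Q = upoly x (\<lambda>i. c i \<oplus> d i)"
    unfolding *(3,6) upoly_def indexed_padd_def by (rule ext) auto
  then show ?case using * K
    by (intro exI[of _ "\<lambda>i. c i \<oplus> d i"] exI[of _ "max k l"]) auto
next
  case (indexed_pmult P i)
  then obtain c k where *: "\<And>i. c i \<in> K" "\<And>i. i > k \<Longrightarrow> c i = \<zero>" "P = upoly x c" by blast
  have i: "i = x" using indexed_pmult by simp
  let ?c = "\<lambda>i. case i of 0 \<Rightarrow> \<zero> | Suc j \<Rightarrow> c j"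
  have "indexed_pmult P i = upoly x ?c"
  proof
    fix M show "indexed_pmult P i M = upoly x ?c M"
    proof (cases "x \<in># M")
      case True
      then obtain N where N: "M = add_mset x N" by (metis multi_member_split)
      then show ?thesis unfolding *(3) i upoly_def indexed_pmult_def by auto
    next
      case False
      then show ?thesis unfolding *(3) i upoly_def indexed_pmult_def by (cases "M = {#}") auto
    qed
  qed
  then show ?case using * K
    by (intro exI[of _ ?c] exI[of _ "Suc k"]) (auto split: nat.splits)
qed

end

text \<open>Only multisets of copies of \<open>x\<close> contribute, and these are indexed by their
  size.\<close>

lemma (in cring) mpoly_eval_upoly:
  assumes x: "x \<in> carrier R" and c: "\<And>i. c i \<in> carrier R" "\<And>i. i > k \<Longrightarrow> c i = \<zero>"
  shows "mpoly_eval R (upoly x c) = (\<Oplus>i\<in>{..k}. c i \<otimes> x [^] i)"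
proof -
  let ?f = "\<lambda>M. upoly x c M \<otimes> (\<Otimes>y\<in>set_mset M. y [^] count M y)"
  let ?A = "(\<lambda>i. replicate_mset i x) ` {..k}"
  have tm: "?f (replicate_mset i x) = c i \<otimes> x [^] i" for i
  proof -
    have "(\<Otimes>y\<in>set_mset (replicate_mset i x). y [^] count (replicate_mset i x) y) = x [^] i"
      using x by (cases "i = 0") (auto simp: finprod_insert)
    then show ?thesis unfolding upoly_def by (auto split: if_splits)
  qed
  have sub: "{M. upoly x c M \<noteq> \<zero>} \<subseteq> ?A"
  proof
    fix M assume "M \<in> {M. upoly x c M \<noteq> \<zero>}"
    then have "set_mset M \<subseteq> {x}" "c (size M) \<noteq> \<zero>" unfolding upoly_def by (auto split: if_splits)
    then have "M = replicate_mset (size M) x" "size M \<le> k"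
      using set_mset_subset_singleton[of M x] c(2)[of "size M"] by (blast, metis not_le)
    then show "M \<in> ?A" by blast
  qed
  have "mpoly_eval R (upoly x c) = (\<Oplus>M\<in>{M. upoly x c M \<noteq> \<zero>}. ?f M)"
    unfolding mpoly_eval_def ..
  also have "\<dots> = (\<Oplus>M\<in>?A. ?f M)"
  proof (rule add.finprod_mono_neutral_cong_left)
    show "?f M = \<zero>" if "M \<in> ?A - {M. upoly x c M \<noteq> \<zero>}" for M
    proof -
      have "upoly x c M = \<zero>" using that by blast
      moreover have "\<exists>i. M = replicate_mset i x" using that by blast
      moreover have "(\<Otimes>y\<in>set_mset (replicate_mset i x). y [^] count (replicate_mset i x) y) \<in> carrier R" for i
        using x by (intro finprod_closed) (auto split: if_splits)
      ultimately show ?thesis by force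
    qed
    show "?f \<in> ?A \<rightarrow> carrier R" using tm x c by auto
  qed (use sub in auto)
  also have "\<dots> = (\<Oplus>i\<in>{..k}. ?f (replicate_mset i x))"
  proof (rule finsum_reindex)
    show "?f \<in> ?A \<rightarrow> carrier R" using tm x c by auto
    show "inj_on (\<lambda>i. replicate_mset i x) {..k}"
      by (rule inj_onI) (metis size_replicate_mset)
  qed
  also have "\<dots> = (\<Oplus>i\<in>{..k}. c i \<otimes> x [^] i)" unfolding tm ..
  finally show ?thesis .
qed

text \<open>In degree zero even a one-element set is dependent, and a common denominator moves the
  coefficients of its relation from the fraction field of \<open>S\<close> into
  \<open>S\<close>.\<close>

lemma (in domain) algebraic_of_trdeg_zero:
  assumes S: "subring S R" and tr: "trdeg S R = 0" and x: "x \<in> carrier R"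
  shows "\<exists>q. set q \<subseteq> S \<and> \<not> set q \<subseteq> {\<zero>} \<and> eval q x = \<zero>"
proof -
  interpret F: domain_localization R "carrier R - {\<zero>}" by (rule frac_domain_localization)
  interpret L: field "frac_field R" by (rule frac_field_is_field)
  have Leq: "frac_field R = F.LR" unfolding frac_field_def ..
  interpret i: ring_hom_ring R "frac_field R" F.incl unfolding Leq by (rule F.incl_hom)
  note SE = subringE[OF S]
  let ?L = "frac_field R"
  define K where "K = frac_subfield R S"
  have K: "K = {F.fr a s | a s. a \<in> S \<and> s \<in> S \<and> s \<noteq> \<zero>}" unfolding K_def frac_subfield_def by simp
  have one: "\<one> \<in> S - {\<zero>}" using SE(3) by auto
  have Kc: "K \<subseteq> carrier ?L"
  proof
    fix z assume "z \<in> K"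
    then obtain a s where "a \<in> S" "s \<in> S" "s \<noteq> \<zero>" "z = F.fr a s" unfolding K by blast
    then show "z \<in> carrier ?L" unfolding Leq using SE(1) F.LR_closed[of a s] by blast
  qed
  have inclK: "F.incl a \<in> K" if "a \<in> S" for a unfolding K using that one by blast
  have K0: "\<zero>\<^bsub>?L\<^esub> \<in> K" unfolding Leq F.LR_zero using inclK SE(2) by blast
  have Kadd: "a \<oplus>\<^bsub>?L\<^esub> b \<in> K" if ab: "a \<in> K" "b \<in> K" for a b
  proof -
    obtain u s where us: "u \<in> S" "s \<in> S" "s \<noteq> \<zero>" "a = F.fr u s" using ab(1) unfolding K by blast
    obtain v t where vt: "v \<in> S" "t \<in> S" "t \<noteq> \<zero>" "b = F.fr v t" using ab(2) unfolding K by blast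
    have c: "u \<in> carrier R" "s \<in> carrier R - {\<zero>}" "v \<in> carrier R" "t \<in> carrier R - {\<zero>}" using us vt SE(1) by auto
    have "a \<oplus>\<^bsub>?L\<^esub> b = F.fr (u \<otimes> t \<oplus> v \<otimes> s) (s \<otimes> t)"
      unfolding us(4) vt(4) Leq by (rule F.LR_add[OF c(1,3,2,4)])
    moreover have "s \<otimes> t \<noteq> \<zero>" using c by (auto simp: integral_iff)
    moreover have "u \<otimes> t \<oplus> v \<otimes> s \<in> S" "s \<otimes> t \<in> S" using us vt SE(6,7) by auto
    ultimately show ?thesis unfolding K by blast
  qed
  let ?x = "F.incl x"
  have xL: "?x \<in> carrier ?L" using x by simp
  have "\<not> alg_independent ?L K {?x}"
  proof
    assume "alg_independent ?L K {?x}"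
    then have "enat (card {?x}) \<le> trdeg S R" unfolding trdeg_def field_trdeg_def K_def[symmetric]
      using xL by (intro Sup_upper CollectI exI[of _ "{?x}"]) auto
    then show False unfolding tr by (simp add: zero_enat_def)
  qed
  then obtain p where p: "p \<in> L.indexed_pset {?x} K" "mpoly_eval ?L p = \<zero>\<^bsub>?L\<^esub>" "p \<noteq> L.indexed_const \<zero>\<^bsub>?L\<^esub>"
    unfolding alg_independent_def by blast
  obtain c k where c: "\<And>i. c i \<in> K" "\<And>i. i > k \<Longrightarrow> c i = \<zero>\<^bsub>?L\<^esub>" "p = L.upoly ?x c"
    using L.indexed_pset_upoly[OF Kc K0 Kadd p(1)] by blast
  have cL: "c i \<in> carrier ?L" for i using c(1) Kc by blast
  have sum0: "(\<Oplus>\<^bsub>?L\<^esub>i\<in>{..k}. c i \<otimes>\<^bsub>?L\<^esub> ?x [^]\<^bsub>?L\<^esub> i) = \<zero>\<^bsub>?L\<^esub>"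
    using L.mpoly_eval_upoly[OF xL cL c(2)] p(2) c(3) by simp
  have "\<exists>j. c j \<noteq> \<zero>\<^bsub>?L\<^esub>"
  proof (rule ccontr)
    assume "\<not> ?thesis"
    then have "p = L.indexed_const \<zero>\<^bsub>?L\<^esub>" unfolding c(3) L.upoly_def L.indexed_const_def by (intro ext) auto
    with p(3) show False by simp
  qed
  then obtain j where j: "c j \<noteq> \<zero>\<^bsub>?L\<^esub>" by blast
  then have jk: "j \<le> k" using c(2)[of j] by (meson not_le)
  \<comment> \<open>A common denominator \<open>t\<close> of the first \<open>n\<close>
    coefficients, built up by induction.\<close>
  have "\<exists>t r. t \<in> S \<and> t \<noteq> \<zero> \<and> (\<forall>i. r i \<in> S) \<and> (\<forall>i<n. F.incl t \<otimes>\<^bsub>?L\<^esub> c i = F.incl (r i))" for n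
  proof (induct n)
    case 0 show ?case using one by (intro exI[of _ \<one>] exI[of _ "\<lambda>_. \<one>"]) auto
  next
    case (Suc n)
    then obtain t r where tr: "t \<in> S" "t \<noteq> \<zero>" "\<And>i. r i \<in> S" "\<And>i. i < n \<Longrightarrow> F.incl t \<otimes>\<^bsub>?L\<^esub> c i = F.incl (r i)" by blast
    obtain u s where us: "u \<in> S" "s \<in> S" "s \<noteq> \<zero>" "c n = F.fr u s" using c(1)[of n] unfolding K by blast
    have cc: "t \<in> carrier R" "s \<in> carrier R" "u \<in> carrier R" using tr us SE(1) by auto
    have ic: "F.incl t \<in> carrier ?L" "F.incl s \<in> carrier ?L" using cc by auto
    have scn: "F.incl s \<otimes>\<^bsub>?L\<^esub> c n = F.incl u" unfolding us(4) Leq by (rule F.incl_mult_frac) (use cc us in auto)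
    let ?r = "\<lambda>i. if i = n then t \<otimes> u else s \<otimes> r i"
    have A1: "F.incl (t \<otimes> s) \<otimes>\<^bsub>?L\<^esub> c i = F.incl (?r i)" if "i < Suc n" for i
    proof (cases "i = n")
      case True
      have "F.incl (t \<otimes> s) \<otimes>\<^bsub>?L\<^esub> c n = F.incl t \<otimes>\<^bsub>?L\<^esub> (F.incl s \<otimes>\<^bsub>?L\<^esub> c n)"
        using cc ic cL[of n] by (simp add: L.m_assoc)
      then show ?thesis using True scn cc by simp
    next
      case False
      have rc: "r i \<in> carrier R" using tr SE(1) by blast
      have "F.incl (t \<otimes> s) \<otimes>\<^bsub>?L\<^esub> c i = F.incl s \<otimes>\<^bsub>?L\<^esub> (F.incl t \<otimes>\<^bsub>?L\<^esub> c i)"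
        using cc ic cL[of i] by (simp add: L.m_assoc L.m_lcomm)
      then show ?thesis using False that tr(4)[of i] cc rc by simp
    qed
    have A2: "t \<otimes> s \<noteq> \<zero>" using integral_iff[OF cc(1,2)] tr(2) us(3) by simp
    have A3: "?r i \<in> S" for i using SE(6)[OF tr(1) us(1)] SE(6)[OF us(2) tr(3)[of i]] by simp
    show ?case
      by (intro exI[of _ "t \<otimes> s"] exI[of _ ?r] conjI allI impI A1 A2 A3 SE(6)[OF tr(1) us(2)])
  qed
  then obtain t r where t: "t \<in> S" "t \<noteq> \<zero>" "\<And>i. r i \<in> S" "\<And>i. i < Suc k \<Longrightarrow> F.incl t \<otimes>\<^bsub>?L\<^esub> c i = F.incl (r i)" by metis
  have tc: "t \<in> carrier R" and rc: "r i \<in> carrier R" for i using t SE(1) by auto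
  have tL: "F.incl t \<in> carrier ?L" using tc by simp
  have "F.incl (\<Oplus>i\<in>{..k}. r i \<otimes> x [^] i) = (\<Oplus>\<^bsub>?L\<^esub>i\<in>{..k}. F.incl (r i \<otimes> x [^] i))"
    by (rule i.hom_finsum[of "\<lambda>i. r i \<otimes> x [^] i" "{..k}", unfolded comp_def]) (intro Pi_I m_closed nat_pow_closed rc x)
  also have "\<dots> = (\<Oplus>\<^bsub>?L\<^esub>i\<in>{..k}. F.incl t \<otimes>\<^bsub>?L\<^esub> (c i \<otimes>\<^bsub>?L\<^esub> ?x [^]\<^bsub>?L\<^esub> i))"
  proof (rule L.finsum_cong')
    fix i assume "i \<in> {..k}"
    then have "F.incl (r i) = F.incl t \<otimes>\<^bsub>?L\<^esub> c i" using t(4) by simp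
    then show "F.incl (r i \<otimes> x [^] i) = F.incl t \<otimes>\<^bsub>?L\<^esub> (c i \<otimes>\<^bsub>?L\<^esub> ?x [^]\<^bsub>?L\<^esub> i)"
      using rc x tL cL xL by (simp add: i.hom_nat_pow L.m_assoc)
  qed (use tL cL xL in auto)
  also have "\<dots> = F.incl t \<otimes>\<^bsub>?L\<^esub> (\<Oplus>\<^bsub>?L\<^esub>i\<in>{..k}. c i \<otimes>\<^bsub>?L\<^esub> ?x [^]\<^bsub>?L\<^esub> i)"
    by (rule L.finsum_rdistr[symmetric]) (use tL cL xL in auto)
  also have "\<dots> = \<zero>\<^bsub>?L\<^esub>" unfolding sum0 using tL by simp
  finally have "F.incl (\<Oplus>i\<in>{..k}. r i \<otimes> x [^] i) = \<zero>\<^bsub>?L\<^esub>" .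
  moreover have "(\<Oplus>i\<in>{..k}. r i \<otimes> x [^] i) \<in> carrier R"
    by (intro finsum_closed Pi_I m_closed nat_pow_closed rc x)
  ultimately have "(\<Oplus>i\<in>{..k}. r i \<otimes> x [^] i) = \<zero>" using F.incl_eq_zero_iff unfolding Leq by blast
  then have "eval (map r (rev [0..<Suc k])) x = \<zero>"
    using eval_map_rev[of r x "Suc k"] rc x by (simp add: lessThan_Suc_atMost del: upt_Suc)
  moreover have "set (map r (rev [0..<Suc k])) \<subseteq> S" using t(3) by auto
  moreover have "\<not> set (map r (rev [0..<Suc k])) \<subseteq> {\<zero>}"
  proof -
    have "r j \<noteq> \<zero>"
    proof
      assume "r j = \<zero>"
      then have "F.incl t \<otimes>\<^bsub>?L\<^esub> c j = \<zero>\<^bsub>?L\<^esub>" using t(4)[of j] jk F.incl_eq_zero_iff[of \<zero>] unfolding Leq by simp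
      then have "F.incl t = \<zero>\<^bsub>?L\<^esub>" using L.integral_iff[OF tL cL] j by simp
      then show False using F.incl_eq_zero_iff[OF tc] t(2) unfolding Leq by simp
    qed
    moreover have "j \<in> set (rev [0..<Suc k])" using jk by auto
    ultimately show ?thesis by (auto simp: image_subset_iff simp del: upt_Suc)
  qed
  ultimately show ?thesis by blast
qed

text \<open>A transcendental element of the fraction field is a quotient of \<open>a\<close> by
  \<open>b\<close>; multiplying by \<open>b [^] k\<close> turns polynomial relations of degree
  \<open>k\<close> into linear relations between the products \<open>a^i b^(k-i)\<close>. These lie
  in the ring itself, where linear dependence over \<open>S\<close> can be counted.\<close>

lemma (in domain) transcendental_of_trdeg_pos:
  assumes S: "subring S R" and tr: "trdeg S R > 0"
  obtains a b where "a \<in> carrier R" "b \<in> carrier R" "b \<noteq> \<zero>"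
    "\<And>k r. (\<And>i. r i \<in> S) \<Longrightarrow> (\<Oplus>i\<in>{..k::nat}. r i \<otimes> (a [^] i \<otimes> b [^] (k - i))) = \<zero> \<Longrightarrow> (\<forall>i\<le>k. r i = \<zero>)"
proof -
  interpret F: domain_localization R "carrier R - {\<zero>}" by (rule frac_domain_localization)
  interpret L: field "frac_field R" by (rule frac_field_is_field)
  have Leq: "frac_field R = F.LR" unfolding frac_field_def ..
  interpret i: ring_hom_ring R "frac_field R" F.incl unfolding Leq by (rule F.incl_hom)
  note SE = subringE[OF S]
  let ?L = "frac_field R"
  define K where "K = frac_subfield R S"
  have K: "K = {F.fr a s | a s. a \<in> S \<and> s \<in> S \<and> s \<noteq> \<zero>}" unfolding K_def frac_subfield_def by simp
  have one: "\<one> \<in> S - {\<zero>}" using SE(3) by auto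
  have Kc: "K \<subseteq> carrier ?L"
  proof
    fix z assume "z \<in> K"
    then obtain a s where "a \<in> S" "s \<in> S" "s \<noteq> \<zero>" "z = F.fr a s" unfolding K by blast
    then show "z \<in> carrier ?L" unfolding Leq using SE(1) F.LR_closed[of a s] by blast
  qed
  have inclK: "F.incl a \<in> K" if "a \<in> S" for a unfolding K using that one by blast
  have K0: "\<zero>\<^bsub>?L\<^esub> \<in> K" unfolding Leq F.LR_zero using inclK SE(2) by blast
  have "\<exists>T. T \<subseteq> carrier ?L \<and> finite T \<and> alg_independent ?L K T \<and> T \<noteq> {}"
  proof (rule ccontr)
    assume "\<not> ?thesis"
    then have "trdeg S R \<le> 0" unfolding trdeg_def field_trdeg_def K_def[symmetric]
      by (intro Sup_least) (auto simp: zero_enat_def)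
    then show False using tr by simp
  qed
  then obtain T x where T: "T \<subseteq> carrier ?L" "alg_independent ?L K T" "x \<in> T" by blast
  have xL: "x \<in> carrier ?L" using T by blast
  obtain a b where ab: "a \<in> carrier R" "b \<in> carrier R - {\<zero>}" "x = F.fr a b" using xL unfolding Leq F.LR_carrier by blast
  have bL: "F.incl b \<in> carrier ?L" using ab by auto
  have bx: "F.incl b \<otimes>\<^bsub>?L\<^esub> x = F.incl a" unfolding ab(3) Leq by (rule F.incl_mult_frac[OF ab(1,2)])
  have "\<forall>i\<le>k. r i = \<zero>" if r: "\<And>i. r i \<in> S" and s0: "(\<Oplus>i\<in>{..k::nat}. r i \<otimes> (a [^] i \<otimes> b [^] (k - i))) = \<zero>" for k r
  proof -
    have rc: "r i \<in> carrier R" for i using r SE(1) by blast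
    define c where "c i = (if i \<le> k then F.incl (r i) else \<zero>\<^bsub>?L\<^esub>)" for i
    have cK: "c i \<in> K" for i unfolding c_def using inclK[OF r] K0 by auto
    have cL: "c i \<in> carrier ?L" for i using cK Kc by blast
    have c0: "c i = \<zero>\<^bsub>?L\<^esub>" if "i > k" for i unfolding c_def using that by simp
    let ?p = "L.upoly x c"
    let ?s = "\<Oplus>\<^bsub>?L\<^esub>i\<in>{..k}. c i \<otimes>\<^bsub>?L\<^esub> x [^]\<^bsub>?L\<^esub> i"
    have p: "?p \<in> L.indexed_pset T K" by (rule L.upoly_mem[OF Kc K0 T(3) cK c0])
    have "F.incl b [^]\<^bsub>?L\<^esub> k \<otimes>\<^bsub>?L\<^esub> ?s = (\<Oplus>\<^bsub>?L\<^esub>i\<in>{..k}. F.incl b [^]\<^bsub>?L\<^esub> k \<otimes>\<^bsub>?L\<^esub> (c i \<otimes>\<^bsub>?L\<^esub> x [^]\<^bsub>?L\<^esub> i))"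
      by (rule L.finsum_rdistr) (use bL cL xL in auto)
    also have "\<dots> = (\<Oplus>\<^bsub>?L\<^esub>i\<in>{..k}. F.incl (r i \<otimes> (a [^] i \<otimes> b [^] (k - i))))"
    proof (rule L.finsum_cong')
      fix i assume "i \<in> {..k}"
      then have ik: "i \<le> k" by simp
      have pw: "F.incl b [^]\<^bsub>?L\<^esub> i \<otimes>\<^bsub>?L\<^esub> x [^]\<^bsub>?L\<^esub> i = F.incl (a [^] i)"
        using L.nat_pow_distrib[OF bL xL, of i] bx ab(1) by (simp add: i.hom_nat_pow)
      have "F.incl b [^]\<^bsub>?L\<^esub> k = F.incl b [^]\<^bsub>?L\<^esub> (k - i) \<otimes>\<^bsub>?L\<^esub> F.incl b [^]\<^bsub>?L\<^esub> i"
        using L.nat_pow_mult[OF bL, of "k - i" i] ik by simp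
      then have "F.incl b [^]\<^bsub>?L\<^esub> k \<otimes>\<^bsub>?L\<^esub> (c i \<otimes>\<^bsub>?L\<^esub> x [^]\<^bsub>?L\<^esub> i)
         = c i \<otimes>\<^bsub>?L\<^esub> (F.incl b [^]\<^bsub>?L\<^esub> (k - i) \<otimes>\<^bsub>?L\<^esub> (F.incl b [^]\<^bsub>?L\<^esub> i \<otimes>\<^bsub>?L\<^esub> x [^]\<^bsub>?L\<^esub> i))"
        using bL cL[of i] xL by (simp add: L.m_ac)
      also have "\<dots> = F.incl (r i) \<otimes>\<^bsub>?L\<^esub> (F.incl (b [^] (k - i)) \<otimes>\<^bsub>?L\<^esub> F.incl (a [^] i))"
        unfolding pw c_def using ik ab by (simp add: i.hom_nat_pow)
      also have "\<dots> = F.incl (r i \<otimes> (b [^] (k - i) \<otimes> a [^] i))" using rc ab by simp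
      also have "b [^] (k - i) \<otimes> a [^] i = a [^] i \<otimes> b [^] (k - i)" using ab by (intro m_comm) auto
      finally show "F.incl b [^]\<^bsub>?L\<^esub> k \<otimes>\<^bsub>?L\<^esub> (c i \<otimes>\<^bsub>?L\<^esub> x [^]\<^bsub>?L\<^esub> i) = F.incl (r i \<otimes> (a [^] i \<otimes> b [^] (k - i)))" .
    qed (use rc ab in auto)
    also have "\<dots> = F.incl (\<Oplus>i\<in>{..k}. r i \<otimes> (a [^] i \<otimes> b [^] (k - i)))"
      by (rule i.hom_finsum[of "\<lambda>i. r i \<otimes> (a [^] i \<otimes> b [^] (k - i))" "{..k}", unfolded comp_def, symmetric])
        (intro Pi_I m_closed nat_pow_closed rc, use ab in auto)
    also have "\<dots> = \<zero>\<^bsub>?L\<^esub>" unfolding s0 by simp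
    finally have "F.incl b [^]\<^bsub>?L\<^esub> k \<otimes>\<^bsub>?L\<^esub> ?s = \<zero>\<^bsub>?L\<^esub>" .
    moreover have "F.incl b [^]\<^bsub>?L\<^esub> k \<noteq> \<zero>\<^bsub>?L\<^esub>"
    proof -
      have "F.incl b \<noteq> \<zero>\<^bsub>?L\<^esub>" using F.incl_eq_zero_iff[of b] ab(2) unfolding Leq by simp
      then show ?thesis using bL by (induct k) (auto simp: L.integral_iff)
    qed
    moreover have "?s \<in> carrier ?L" by (rule L.finsum_closed) (use cL xL in auto)
    ultimately have "?s = \<zero>\<^bsub>?L\<^esub>" using L.integral_iff[of "F.incl b [^]\<^bsub>?L\<^esub> k" ?s] bL by auto
    then have "mpoly_eval ?L ?p = \<zero>\<^bsub>?L\<^esub>" using L.mpoly_eval_upoly[OF xL cL c0] by simp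
    then have pz: "?p = L.indexed_const \<zero>\<^bsub>?L\<^esub>" using T(2) p unfolding alg_independent_def by blast
    show ?thesis
    proof (intro allI impI)
      fix i assume ik: "i \<le> k"
      have "?p (replicate_mset i x) = \<zero>\<^bsub>?L\<^esub>" unfolding pz L.indexed_const_def by simp
      then have "c i = \<zero>\<^bsub>?L\<^esub>" unfolding L.upoly_def by (auto split: if_splits)
      then show "r i = \<zero>" unfolding c_def using ik F.incl_eq_zero_iff[OF rc] unfolding Leq by simp
    qed
  qed
  then show thesis using that ab by blast
qed

lemma (in domain_localization) fractions_ideal:
  assumes I: "ideal I R"
  shows "ideal {fr c s | c s. c \<in> I \<and> s \<in> S} LR" (is "ideal ?J LR")
proof -
  interpret I: ideal I R by (rule I)
  interpret LR: cring LR by (rule LR_cring)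
  show ?thesis
  proof (rule LR.ideal_of_closed)
    show "?J \<subseteq> carrier LR" using I.Icarr by blast
    show "\<zero>\<^bsub>LR\<^esub> \<in> ?J" unfolding LR_zero using I.zero_closed S_one by blast
  next
    fix x y assume "x \<in> ?J" "y \<in> ?J"
    then obtain a s b t where *: "a \<in> I" "s \<in> S" "x = fr a s" "b \<in> I" "t \<in> S" "y = fr b t" by blast
    have "x \<oplus>\<^bsub>LR\<^esub> y = fr (a \<otimes> t \<oplus> b \<otimes> s) (s \<otimes> t)"
      unfolding *(3,6) using * I.Icarr by (intro LR_add) auto
    moreover have "a \<otimes> t \<oplus> b \<otimes> s \<in> I" using * I.I_r_closed by (intro I.a_closed) auto
    ultimately show "x \<oplus>\<^bsub>LR\<^esub> y \<in> ?J" using S_mult[OF *(2,5)] by blast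
  next
    fix x y assume "x \<in> carrier LR" "y \<in> ?J"
    then obtain a s b t where *: "a \<in> carrier R" "s \<in> S" "x = fr a s" "b \<in> I" "t \<in> S" "y = fr b t"
      unfolding LR_carrier by blast
    have "x \<otimes>\<^bsub>LR\<^esub> y = fr (a \<otimes> b) (s \<otimes> t)"
      unfolding *(3,6) using * I.Icarr by (intro LR_mult) auto
    moreover have "a \<otimes> b \<in> I" using * I.I_l_closed by auto
    ultimately show "x \<otimes>\<^bsub>LR\<^esub> y \<in> ?J" using S_mult[OF *(2,5)] by blast
  qed
qed

text \<open>Finitely many fractions generate the extended ideal; their numerators generate
  \<open>J\<close> up to multiplication by elements of \<open>S\<close>.\<close>

lemma (in domain_localization) fg_up_to_denominators:
  assumes noeth: "noetherian_ring LR" and J: "ideal J R"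
  shows "\<exists>G\<subseteq>J. finite G \<and> (\<forall>x\<in>J. \<exists>s\<in>S. s \<otimes> x \<in> Idl G)"
proof -
  interpret J: ideal J R by (rule J)
  interpret LR: cring LR by (rule LR_cring)
  let ?J = "{fr c s | c s. c \<in> J \<and> s \<in> S}"
  obtain T where T: "T \<subseteq> carrier LR" "finite T" "?J = genideal LR T"
    using noetherian_ring_fg[OF noeth fractions_ideal[OF J]] unfolding fg_ideal_def by blast
  have "T \<subseteq> ?J" unfolding T(3) by (rule LR.genideal_self[OF T(1)])
  then have "\<forall>t\<in>T. \<exists>c. c \<in> J \<and> (\<exists>s\<in>S. t = fr c s)" by blast
  then obtain f where f: "\<And>t. t \<in> T \<Longrightarrow> f t \<in> J \<and> (\<exists>s\<in>S. t = fr (f t) s)" by metis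
  let ?G = "f ` T"
  have GJ: "?G \<subseteq> J" using f by blast
  then have Gc: "?G \<subseteq> carrier R" using J.Icarr by blast
  have "\<exists>s\<in>S. s \<otimes> x \<in> Idl ?G" if x: "x \<in> J" for x
  proof -
    have xc: "x \<in> carrier R" using x J.Icarr by simp
    have "T \<subseteq> {fr c s | c s. c \<in> Idl ?G \<and> s \<in> S}"
    proof
      fix t assume t: "t \<in> T"
      then have "f t \<in> Idl ?G" using genideal_self[OF Gc] by blast
      then show "t \<in> {fr c s | c s. c \<in> Idl ?G \<and> s \<in> S}" using f[OF t] by blast
    qed
    then have "?J \<subseteq> {fr c s | c s. c \<in> Idl ?G \<and> s \<in> S}"
      unfolding T(3) by (rule LR.genideal_minimal[OF fractions_ideal[OF genideal_ideal[OF Gc]]])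
    moreover have "fr x \<one> \<in> ?J" using x S_one by blast
    ultimately obtain c s where cs: "c \<in> Idl ?G" "s \<in> S" "fr x \<one> = fr c s" by blast
    have cc: "c \<in> carrier R" using ideal.Icarr[OF genideal_ideal[OF Gc] cs(1)] .
    have "x \<otimes> s = c \<otimes> \<one>" using cs(3) frac_eq_iff[OF xc cc S_one cs(2)] by simp
    then have "s \<otimes> x = c" using xc cc cs(2) by (simp add: m_comm)
    then show ?thesis using cs by blast
  qed
  then show ?thesis using GJ T(2) by blast
qed

section \<open>Krull domains and their valuations\<close>

text \<open>Every nonzero element is a unit times a power of a generator \<open>t\<close> of the
  maximal ideal, and \<open>v\<close> is the exponent. The value at zero is unspecified, so each
  clause is restricted to nonzero elements.\<close>

lemma dvr_valuation:
  fixes B :: "('c, 'd) ring_scheme" (structure)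
  assumes "dvr B"
  shows "\<exists>v::'c \<Rightarrow> nat.
    (\<forall>x\<in>carrier B - {\<zero>}. \<forall>y\<in>carrier B - {\<zero>}. v (x \<otimes> y) = v x + v y \<and>
       (v x \<le> v y \<longleftrightarrow> (\<exists>c\<in>carrier B. y = x \<otimes> c)) \<and> (x \<oplus> y \<noteq> \<zero> \<longrightarrow> min (v x) (v y) \<le> v (x \<oplus> y))) \<and>
    (\<forall>x\<in>carrier B - {\<zero>}. v x = 0 \<longleftrightarrow> x \<in> Units B) \<and> (\<exists>x\<in>carrier B - {\<zero>}. 0 < v x)"
proof -
  have pd: "principal_domain B" and nf: "\<not> field B" using assms unfolding dvr_def by auto
  interpret B: principal_domain B by (rule pd)
  obtain m where m: "{M. maximalideal M B} = {m}" using assms unfolding dvr_def local_ring_def by blast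
  then have mm: "maximalideal m B" by auto
  interpret m: maximalideal m B by (rule mm)
  obtain t where t: "t \<in> carrier B" "m = PIdl t" using B.exists_gen[OF m.is_ideal] by blast
  have nonunit: "x \<in> m" if x: "x \<in> carrier B" "x \<notin> Units B" for x
  proof -
    have "ideal (PIdl x) B" using B.cgenideal_ideal[OF x(1)] .
    moreover have "PIdl x \<noteq> carrier B"
    proof
      assume "PIdl x = carrier B"
      then obtain y where "y \<in> carrier B" "\<one> = y \<otimes> x" unfolding cgenideal_def by blast
      then have "x \<in> Units B" using x B.m_comm[of x y] unfolding Units_def by auto
      then show False using x by simp
    qed
    ultimately obtain M where M: "maximalideal M B" "PIdl x \<subseteq> M" by (rule B.exists_maximalideal_containing)
    then have "M = m" using m by blast
    then show ?thesis using M B.cgenideal_self[OF x(1)] by blast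
  qed
  have tU: "t \<notin> Units B"
  proof
    assume "t \<in> Units B"
    then have "inv t \<otimes> t \<in> m" "inv t \<otimes> t = \<one>"
      unfolding t(2) cgenideal_def using B.Units_inv_closed by (blast, simp)
    then have "m = carrier B" using m.one_imp_carrier by simp
    then show False using m.I_notcarr by simp
  qed
  have t0: "t \<noteq> \<zero>"
  proof
    assume "t = \<zero>"
    then have "m \<subseteq> {\<zero>}" unfolding t(2) using B.cgenideal_minimal[OF B.zeroideal, of \<zero>] by simp
    then have "m = {\<zero>}" using m.zero_closed by blast
    then show False using mm B.zeromaximalideal_fieldI nf by simp
  qed
  \<comment> \<open>Dividing a bad element by \<open>t\<close> gives another bad one that generates
    a strictly larger principal ideal, so a bad element with maximal principal ideal cannot
    exist.\<close>
  have form: "\<exists>n u. u \<in> Units B \<and> x = t [^] (n::nat) \<otimes> u" if x: "x \<in> carrier B" "x \<noteq> \<zero>" for x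
  proof (rule ccontr)
    assume no: "\<not> ?thesis"
    let ?bad = "\<lambda>y. y \<in> carrier B \<and> y \<noteq> \<zero> \<and> \<not> (\<exists>n u. u \<in> Units B \<and> y = t [^] (n::nat) \<otimes> u)"
    let ?C = "{PIdl y | y. ?bad y}"
    have "?C \<noteq> {}" using no x by blast
    then obtain Z where Z: "Z \<in> ?C" "\<And>K. K \<in> ?C \<Longrightarrow> Z \<subseteq> K \<Longrightarrow> K = Z"
      by (rule B.maximal_condition[of "{}" ?C, rotated])
        (use noetherian_ring_fg[OF B.noetherian_ring_axioms] B.cgenideal_ideal in auto)
    then obtain y where y: "?bad y" "Z = PIdl y" by blast
    have "y \<notin> Units B"
    proof
      assume "y \<in> Units B"
      moreover have "y = t [^] (0::nat) \<otimes> y" using y by simp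
      ultimately show False using y by blast
    qed
    then have "y \<in> m" using nonunit y by blast
    then obtain z where z: "z \<in> carrier B" "y = z \<otimes> t" unfolding t(2) cgenideal_def by blast
    have z0: "z \<noteq> \<zero>" using z y(1) t by auto
    have "?bad z"
    proof (rule ccontr)
      assume "\<not> ?bad z"
      then obtain n u where nu: "u \<in> Units B" "z = t [^] (n::nat) \<otimes> u" using z z0 by blast
      have "y = t [^] Suc n \<otimes> u" unfolding z(2) nu(2) using t(1) B.Units_closed[OF nu(1)] by (simp add: B.m_ac)
      then show False using y(1) nu(1) by blast
    qed
    then have "PIdl z \<in> ?C" by blast
    moreover have "PIdl y \<subseteq> PIdl z"
    proof (rule B.cgenideal_minimal[OF B.cgenideal_ideal[OF z(1)]])
      have "y = t \<otimes> z" using z t B.m_comm by simp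
      then show "y \<in> PIdl z" unfolding cgenideal_def using t by blast
    qed
    ultimately have "PIdl z = PIdl y" using Z(2) y(2) by blast
    then obtain w where w: "w \<in> carrier B" "z = w \<otimes> y" using B.cgenideal_self[OF z(1)] unfolding cgenideal_def by blast
    have "z \<otimes> \<one> = z \<otimes> (w \<otimes> t)" using w z t by (metis B.m_assoc B.m_comm B.m_closed B.r_one)
    then have "w \<otimes> t = \<one>" using B.m_lcancel[OF z0 z(1)] w t by simp
    then have "t \<in> Units B" using w t B.m_comm[of w t] unfolding Units_def by auto
    then show False using tU by simp
  qed
  have tpc: "t [^] (n::nat) \<in> carrier B" for n using t by simp
  have tp0: "t [^] (n::nat) \<noteq> \<zero>" for n by (induct n) (use t t0 in \<open>auto simp: B.integral_iff\<close>)
  have Uc: "u \<in> Units B \<Longrightarrow> u \<in> carrier B" for u by (rule B.Units_closed)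
  \<comment> \<open>With \<open>n > k\<close>, cancelling \<open>t [^] k\<close> would make
    \<open>t\<close> a divisor of a unit.\<close>
  have uniq: "n \<le> k" if u: "u \<in> Units B" and w: "w \<in> carrier B" and eq: "t [^] (n::nat) \<otimes> w = t [^] (k::nat) \<otimes> u" for n k u w
  proof (rule ccontr)
    assume "\<not> n \<le> k"
    then obtain d where d: "n = k + Suc d" using less_iff_Suc_add[of k n] by auto
    have dw: "t [^] d \<otimes> w \<in> carrier B" using tpc w by simp
    have "t [^] n = t [^] k \<otimes> t [^] Suc d" unfolding d B.nat_pow_mult[OF t(1)] ..
    then have "t [^] k \<otimes> (t [^] Suc d \<otimes> w) = t [^] k \<otimes> u" using eq B.m_assoc[OF tpc tpc w] by metis
    then have "t [^] Suc d \<otimes> w = u"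
      using B.m_lcancel[OF tp0 tpc B.m_closed[OF tpc w] Uc[OF u]] by metis
    then have tu: "t \<otimes> (t [^] d \<otimes> w) = u" using t w tpc[of d] by (simp add: B.m_ac)
    have "t \<otimes> ((t [^] d \<otimes> w) \<otimes> inv u) = \<one>"
      using B.m_assoc[OF t(1) dw B.Units_inv_closed[OF u]] tu B.Units_r_inv[OF u] by simp
    moreover have sc: "(t [^] d \<otimes> w) \<otimes> inv u \<in> carrier B" using dw B.Units_inv_closed[OF u] by simp
    moreover have "((t [^] d \<otimes> w) \<otimes> inv u) \<otimes> t = t \<otimes> ((t [^] d \<otimes> w) \<otimes> inv u)" by (rule B.m_comm[OF sc t(1)])
    ultimately have "t \<in> Units B" unfolding Units_def using t(1) by (metis (mono_tags, lifting) mem_Collect_eq)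
    then show False using tU by simp
  qed
  define v where "v x = (SOME n. \<exists>u. u \<in> Units B \<and> x = t [^] (n::nat) \<otimes> u)" for x
  have v: "\<exists>u. u \<in> Units B \<and> x = t [^] v x \<otimes> u" if "x \<in> carrier B - {\<zero>}" for x
    unfolding v_def by (rule someI_ex) (use form that in blast)
  have v_le: "n \<le> v x" if "x \<in> carrier B - {\<zero>}" "w \<in> carrier B" "x = t [^] n \<otimes> w" for x n w
    using v[OF that(1)] uniq that by metis
  have v_eq: "v x = n" if x: "x \<in> carrier B - {\<zero>}" and u: "u \<in> Units B" "x = t [^] n \<otimes> u" for x n u
    using v_le[OF x Uc[OF u(1)] u(2)] v[OF x] uniq[OF u(1)] u(2) Uc by (metis le_antisym)
  show ?thesis
  proof (intro exI[of _ v] conjI ballI impI)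
    fix x y assume xy: "x \<in> carrier B - {\<zero>}" "y \<in> carrier B - {\<zero>}"
    obtain u w where u: "u \<in> Units B" "x = t [^] v x \<otimes> u" and w: "w \<in> Units B" "y = t [^] v y \<otimes> w" using v xy by blast
    have uw: "u \<in> carrier B" "w \<in> carrier B" using u w Uc by auto
    have "x \<otimes> y = (t [^] v x \<otimes> u) \<otimes> (t [^] v y \<otimes> w)" using u w by simp
    also have "\<dots> = (t [^] v x \<otimes> t [^] v y) \<otimes> (u \<otimes> w)" using tpc uw by (simp add: B.m_ac)
    also have "t [^] v x \<otimes> t [^] v y = t [^] (v x + v y)" using t by (simp add: B.nat_pow_mult)
    finally show "v (x \<otimes> y) = v x + v y"
      by (rule v_eq[rotated 2]) (use xy u w in \<open>auto simp: B.integral_iff\<close>)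
    show "v x \<le> v y \<longleftrightarrow> (\<exists>c\<in>carrier B. y = x \<otimes> c)"
    proof
      assume le: "v x \<le> v y"
      let ?c = "inv u \<otimes> (t [^] (v y - v x) \<otimes> w)"
      have iu: "inv u \<in> carrier B" using u by simp
      have "x \<otimes> ?c = (t [^] v x \<otimes> u) \<otimes> ?c" using u by simp
      also have "\<dots> = (u \<otimes> inv u) \<otimes> ((t [^] v x \<otimes> t [^] (v y - v x)) \<otimes> w)" using tpc uw iu by (simp add: B.m_ac)
      also have "\<dots> = t [^] v y \<otimes> w" using u(1) t uw le by (simp add: B.nat_pow_mult)
      finally show "\<exists>c\<in>carrier B. y = x \<otimes> c" using w(2) tpc uw iu by (intro bexI[of _ ?c]) auto
    next
      assume "\<exists>c\<in>carrier B. y = x \<otimes> c"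
      then obtain c where c: "c \<in> carrier B" "y = x \<otimes> c" by blast
      have "y = t [^] v x \<otimes> (u \<otimes> c)" unfolding c(2) using u(2) tpc uw c by (metis B.m_assoc)
      then show "v x \<le> v y" by (rule v_le[OF xy(2), rotated]) (use uw c in auto)
    qed
    assume ne: "x \<oplus> y \<noteq> \<zero>"
    let ?n = "min (v x) (v y)"
    have "x = t [^] ?n \<otimes> (t [^] (v x - ?n) \<otimes> u)" "y = t [^] ?n \<otimes> (t [^] (v y - ?n) \<otimes> w)"
      using u(2) w(2) t uw by (simp_all add: B.m_assoc[symmetric] B.nat_pow_mult)
    then have "x \<oplus> y = t [^] ?n \<otimes> (t [^] (v x - ?n) \<otimes> u \<oplus> t [^] (v y - ?n) \<otimes> w)"
      using tpc uw by (metis B.m_closed B.r_distr)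
    then show "?n \<le> v (x \<oplus> y)" by (rule v_le[rotated 2]) (use xy ne tpc uw in auto)
  next
    fix x assume x: "x \<in> carrier B - {\<zero>}"
    obtain u where u: "u \<in> Units B" "x = t [^] v x \<otimes> u" using v[OF x] by blast
    show "v x = 0 \<longleftrightarrow> x \<in> Units B"
    proof
      assume "v x = 0" then show "x \<in> Units B" using u Uc[OF u(1)] by simp
    next
      assume "x \<in> Units B"
      then show "v x = 0" by (intro v_eq[OF x, of x]) (use x in auto)
    qed
  next
    have "v t = 1" by (rule v_eq[of t "\<one>"]) (use t t0 in auto)
    then show "\<exists>x\<in>carrier B - {\<zero>}. 0 < v x" using t t0 by (intro bexI[of _ t]) auto
  qed
qed

text \<open>Values are natural numbers on nonzero ring elements, so neither fractions nor an
  infinite value occur. \<open>val_dvd\<close> expresses that the ring is the intersection of the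
  valuation rings.\<close>

locale krull_valuations = domain R for R (structure) +
  fixes F :: "'i set" and val :: "'i \<Rightarrow> 'a \<Rightarrow> nat"
  assumes val_mult: "V \<in> F \<Longrightarrow> a \<in> carrier R - {\<zero>} \<Longrightarrow> b \<in> carrier R - {\<zero>} \<Longrightarrow> val V (a \<otimes> b) = val V a + val V b"
    and val_add: "V \<in> F \<Longrightarrow> a \<in> carrier R - {\<zero>} \<Longrightarrow> b \<in> carrier R - {\<zero>} \<Longrightarrow> a \<oplus> b \<noteq> \<zero> \<Longrightarrow>
      min (val V a) (val V b) \<le> val V (a \<oplus> b)"
    and val_dvd: "a \<in> carrier R - {\<zero>} \<Longrightarrow> b \<in> carrier R - {\<zero>} \<Longrightarrow> (\<And>V. V \<in> F \<Longrightarrow> val V a \<le> val V b) \<Longrightarrow>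
      \<exists>c\<in>carrier R. b = c \<otimes> a"
    and val_finite: "a \<in> carrier R - {\<zero>} \<Longrightarrow> finite {V \<in> F. 0 < val V a}"
    and val_nontrivial: "V \<in> F \<Longrightarrow> \<exists>a\<in>carrier R - {\<zero>}. 0 < val V a"

text \<open>If the value of \<open>a\<close> is everywhere at most that of \<open>b\<close>, the
  fraction of \<open>b\<close> by \<open>a\<close> lies in every member of the family, hence in
  \<open>A\<close>.\<close>

lemma krull_domain_valuations:
  fixes A :: "('a, 'b) ring_scheme" (structure)
  assumes "krull_domain A"
  shows "\<exists>F (val :: ('a \<times> 'a) set set \<Rightarrow> 'a \<Rightarrow> nat). krull_valuations A F val"
proof -
  have dom: "domain A" using assms unfolding krull_domain_def by simp
  interpret domain A by (rule dom)
  interpret Q: domain_localization A "carrier A - {\<zero>}" by (rule frac_domain_localization)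
  interpret L: field "frac_field A" by (rule frac_field_is_field)
  have Leq: "frac_field A = Q.LR" unfolding frac_field_def ..
  interpret i: ring_hom_ring A "frac_field A" Q.incl unfolding Leq by (rule Q.incl_hom)
  let ?L = "frac_field A"
  from assms[unfolded krull_domain_def Let_def, THEN conjunct2] obtain F where F0:
    "(\<forall>V\<in>F. dvr_of_field ?L V) \<and> Q.incl ` carrier A = {x \<in> carrier ?L. \<forall>V\<in>F. x \<in> V} \<and>
     (\<forall>x\<in>carrier ?L - {\<zero>\<^bsub>?L\<^esub>}. finite {V \<in> F. x \<notin> Units (?L\<lparr>carrier := V\<rparr>)})" by (elim exE)
  note F = F0[THEN conjunct1, rule_format] F0[THEN conjunct2, THEN conjunct1]
    F0[THEN conjunct2, THEN conjunct2, THEN bspec]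
  define P where "P V v \<longleftrightarrow>
    (\<forall>x\<in>V - {\<zero>\<^bsub>?L\<^esub>}. \<forall>y\<in>V - {\<zero>\<^bsub>?L\<^esub>}. v (x \<otimes>\<^bsub>?L\<^esub> y) = v x + v y \<and>
       (v x \<le> v y \<longleftrightarrow> (\<exists>c\<in>V. y = x \<otimes>\<^bsub>?L\<^esub> c)) \<and> (x \<oplus>\<^bsub>?L\<^esub> y \<noteq> \<zero>\<^bsub>?L\<^esub> \<longrightarrow> min (v x) (v y) \<le> v (x \<oplus>\<^bsub>?L\<^esub> y))) \<and>
    (\<forall>x\<in>V - {\<zero>\<^bsub>?L\<^esub>}. v x = 0 \<longleftrightarrow> x \<in> Units (?L\<lparr>carrier := V\<rparr>)) \<and> (\<exists>x\<in>V - {\<zero>\<^bsub>?L\<^esub>}. 0 < v x)"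
    for V and v :: "('a \<times> 'a) set \<Rightarrow> nat"
  have "\<exists>v. P V v" if "V \<in> F" for V
  proof -
    have "dvr (?L\<lparr>carrier := V\<rparr>)" using F(1)[OF that] unfolding dvr_of_field_def by simp
    from dvr_valuation[OF this] show ?thesis unfolding P_def by simp
  qed
  then obtain v where v: "\<And>V. V \<in> F \<Longrightarrow> P V (v V)" by metis
  have Pm: "v V (x \<otimes>\<^bsub>?L\<^esub> y) = v V x + v V y" and Pd: "v V x \<le> v V y \<longleftrightarrow> (\<exists>c\<in>V. y = x \<otimes>\<^bsub>?L\<^esub> c)"
    and Pa: "x \<oplus>\<^bsub>?L\<^esub> y \<noteq> \<zero>\<^bsub>?L\<^esub> \<Longrightarrow> min (v V x) (v V y) \<le> v V (x \<oplus>\<^bsub>?L\<^esub> y)"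
    if "V \<in> F" "x \<in> V - {\<zero>\<^bsub>?L\<^esub>}" "y \<in> V - {\<zero>\<^bsub>?L\<^esub>}" for V x y
    using v[OF that(1), unfolded P_def, THEN conjunct1, THEN bspec, OF that(2), THEN bspec, OF that(3)] by blast+
  have VL: "V \<subseteq> carrier ?L" if "V \<in> F" for V
    using F(1)[OF that] subringE(1) unfolding dvr_of_field_def by blast
  have incl0: "Q.incl a \<noteq> \<zero>\<^bsub>?L\<^esub>" if "a \<in> carrier A - {\<zero>}" for a
    using Q.incl_eq_zero_iff[of a] that unfolding Leq by simp
  have inV: "Q.incl a \<in> V - {\<zero>\<^bsub>?L\<^esub>}" if V: "V \<in> F" and a: "a \<in> carrier A - {\<zero>}" for V a
  proof -
    have "Q.incl a \<in> Q.incl ` carrier A" using a by blast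
    then show ?thesis unfolding F(2) using V incl0[OF a] by blast
  qed
  define val where "val V a = v V (Q.incl a)" for V a
  have "krull_valuations A F val"
  proof
    fix V a b assume V: "V \<in> F" and a: "a \<in> carrier A - {\<zero>}" and b: "b \<in> carrier A - {\<zero>}"
    show "val V (a \<otimes> b) = val V a + val V b" using Pm[OF V inV[OF V a] inV[OF V b]] a b unfolding val_def by simp
    assume "a \<oplus> b \<noteq> \<zero>"
    then have "Q.incl (a \<oplus> b) \<noteq> \<zero>\<^bsub>?L\<^esub>" using incl0[of "a \<oplus> b"] a b by blast
    moreover have "Q.incl (a \<oplus> b) = Q.incl a \<oplus>\<^bsub>?L\<^esub> Q.incl b" using i.hom_add a b by blast
    ultimately show "min (val V a) (val V b) \<le> val V (a \<oplus> b)"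
      using Pa[OF V inV[OF V a] inV[OF V b]] unfolding val_def by metis
  next
    fix a b assume a: "a \<in> carrier A - {\<zero>}" and b: "b \<in> carrier A - {\<zero>}"
      and le: "\<And>V. V \<in> F \<Longrightarrow> val V a \<le> val V b"
    let ?q = "Q.fr b a"
    have qL: "?q \<in> carrier ?L" unfolding Leq using a b by (intro Q.LR_closed) auto
    have aq: "Q.incl a \<otimes>\<^bsub>?L\<^esub> ?q = Q.incl b" unfolding Leq by (rule Q.incl_mult_frac) (use a b in auto)
    have aL: "Q.incl a \<in> carrier ?L" "Q.incl a \<noteq> \<zero>\<^bsub>?L\<^esub>" using i.hom_closed[of a] a incl0[OF a] by auto
    have "?q \<in> V" if V: "V \<in> F" for V
    proof -
      obtain c where c: "c \<in> V" "Q.incl b = Q.incl a \<otimes>\<^bsub>?L\<^esub> c" 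
        using le[OF V] Pd[OF V inV[OF V a] inV[OF V b]] unfolding val_def by blast
      have "c = ?q" using L.m_lcancel[OF aL(2,1), of c ?q] c VL[OF V] qL aq by auto
      then show ?thesis using c by simp
    qed
    then have "?q \<in> Q.incl ` carrier A" unfolding F(2) using qL by blast
    then obtain c where c: "c \<in> carrier A" "?q = Q.incl c" by blast
    have "Q.incl b = Q.incl (a \<otimes> c)" using aq a c by simp
    then have "b = a \<otimes> c" using Q.incl_eq_iff[of b "a \<otimes> c"] a b c by simp
    then show "\<exists>c\<in>carrier A. b = c \<otimes> a" using c a m_comm by auto
  next
    fix a assume a: "a \<in> carrier A - {\<zero>}"
    have aL: "Q.incl a \<in> carrier ?L - {\<zero>\<^bsub>?L\<^esub>}" using i.hom_closed[of a] a incl0[OF a] by auto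
    have "{V \<in> F. 0 < val V a} \<subseteq> {V \<in> F. Q.incl a \<notin> Units (?L\<lparr>carrier := V\<rparr>)}"
    proof
      fix V assume V: "V \<in> {V \<in> F. 0 < val V a}"
      then have VF: "V \<in> F" by simp
      have "v V (Q.incl a) = 0 \<longleftrightarrow> Q.incl a \<in> Units (?L\<lparr>carrier := V\<rparr>)"
        using v[OF VF, unfolded P_def, THEN conjunct2, THEN conjunct1, THEN bspec, OF inV[OF VF a]] .
      then show "V \<in> {V \<in> F. Q.incl a \<notin> Units (?L\<lparr>carrier := V\<rparr>)}" using V unfolding val_def by simp
    qed
    then show "finite {V \<in> F. 0 < val V a}" using F(3)[OF aL] finite_subset by blast
  next
    fix V assume V: "V \<in> F"
    obtain x where x: "x \<in> V - {\<zero>\<^bsub>?L\<^esub>}" "0 < v V x"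
      using v[OF V, unfolded P_def, THEN conjunct2, THEN conjunct2] by blast
    obtain a b where ab: "a \<in> carrier A" "b \<in> carrier A - {\<zero>}" "x = Q.fr a b"
      using x VL[OF V] unfolding Leq Q.LR_carrier by blast
    have bx: "Q.incl b \<otimes>\<^bsub>?L\<^esub> x = Q.incl a" unfolding Leq ab(3) by (rule Q.incl_mult_frac[OF ab(1,2)])
    have a0: "a \<noteq> \<zero>" using x(1) Q.frac_eq_zero_iff[OF ab(1,2)] ab(3) unfolding Leq by auto
    \<comment> \<open>An element of positive value in \<open>V\<close> may fail to lie in
      \<open>A\<close>, but its numerator does and has at least the same value.\<close>
    have "v V (Q.incl a) = v V (Q.incl b) + v V x" using Pm[OF V inV[OF V ab(2)] x(1)] bx by simp
    then show "\<exists>a\<in>carrier A - {\<zero>}. 0 < val V a" using x(2) ab(1) a0 unfolding val_def by (intro bexI[of _ a]) auto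
  qed
  then show ?thesis by blast
qed

section \<open>Centers of valuations and the localization at a minimal prime\<close>

context krull_valuations
begin

lemma val_one: "V \<in> F \<Longrightarrow> val V \<one> = 0"
  using val_mult[of V \<one> \<one>] by simp

lemma pow_nz: "a \<in> carrier R - {\<zero>} \<Longrightarrow> a [^] (n::nat) \<in> carrier R - {\<zero>}"
  by (induct n) (auto simp: integral_iff)

lemma mult_nz: "a \<in> carrier R - {\<zero>} \<Longrightarrow> b \<in> carrier R - {\<zero>} \<Longrightarrow> a \<otimes> b \<in> carrier R - {\<zero>}"
  by (auto simp: integral_iff)

lemma val_pow: "V \<in> F \<Longrightarrow> a \<in> carrier R - {\<zero>} \<Longrightarrow> val V (a [^] n) = n * val V a"
proof (induct n)
  case (Suc n)
  then show ?case using val_mult[OF Suc(2) pow_nz[OF Suc(3), of n] Suc(3)] by simp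
qed (simp add: val_one)

text \<open>The maximal ideal of the valuation ring restricted to \<open>R\<close>; zero is added by
  hand because \<open>val\<close> is unspecified there.\<close>

definition center :: "'i \<Rightarrow> 'a set" where
  "center V = {a \<in> carrier R. a = \<zero> \<or> 0 < val V a}"

lemma val_zero_iff: "a \<in> carrier R - {\<zero>} \<Longrightarrow> val V a = 0 \<longleftrightarrow> a \<notin> center V"
  unfolding center_def by auto

lemma center_prime: assumes V: "V \<in> F" shows "primeideal (center V) R"
proof (rule primeidealI)
  show "ideal (center V) R"
  proof (rule ideal_of_closed)
    fix x y assume xy: "x \<in> center V" "y \<in> center V"
    then have c: "x \<in> carrier R" "y \<in> carrier R" unfolding center_def by auto
    show "x \<oplus> y \<in> center V"
    proof (cases "x = \<zero> \<or> y = \<zero> \<or> x \<oplus> y = \<zero>")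
      case True then show ?thesis using xy c unfolding center_def by auto
    next
      case False
      then have "min (val V x) (val V y) \<le> val V (x \<oplus> y)" using val_add[OF V] c by auto
      then show ?thesis using xy False c unfolding center_def by auto
    qed
  next
    fix d x assume d: "d \<in> carrier R" and x: "x \<in> center V"
    show "d \<otimes> x \<in> center V"
    proof (cases "d = \<zero> \<or> x = \<zero>")
      case True then show ?thesis using d x unfolding center_def by auto
    next
      case False
      then show ?thesis using val_mult[OF V, of d x] d x unfolding center_def by auto
    qed
  qed (auto simp: center_def)
  show "cring R" by (rule is_cring)
  have "\<one> \<notin> center V" unfolding center_def using val_one[OF V] by simp
  then show "carrier R \<noteq> center V" by auto
next
  fix a b assume ab: "a \<in> carrier R" "b \<in> carrier R" "a \<otimes> b \<in> center V"
  show "a \<in> center V \<or> b \<in> center V"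
  proof (cases "a = \<zero> \<or> b = \<zero>")
    case True then show ?thesis using ab unfolding center_def by auto
  next
    case False
    then show ?thesis using val_mult[OF V, of a b] ab unfolding center_def by (auto simp: integral_iff)
  qed
qed

text \<open>A product of elements outside \<open>Q\<close>, one from each of the finitely many
  centers, has positive value at all these valuations and stays outside the prime
  \<open>Q\<close>.\<close>

lemma avoid_centers:
  assumes Q: "primeideal Q R" and T: "finite T" "T \<subseteq> F" "\<And>V. V \<in> T \<Longrightarrow> \<not> center V \<subseteq> Q"
  shows "\<exists>s\<in>carrier R - Q. \<forall>V\<in>T. 0 < val V s"
  using T
proof induct
  interpret Q: primeideal Q R by (rule Q)
  case empty
  have "\<one> \<notin> Q" using Q.I_notcarr Q.one_imp_carrier by blast
  then show ?case by blast
next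
  interpret Q: primeideal Q R by (rule Q)
  case (insert V T)
  then obtain s where s: "s \<in> carrier R - Q" "\<And>W. W \<in> T \<Longrightarrow> 0 < val W s" by auto
  obtain t where t: "t \<in> center V" "t \<notin> Q" using insert(5)[of V] by blast
  have tc: "t \<in> carrier R" using t unfolding center_def by simp
  have nz: "s \<in> carrier R - {\<zero>}" "t \<in> carrier R - {\<zero>}" using s t tc Q.zero_closed by auto
  have "0 < val W (s \<otimes> t)" if "W \<in> insert V T" for W
    using val_mult[of W s t] nz s(2)[of W] t insert(4) that unfolding center_def by auto
  moreover have "s \<otimes> t \<in> carrier R - Q" using Q.I_prime[of s t] s t tc by auto
  ultimately show ?case by blast
qed

text \<open>Otherwise an element outside \<open>Q\<close> would have positive value wherever
  \<open>p\<close> has, so a power of it would be divisible by \<open>p\<close> and lie in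
  \<open>Q\<close>.\<close>

lemma prime_contains_center:
  assumes Q: "primeideal Q R" and p: "p \<in> Q" "p \<noteq> \<zero>"
  shows "\<exists>V\<in>F. p \<in> center V \<and> center V \<subseteq> Q"
proof (rule ccontr)
  assume no: "\<not> ?thesis"
  interpret Q: primeideal Q R by (rule Q)
  have pc: "p \<in> carrier R - {\<zero>}" using p Q.Icarr by auto
  let ?T = "{V \<in> F. 0 < val V p}"
  have fin: "finite ?T" by (rule val_finite[OF pc])
  have "\<not> center V \<subseteq> Q" if "V \<in> ?T" for V using no that pc unfolding center_def by auto
  then obtain s where s: "s \<in> carrier R - Q" "\<And>V. V \<in> ?T \<Longrightarrow> 0 < val V s"
    using avoid_centers[OF Q fin] by blast
  have snz: "s \<in> carrier R - {\<zero>}" using s Q.zero_closed by auto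
  \<comment> \<open>The sum of all values of \<open>p\<close> is one exponent large enough for every
    valuation at once.\<close>
  let ?N = "\<Sum>V\<in>?T. val V p"
  have "val V p \<le> val V (s [^] ?N)" if V: "V \<in> F" for V
  proof (cases "V \<in> ?T")
    case True
    have "val V p \<le> ?N" by (rule member_le_sum[OF True _ fin]) simp
    also have "\<dots> \<le> ?N * val V s" using s(2)[OF True] by simp
    finally show ?thesis using val_pow[OF V snz] by simp
  next
    case False then show ?thesis using V by simp
  qed
  then obtain c where c: "c \<in> carrier R" "s [^] ?N = c \<otimes> p" using val_dvd[OF pc pow_nz[OF snz]] by blast
  then have "s [^] ?N \<in> Q" using Q.I_l_closed[OF p(1)] by simp
  moreover have "s [^] (n::nat) \<notin> Q" for n
  proof (induct n)
    case 0 then show ?case using Q.I_notcarr Q.one_imp_carrier by auto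
  next
    case (Suc n) then show ?case using Q.I_prime[of "s [^] n" s] s by auto
  qed
  ultimately show False by blast
qed

text \<open>Finitely many centers contain \<open>p\<close>, so there is a minimal one inside
  \<open>Q\<close>; a prime below it that contains \<open>p\<close> again contains such a
  center.\<close>

lemma exists_minimal_prime_below:
  assumes Q: "primeideal Q R" and p: "p \<in> Q" "p \<noteq> \<zero>"
  obtains V where "V \<in> F" "p \<in> center V" "center V \<subseteq> Q" "minimal_prime_over R (PIdl p) (center V)"
proof -
  interpret Q: primeideal Q R by (rule Q)
  have pc: "p \<in> carrier R - {\<zero>}" using p Q.Icarr by auto
  let ?C = "center ` {V \<in> F. p \<in> center V \<and> center V \<subseteq> Q}"
  have "{V \<in> F. p \<in> center V \<and> center V \<subseteq> Q} \<subseteq> {V \<in> F. 0 < val V p}" using pc unfolding center_def by auto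
  then have "finite ?C" using val_finite[OF pc] finite_subset by blast
  moreover have "?C \<noteq> {}" using prime_contains_center[OF Q p] by blast
  ultimately have "\<exists>Z\<in>?C. \<forall>Y\<in>?C. Y \<le> Z \<longrightarrow> Z = Y" by (rule finite_has_minimal)
  then obtain Z where Z1: "Z \<in> ?C" and Z0: "\<forall>Y\<in>?C. Y \<le> Z \<longrightarrow> Z = Y" by (elim bexE)
  have Z2: "Y = Z" if "Y \<in> ?C" "Y \<subseteq> Z" for Y using Z0[THEN bspec, OF that(1)] that(2) by simp
  note Z = Z1 Z2
  then obtain V where V: "V \<in> F" "p \<in> center V" "center V \<subseteq> Q" "Z = center V" by blast
  have "minimal_prime_over R (PIdl p) (center V)" unfolding minimal_prime_over_def
  proof (intro conjI allI impI)
    show pr: "primeideal (center V) R" by (rule center_prime[OF V(1)])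
    show "PIdl p \<subseteq> center V" by (rule cgenideal_minimal[OF primeideal.axioms(1)[OF pr] V(2)])
    fix Q' assume *: "primeideal Q' R \<and> PIdl p \<subseteq> Q' \<and> Q' \<subseteq> center V"
    then have "p \<in> Q'" using cgenideal_self[of p] pc by blast
    then obtain W where W: "W \<in> F" "p \<in> center W" "center W \<subseteq> Q'" using prime_contains_center[of Q' p] * p by blast
    then have "center W \<in> ?C" using * V(3) by blast
    then have "center W = center V" using Z(2)[of "center W"] W(3) * V(4) by blast
    then show "Q' = center V" using W * by blast
  qed
  with V that show thesis by blast
qed

lemma minimal_prime_is_center:
  assumes P: "minimal_prime_over R (PIdl p) P" and p: "p \<in> carrier R - {\<zero>}"
  shows "\<exists>V\<in>F. P = center V \<and> 0 < val V p"
proof -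
  have pP: "p \<in> P" using P cgenideal_self[of p] p unfolding minimal_prime_over_def by blast
  have Ppr: "primeideal P R" using P unfolding minimal_prime_over_def by simp
  have p0: "p \<noteq> \<zero>" using p by simp
  obtain V where V: "V \<in> F" "p \<in> center V" "center V \<subseteq> P" "minimal_prime_over R (PIdl p) (center V)"
    by (rule exists_minimal_prime_below[OF Ppr pP p0])
  then have "center V = P" using P unfolding minimal_prime_over_def by blast
  then show ?thesis using V p unfolding center_def by auto
qed

lemma finite_minimal_primes:
  assumes p: "p \<in> carrier R - {\<zero>}"
  shows "finite {P. minimal_prime_over R (PIdl p) P}"
proof -
  have "{P. minimal_prime_over R (PIdl p) P} \<subseteq> center ` {V \<in> F. 0 < val V p}"
    using minimal_prime_is_center[OF _ p] by blast
  then show ?thesis using val_finite[OF p] finite_subset by blast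
qed

text \<open>Localizing at \<open>P\<close> leaves only the valuations centered inside
  \<open>P\<close>: the finitely many others that are positive on \<open>a\<close> are compensated
  by a power of an element outside \<open>P\<close>.\<close>

lemma local_dvd:
  assumes P: "primeideal P R" and ab: "a \<in> carrier R - {\<zero>}" "b \<in> carrier R - {\<zero>}"
    and le: "\<And>V. V \<in> F \<Longrightarrow> center V \<subseteq> P \<Longrightarrow> val V a \<le> val V b"
  shows "\<exists>s\<in>carrier R - P. \<exists>c\<in>carrier R. s \<otimes> b = c \<otimes> a"
proof -
  interpret P: primeideal P R by (rule P)
  let ?T = "{V \<in> F. 0 < val V a \<and> \<not> center V \<subseteq> P}"
  have fin: "finite ?T" using val_finite[OF ab(1)] by (rule finite_subset[rotated]) auto
  obtain s where s: "s \<in> carrier R - P" "\<And>V. V \<in> ?T \<Longrightarrow> 0 < val V s"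
    using avoid_centers[OF P fin] by blast
  have snz: "s \<in> carrier R - {\<zero>}" using s P.zero_closed by auto
  let ?N = "\<Sum>V\<in>?T. val V a"
  have "val V a \<le> val V (s [^] ?N \<otimes> b)" if V: "V \<in> F" for V
  proof -
    have eq: "val V (s [^] ?N \<otimes> b) = ?N * val V s + val V b"
      using val_mult[OF V pow_nz[OF snz] ab(2)] val_pow[OF V snz] by simp
    show ?thesis
    proof (cases "center V \<subseteq> P")
      case True then show ?thesis using le[OF V] eq by simp
    next
      case False
      show ?thesis
      proof (cases "V \<in> ?T")
        case True
        have "val V a \<le> ?N" by (rule member_le_sum[OF True _ fin]) simp
        also have "\<dots> \<le> ?N * val V s" using s(2)[OF True] by simp
        finally show ?thesis using eq by simp
      next
        case F: False then show ?thesis using V False by simp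
      qed
    qed
  qed
  then obtain c where c: "c \<in> carrier R" "s [^] ?N \<otimes> b = c \<otimes> a"
    using val_dvd[OF ab(1) mult_nz[OF pow_nz[OF snz] ab(2)]] by blast
  have "s [^] (n::nat) \<notin> P" for n
  proof (induct n)
    case 0 then show ?case using P.I_notcarr P.one_imp_carrier by auto
  next
    case (Suc n) then show ?case using P.I_prime[of "s [^] n" s] s by auto
  qed
  then have "s [^] ?N \<in> carrier R - P" using s(1) by simp
  then show ?thesis using c by blast
qed

text \<open>In other words, the localization at \<open>P\<close> is the valuation ring of some \<open>V\<close> in \<open>F\<close>. The
  valuations centered at \<open>P\<close> are finitely many, so among the families defining the
  localization one with as few of them as possible exists; an element separating one of them from
  the rest of the family then forces the rest to be trivial.\<close>

lemma minimal_prime_valuation: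
  assumes P: "minimal_prime_over R (PIdl p) P" and p: "p \<in> carrier R - {\<zero>}"
  shows "\<exists>V\<in>F. \<forall>a\<in>carrier R - {\<zero>}. \<forall>b\<in>carrier R - {\<zero>}. val V a \<le> val V b \<longrightarrow>
    (\<exists>s\<in>carrier R - P. \<exists>c\<in>carrier R. s \<otimes> b = c \<otimes> a)"
proof -
  have Ppr: "primeideal P R" using P unfolding minimal_prime_over_def by simp
  interpret P: primeideal P R by (rule Ppr)
  \<comment> \<open>\<open>FP\<close> defines the localization at \<open>P\<close>. Its members
    outside \<open>T\<close> have a center strictly below \<open>P\<close> and so give
    \<open>p\<close> the value zero.\<close>
  define FP where "FP = {V \<in> F. center V \<subseteq> P}"
  define T where "T = {V \<in> F. center V = P}"
  have pP: "p \<in> P" using P cgenideal_self[of p] p unfolding minimal_prime_over_def by blast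
  have TF: "T \<subseteq> F" "T \<subseteq> FP" unfolding T_def FP_def by auto
  have "T \<subseteq> {V \<in> F. 0 < val V p}" unfolding T_def using pP p unfolding center_def by auto
  then have finT: "finite T" using val_finite[OF p] finite_subset by blast
  have offT: "val V p = 0" if V: "V \<in> FP" "V \<notin> T" for V
  proof (rule ccontr)
    assume "val V p \<noteq> 0"
    then have pV: "p \<in> center V" using p unfolding center_def by auto
    have VF: "V \<in> F" "center V \<subseteq> P" using V unfolding FP_def by auto
    have "PIdl p \<subseteq> center V" by (rule cgenideal_minimal[OF primeideal.axioms(1)[OF center_prime[OF VF(1)]] pV])
    then have "center V = P" using P center_prime[OF VF(1)] VF(2) unfolding minimal_prime_over_def by blast
    then show False using V VF unfolding T_def by simp
  qed
  have unitP: "val V s = 0" if "V \<in> FP" "s \<in> carrier R - P" for V s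
  proof -
    have "s \<notin> center V" using that unfolding FP_def by auto
    then show ?thesis using that unfolding center_def by auto
  qed
  have nzP: "s \<in> carrier R - {\<zero>}" if "s \<in> carrier R - P" for s using that P.zero_closed by auto
  have notP: "c \<in> carrier R - P" if "V \<in> T" "c \<in> carrier R - {\<zero>}" "val V c = 0" for V c
    using that val_zero_iff[of c V] unfolding T_def by auto
  define le where "le G a b \<longleftrightarrow> (\<forall>V\<in>G. val V a \<le> val V b)" for G a b
  \<comment> \<open>Only members of \<open>T\<close> may be discarded, so that minimality can be
    measured by a finite cardinality.\<close>
  define defi where "defi G \<longleftrightarrow> FP - T \<subseteq> G \<and> G \<subseteq> FP \<and>
    (\<forall>a\<in>carrier R - {\<zero>}. \<forall>b\<in>carrier R - {\<zero>}. le G a b \<longrightarrow> le FP a b)" for G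
  have "defi FP" unfolding defi_def by auto
  then have "\<exists>G. defi G \<and> (\<forall>H. defi H \<longrightarrow> card (G \<inter> T) \<le> card (H \<inter> T))"
    by (rule ex_has_least_nat)
  then obtain G where G: "defi G" and Gmin: "\<And>H. defi H \<Longrightarrow> card (G \<inter> T) \<le> card (H \<inter> T)" by blast
  have GFP: "FP - T \<subseteq> G" "G \<subseteq> FP" and Gd: "\<And>a b. a \<in> carrier R - {\<zero>} \<Longrightarrow> b \<in> carrier R - {\<zero>} \<Longrightarrow> le G a b \<Longrightarrow> le FP a b"
    using G unfolding defi_def by auto
  have loc: "\<exists>s\<in>carrier R - P. \<exists>c\<in>carrier R - {\<zero>}. s \<otimes> b = c \<otimes> a"
    if ab: "a \<in> carrier R - {\<zero>}" "b \<in> carrier R - {\<zero>}" and l: "le G a b" for a b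
  proof -
    have "le FP a b" using Gd[OF ab l] .
    then obtain s c where sc: "s \<in> carrier R - P" "c \<in> carrier R" "s \<otimes> b = c \<otimes> a"
      using local_dvd[OF Ppr ab] unfolding le_def FP_def by blast
    have "s \<otimes> b \<noteq> \<zero>" using mult_nz[OF nzP[OF sc(1)] ab(2)] by blast
    then have "c \<noteq> \<zero>" using sc(3) ab by auto
    then show ?thesis using sc by blast
  qed
  \<comment> \<open>Otherwise \<open>p\<close>, of value zero throughout \<open>G\<close>, would be
    invertible in the localization.\<close>
  have "G \<inter> T \<noteq> {}"
  proof
    assume e: "G \<inter> T = {}"
    have "le G p \<one>" unfolding le_def using offT e GFP(2) by fastforce
    then have l: "le FP p \<one>" using Gd[OF p] by simp
    obtain V where V: "V \<in> F" "P = center V" "0 < val V p" using minimal_prime_is_center[OF P p] by blast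
    then have "V \<in> FP" unfolding FP_def by simp
    then show False using l V val_one[OF V(1)] unfolding le_def by auto
  qed
  then obtain V where V: "V \<in> G" "V \<in> T" by blast
  have VF: "V \<in> F" using V TF by blast
  let ?H = "G - {V}"
  have HF: "W \<in> F" "W \<in> FP" if "W \<in> ?H" for W using that GFP(2) unfolding FP_def by auto
  have "\<not> defi ?H"
  proof
    assume "defi ?H"
    then have "card (G \<inter> T) \<le> card (?H \<inter> T)" by (rule Gmin)
    moreover have "?H \<inter> T \<subset> G \<inter> T" using V by blast
    then have "card (?H \<inter> T) < card (G \<inter> T)" using finT by (intro psubset_card_mono) auto
    ultimately show False by simp
  qed
  then obtain a b where ab: "a \<in> carrier R - {\<zero>}" "b \<in> carrier R - {\<zero>}" "le ?H a b" "\<not> le FP a b"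
    unfolding defi_def using GFP V by blast
  then have nab: "\<not> le G a b" using Gd by blast
  then have Vab: "val V b < val V a" using ab(3) V unfolding le_def by (metis Diff_iff empty_iff insert_iff not_le)
  \<comment> \<open>The exponents are chosen so that \<open>a^e\<close> and \<open>b^e p^n\<close>
    have the same value at \<open>V\<close>.\<close>
  define n e where "n = val V a - val V b" and "e = val V p"
  have n: "0 < n" unfolding n_def using Vab by simp
  have e: "0 < e" unfolding e_def using V(2) pP p unfolding T_def center_def by auto
  have vz: "val W (b [^] e \<otimes> p [^] n) = e * val W b + n * val W p" if "W \<in> F" for W
    using val_mult[OF that pow_nz[OF ab(2)] pow_nz[OF p]] val_pow[OF that] ab p by simp
  have Veq: "val V (b [^] e \<otimes> p [^] n) = e * val V a"
  proof -
    have "e * val V b + n * e = e * (val V b + n)" by (simp add: algebra_simps)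
    also have "val V b + n = val V a" unfolding n_def using Vab by simp
    finally show ?thesis using vz[OF VF] unfolding e_def by simp
  qed
  have "le G (a [^] e) (b [^] e \<otimes> p [^] n)" unfolding le_def
  proof
    fix W assume W: "W \<in> G"
    then have WF: "W \<in> F" using GFP(2) unfolding FP_def by auto
    show "val W (a [^] e) \<le> val W (b [^] e \<otimes> p [^] n)"
    proof (cases "W = V")
      case True then show ?thesis using Veq val_pow[OF VF ab(1)] by simp
    next
      case False
      then have "val W a \<le> val W b" using ab(3) W unfolding le_def by blast
      then have "e * val W a \<le> e * val W b" by simp
      then show ?thesis unfolding vz[OF WF] val_pow[OF WF ab(1)] by linarith
    qed
  qed
  from loc[OF pow_nz[OF ab(1)] mult_nz[OF pow_nz[OF ab(2)] pow_nz[OF p]] this]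
  obtain s c where sc: "s \<in> carrier R - P" "c \<in> carrier R - {\<zero>}" "s \<otimes> (b [^] e \<otimes> p [^] n) = c \<otimes> a [^] e" by blast
  have vsc: "val W s + (e * val W b + n * val W p) = val W c + e * val W a" if "W \<in> F" for W
    using val_mult[OF that nzP[OF sc(1)] mult_nz[OF pow_nz[OF ab(2)] pow_nz[OF p]]]
      val_mult[OF that sc(2) pow_nz[OF ab(1)]] vz[OF that] val_pow[OF that ab(1)] sc(3) by metis
  \<comment> \<open>\<open>V\<close> is centered at \<open>P\<close>, so value zero at
    \<open>V\<close> puts \<open>c\<close> outside \<open>P\<close>, and then \<open>c\<close> has
    value zero at every member of \<open>FP\<close>.\<close>
  have "val V c = 0" using vsc[OF VF] unitP[OF _ sc(1), of V] V TF Veq vz[OF VF] by auto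
  then have cP: "c \<in> carrier R - P" using notP[OF V(2) sc(2)] by simp
  have Hab: "val W a = val W b" if W: "W \<in> ?H" for W
  proof -
    have "e * val W b + n * val W p = e * val W a"
      using vsc[OF HF(1)[OF W]] unitP[OF HF(2)[OF W] sc(1)] unitP[OF HF(2)[OF W] cP] by simp
    moreover have "val W a \<le> val W b" using ab(3) W unfolding le_def by blast
    ultimately have "e * val W b \<le> e * val W a" by linarith
    then show ?thesis using e \<open>val W a \<le> val W b\<close> by simp
  qed
  \<comment> \<open>The fraction of \<open>b\<close> by \<open>a\<close> has value \<open>-n\<close>
    at \<open>V\<close> and zero on \<open>?H\<close>. Multiplied by its \<open>k\<close>-th power,
    \<open>x [^] n\<close> has value zero at \<open>V\<close>, hence becomes a unit of the
    localization, and so \<open>x\<close> has value zero on \<open>?H\<close>.\<close>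
  have triv: "val W x = 0" if W: "W \<in> ?H" and x: "x \<in> carrier R - {\<zero>}" for W x
  proof -
    define k where "k = val V x"
    have vx: "val U (x [^] n \<otimes> b [^] k) = n * val U x + k * val U b" if "U \<in> F" for U
      using val_mult[OF that pow_nz[OF x] pow_nz[OF ab(2)]] val_pow[OF that] x ab by simp
    have Vx: "val V (x [^] n \<otimes> b [^] k) = k * val V a"
    proof -
      have "n * k + k * val V b = k * (val V b + n)" by (simp add: algebra_simps)
      also have "val V b + n = val V a" unfolding n_def using Vab by simp
      finally show ?thesis using vx[OF VF] unfolding k_def by simp
    qed
    have "le G (a [^] k) (x [^] n \<otimes> b [^] k)" unfolding le_def
    proof
      fix U assume U: "U \<in> G"
      then have UF: "U \<in> F" using GFP(2) unfolding FP_def by auto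
      show "val U (a [^] k) \<le> val U (x [^] n \<otimes> b [^] k)"
      proof (cases "U = V")
        case True then show ?thesis using Vx val_pow[OF VF ab(1)] by simp
      next
        case False
        then have "val U a = val U b" using Hab U by blast
        then show ?thesis using vx[OF UF] val_pow[OF UF ab(1)] by simp
      qed
    qed
    from loc[OF pow_nz[OF ab(1)] mult_nz[OF pow_nz[OF x] pow_nz[OF ab(2)]] this]
    obtain s d where sd: "s \<in> carrier R - P" "d \<in> carrier R - {\<zero>}" "s \<otimes> (x [^] n \<otimes> b [^] k) = d \<otimes> a [^] k" by blast
    have vsd: "val U s + (n * val U x + k * val U b) = val U d + k * val U a" if "U \<in> F" for U
      using val_mult[OF that nzP[OF sd(1)] mult_nz[OF pow_nz[OF x] pow_nz[OF ab(2)]]]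
        val_mult[OF that sd(2) pow_nz[OF ab(1)]] vx[OF that] val_pow[OF that ab(1)] sd(3) by metis
    have "val V d = 0" using vsd[OF VF] unitP[OF _ sd(1), of V] V TF Vx vx[OF VF] by auto
    then have dP: "d \<in> carrier R - P" using notP[OF V(2) sd(2)] by simp
    have "n * val W x = 0"
      using vsd[OF HF(1)[OF W]] unitP[OF HF(2)[OF W] sd(1)] unitP[OF HF(2)[OF W] dP] Hab[OF W] by simp
    then show ?thesis using n by simp
  qed
  \<comment> \<open>A trivial valuation would contradict \<open>val_nontrivial\<close>.\<close>
  have "?H = {}"
  proof (rule ccontr)
    assume "?H \<noteq> {}"
    then obtain W where W: "W \<in> ?H" by blast
    then show False using val_nontrivial[OF HF(1)[OF W]] triv[OF W] by fastforce
  qed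
  then have GV: "G = {V}" using V by blast
  have "\<exists>s\<in>carrier R - P. \<exists>c\<in>carrier R. s \<otimes> b = c \<otimes> a"
    if "a \<in> carrier R - {\<zero>}" "b \<in> carrier R - {\<zero>}" "val V a \<le> val V b" for a b
    using loc[OF that(1,2)] that(3) unfolding le_def GV by blast
  then show ?thesis using VF by blast
qed

text \<open>An element of least value under the valuation of \<open>minimal_prime_valuation\<close>
  divides all others after localizing at \<open>P\<close>.\<close>

lemma minimal_prime_ideal_principal:
  assumes P: "minimal_prime_over R (PIdl p) P" and p: "p \<in> carrier R - {\<zero>}" and J: "ideal J R"
  shows "\<exists>j\<in>J. \<forall>x\<in>J. \<exists>s\<in>carrier R - P. s \<otimes> x \<in> PIdl j"
proof -
  interpret J: ideal J R by (rule J)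
  have Ppr: "primeideal P R" using P unfolding minimal_prime_over_def by simp
  interpret P: primeideal P R by (rule Ppr)
  have one: "\<one> \<in> carrier R - P" using P.I_notcarr P.one_imp_carrier by blast
  obtain V where V: "V \<in> F" "\<And>a b. a \<in> carrier R - {\<zero>} \<Longrightarrow> b \<in> carrier R - {\<zero>} \<Longrightarrow> val V a \<le> val V b \<Longrightarrow>
    \<exists>s\<in>carrier R - P. \<exists>c\<in>carrier R. s \<otimes> b = c \<otimes> a" using minimal_prime_valuation[OF P p] by blast
  have z: "\<exists>s\<in>carrier R - P. s \<otimes> \<zero> \<in> PIdl j" if j: "j \<in> carrier R" for j
  proof -
    interpret I: ideal "PIdl j" R by (rule cgenideal_ideal[OF j])
    show ?thesis by (rule bexI[OF _ one]) simp
  qed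
  show ?thesis
  proof (cases "J \<subseteq> {\<zero>}")
    case True
    then have "\<exists>s\<in>carrier R - P. s \<otimes> x \<in> PIdl \<zero>" if "x \<in> J" for x
      using z[OF zero_closed] that by blast
    then show ?thesis using J.zero_closed by blast
  next
    case False
    then obtain x0 where "x0 \<in> J \<and> x0 \<noteq> \<zero>" by blast
    then obtain j where j: "j \<in> J \<and> j \<noteq> \<zero>" "\<And>y. y \<in> J \<and> y \<noteq> \<zero> \<Longrightarrow> val V j \<le> val V y"
      using ex_has_least_nat[of "\<lambda>x. x \<in> J \<and> x \<noteq> \<zero>" x0 "val V"] by blast
    have jc: "j \<in> carrier R" using j J.Icarr by blast
    have "\<exists>s\<in>carrier R - P. s \<otimes> x \<in> PIdl j" if x: "x \<in> J" for x
    proof (cases "x = \<zero>")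
      case True then show ?thesis using z[OF jc] by simp
    next
      case False
      then obtain s c where "s \<in> carrier R - P" "c \<in> carrier R" "s \<otimes> x = c \<otimes> j"
        using V(2)[of j x] j x J.Icarr by blast
      then show ?thesis unfolding cgenideal_def by blast
    qed
    then show ?thesis using j by blast
  qed
qed

text \<open>Equality of \<open>J\<close> with a finitely generated subideal is tested at every
  maximal ideal: by \<open>den\<close> where \<open>p\<close> is invertible, and otherwise at one of
  the finitely many minimal primes, where one element suffices.\<close>

lemma noetherian_of_maximal_minimal_primes:
  assumes p: "p \<in> carrier R - {\<zero>}"
    and max: "\<And>P M. minimal_prime_over R (PIdl p) P \<Longrightarrow> maximalideal M R \<Longrightarrow> P \<subseteq> M \<Longrightarrow> M = P"
    and den: "\<And>J. ideal J R \<Longrightarrow> \<exists>G\<subseteq>J. finite G \<and> (\<forall>x\<in>J. \<exists>n::nat. p [^] n \<otimes> x \<in> Idl G)"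
  shows "noetherian_ring R"
proof (rule noetherian_ringI)
  fix J assume J: "ideal J R"
  interpret J: ideal J R by (rule J)
  obtain G where G: "G \<subseteq> J" "finite G" "\<And>x. x \<in> J \<Longrightarrow> \<exists>n::nat. p [^] n \<otimes> x \<in> Idl G" using den[OF J] by blast
  let ?M = "{P. minimal_prime_over R (PIdl p) P}"
  have "\<forall>P\<in>?M. \<exists>j. j \<in> J \<and> (\<forall>x\<in>J. \<exists>s\<in>carrier R - P. s \<otimes> x \<in> PIdl j)"
    using minimal_prime_ideal_principal[OF _ p J] by blast
  then obtain j where j: "\<And>P. P \<in> ?M \<Longrightarrow> j P \<in> J \<and> (\<forall>x\<in>J. \<exists>s\<in>carrier R - P. s \<otimes> x \<in> PIdl (j P))" by metis
  let ?G = "G \<union> j ` ?M"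
  have GJ: "?G \<subseteq> J" using G j by blast
  then have Gc: "?G \<subseteq> carrier R" using J.Icarr by blast
  have fin: "finite ?G" using G finite_minimal_primes[OF p] by blast
  interpret I: ideal "Idl ?G" R by (rule genideal_ideal[OF Gc])
  have "J \<subseteq> Idl ?G"
  proof
    fix x assume x: "x \<in> J"
    then have xc: "x \<in> carrier R" by simp
    \<comment> \<open>The ideal of multipliers taking \<open>x\<close> into the finitely generated
      ideal; were it proper, some maximal ideal would contain it.\<close>
    let ?C = "{s \<in> carrier R. s \<otimes> x \<in> Idl ?G}"
    have C: "ideal ?C R"
      by (rule ideal_of_closed) (use xc I.a_closed I.I_l_closed I.zero_closed in \<open>auto simp: l_distr m_assoc\<close>)
    have "?C = carrier R"
    proof (rule ccontr)
      assume "?C \<noteq> carrier R"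
      then obtain M where M: "maximalideal M R" "?C \<subseteq> M" by (rule exists_maximalideal_containing[OF C])
      have Mpr: "primeideal M R" by (rule maximalideal_prime[OF M(1)])
      interpret M: primeideal M R by (rule Mpr)
      show False
      proof (cases "p \<in> M")
        case False
        obtain n :: nat where n: "p [^] n \<otimes> x \<in> Idl G" using G(3)[OF x] by blast
        have "Idl G \<subseteq> Idl ?G"
          by (rule genideal_minimal[OF I.is_ideal]) (use genideal_self[OF Gc] in blast)
        then have "p [^] n \<in> ?C" using n p by auto
        then have pn: "p [^] n \<in> M" using M(2) by blast
        have "p [^] (k::nat) \<notin> M" for k
        proof (induct k)
          case 0 then show ?case using M.I_notcarr M.one_imp_carrier by auto
        next
          case (Suc k) then show ?case using M.I_prime[of "p [^] k" p] p False by auto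
        qed
        then show False using pn by blast
      next
        case True
        obtain V where V: "center V \<subseteq> M" "minimal_prime_over R (PIdl p) (center V)"
          using exists_minimal_prime_below[OF Mpr True] p by auto
        have MP: "M = center V" by (rule max[OF V(2) M(1) V(1)])
        then obtain s where s: "s \<in> carrier R - M" "s \<otimes> x \<in> PIdl (j M)" using j[of M] V(2) x by blast
        have "PIdl (j M) \<subseteq> Idl ?G"
          by (rule cgenideal_minimal[OF I.is_ideal]) (use genideal_self[OF Gc] V(2) MP in blast)
        then have "s \<in> ?C" using s by blast
        then show False using M(2) s by blast
      qed
    qed
    then have "\<one> \<in> ?C" by simp
    then show "x \<in> Idl ?G" using xc by simp
  qed
  moreover have "Idl ?G \<subseteq> J" by (rule genideal_minimal[OF J GJ])
  ultimately show "\<exists>A\<subseteq>carrier R. finite A \<and> J = Idl A" using Gc fin by blast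
qed

end

section \<open>Linear dependence, primes of the subring, and relations modulo a prime\<close>

context noeth_local_subring
begin

text \<open>Elimination without division: an element \<open>y k\<close> with nonzero coefficient at
  \<open>u\<close> clears \<open>u\<close> from the others by cross-multiplication.\<close>

lemma linear_dependence:
  assumes dom: "domain R" and us: "set us \<subseteq> carrier R"
    and J: "finite J" "length us < card J" and y: "\<And>j. j \<in> J \<Longrightarrow> y j \<in> Span D us"
  shows "\<exists>r. (\<forall>j. r j \<in> D) \<and> (\<exists>j\<in>J. r j \<noteq> \<zero>) \<and> (\<Oplus>j\<in>J. r j \<otimes> y j) = \<zero>"
  using us J y
proof (induct us arbitrary: J y)
  case Nil
  then have "(\<Oplus>j\<in>J. \<one> \<otimes> y j) = (\<Oplus>j\<in>J. \<zero>)" by (intro finsum_cong') auto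
  moreover have "\<exists>j. j \<in> J" using Nil(3) by (metis card_gt_0_iff ex_in_conv list.size(3))
  ultimately show ?case using domain.one_not_zero[OF dom] by (intro exI[of _ "\<lambda>_. \<one>"]) auto
next
  case (Cons u us)
  interpret domain R by (rule dom)
  have u: "u \<in> carrier R" and us: "set us \<subseteq> carrier R" using Cons by auto
  have dS: "dsub (Span D us)" by (rule dsub_Span[OF D_ideal us])
  have "\<forall>j\<in>J. \<exists>d w. d \<in> D \<and> w \<in> Span D us \<and> y j = d \<otimes> u \<oplus> w"
    using Cons(5) by (auto simp: line_extension_mem_iff)
  then obtain c w where cw: "\<And>j. j \<in> J \<Longrightarrow> c j \<in> D \<and> w j \<in> Span D us \<and> y j = c j \<otimes> u \<oplus> w j"
    by metis
  have wc: "w j \<in> carrier R" if "j \<in> J" for j using cw[OF that] dsub_carrier[OF dS] by blast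
  have cc: "c j \<in> carrier R" if "j \<in> J" for j using cw[OF that] by auto
  have yc: "y j \<in> carrier R" if "j \<in> J" for j using cw[OF that] wc[OF that] cc[OF that] u by auto
  show ?case
  proof (cases "\<forall>j\<in>J. c j = \<zero>")
    case True
    then have "y j \<in> Span D us" if "j \<in> J" for j using cw[OF that] wc[OF that] u that by auto
    then show ?thesis using Cons(1)[OF us Cons(3)] Cons(4) by simp
  next
    case False
    then obtain k where k: "k \<in> J" "c k \<noteq> \<zero>" by blast
    let ?J = "J - {k}"
    have J': "finite ?J" "length us < card ?J" using Cons(3,4) k by auto
    let ?z = "\<lambda>j. c k \<otimes> w j \<ominus> c j \<otimes> w k"
    have "?z j \<in> Span D us" if "j \<in> ?J" for j
      using cw[of j] cw[OF k(1)] that by (intro dsub_minus[OF dS] dsub_smult[OF dS]) auto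
    then have "\<exists>r. (\<forall>j. r j \<in> D) \<and> (\<exists>j\<in>?J. r j \<noteq> \<zero>) \<and> (\<Oplus>j\<in>?J. r j \<otimes> ?z j) = \<zero>"
      by (rule Cons(1)[OF us J'])
    then obtain r where r0: "(\<forall>j. r j \<in> D) \<and> (\<exists>j\<in>?J. r j \<noteq> \<zero>) \<and> (\<Oplus>j\<in>?J. r j \<otimes> ?z j) = \<zero>"
      by (elim exE)
    have r: "r j \<in> D" "\<exists>j\<in>?J. r j \<noteq> \<zero>" "(\<Oplus>j\<in>?J. r j \<otimes> ?z j) = \<zero>" for j
      using r0 by simp_all
    have rc: "r j \<in> carrier R" for j using r(1) by auto
    define s where "s = (\<Oplus>j\<in>?J. r j \<otimes> c j)"
    have "(\<Oplus>j\<in>T. r j \<otimes> c j) \<in> D" if "finite T" "T \<subseteq> J" for T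
      using that
    proof induct
      case (insert j T)
      have "(\<Oplus>j\<in>insert j T. r j \<otimes> c j) = r j \<otimes> c j \<oplus> (\<Oplus>j\<in>T. r j \<otimes> c j)"
        by (rule finsum_insert) (use insert rc cc in auto)
      moreover have "r j \<otimes> c j \<in> D" using insert(4) r(1) cw by blast
      ultimately show ?case using insert(3,4) by simp
    qed simp
    then have sD: "s \<in> D" unfolding s_def using J'(1) by blast
    \<comment> \<open>The coefficient at \<open>k\<close> collects what the cross-multiplications
      subtracted.\<close>
    define r' where "r' j = (if j = k then \<ominus> s else c k \<otimes> r j)" for j
    have ck: "c k \<in> carrier R" "y k \<in> carrier R" "s \<in> carrier R" using cc yc k sD by auto
    have fc: "(\<lambda>j. c k \<otimes> r j \<otimes> y j) \<in> ?J \<rightarrow> carrier R" using rc yc ck by auto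
    define S where "S = (\<Oplus>j\<in>?J. c k \<otimes> r j \<otimes> y j)"
    have Sc: "S \<in> carrier R" unfolding S_def by (rule finsum_closed[OF fc])
    have "(\<Oplus>j\<in>?J. r j \<otimes> ?z j) \<oplus> s \<otimes> y k = S"
    proof -
      have "s \<otimes> y k = (\<Oplus>j\<in>?J. r j \<otimes> c j \<otimes> y k)" unfolding s_def
        by (rule finsum_ldistr) (use J' rc cc ck in auto)
      then have "(\<Oplus>j\<in>?J. r j \<otimes> ?z j) \<oplus> s \<otimes> y k = (\<Oplus>j\<in>?J. r j \<otimes> ?z j \<oplus> r j \<otimes> c j \<otimes> y k)"
        by (simp only:) (rule finsum_addf[symmetric], use rc cc wc ck k in auto)
      also have "\<dots> = S" unfolding S_def
      proof (rule finsum_cong'[OF refl fc])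
        fix j assume j: "j \<in> ?J"
        then have "j \<in> J" by simp
        note j = cc[OF this] wc[OF this] cw[OF this]
        have yk: "y k = c k \<otimes> u \<oplus> w k" and yj: "y j = c j \<otimes> u \<oplus> w j" using cw[OF k(1)] j by auto
        show "r j \<otimes> ?z j \<oplus> r j \<otimes> c j \<otimes> y k = c k \<otimes> r j \<otimes> y j"
          unfolding yk yj using rc[of j] j(1,2) wc[OF k(1)] ck(1) u by algebra
      qed
      finally show ?thesis .
    qed
    then have Sk: "S = s \<otimes> y k" using r(3) ck by simp
    have "(\<Oplus>j\<in>J. r' j \<otimes> y j) = r' k \<otimes> y k \<oplus> (\<Oplus>j\<in>?J. r' j \<otimes> y j)"
    proof -
      have "J = insert k ?J" using k by blast
      moreover have "(\<Oplus>j\<in>insert k ?J. r' j \<otimes> y j) = r' k \<otimes> y k \<oplus> (\<Oplus>j\<in>?J. r' j \<otimes> y j)"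
        by (rule finsum_insert) (use J' rc yc ck in \<open>auto simp: r'_def\<close>)
      ultimately show ?thesis by simp
    qed
    also have "(\<Oplus>j\<in>?J. r' j \<otimes> y j) = S" unfolding S_def
      by (rule finsum_cong'[OF refl fc]) (auto simp: r'_def)
    also have "r' k \<otimes> y k \<oplus> S = \<zero>" unfolding Sk r'_def using ck by (simp add: l_minus l_neg)
    finally have "(\<Oplus>j\<in>J. r' j \<otimes> y j) = \<zero>" .
    moreover have "r' j \<in> D" for j unfolding r'_def using sD cw[OF k(1)] r(1) by auto
    moreover have "\<exists>j\<in>J. r' j \<noteq> \<zero>"
    proof -
      obtain j where j: "j \<in> ?J" "r j \<noteq> \<zero>" using r(2) by blast
      then have "r' j \<noteq> \<zero>" unfolding r'_def using k ck(1) rc[of j] by (simp add: integral_iff)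
      then show ?thesis using j by blast
    qed
    ultimately show ?thesis by blast
  qed
qed

lemma contracted_prime:
  assumes P: "primeideal P R" shows "primeideal (P \<inter> D) DD"
proof -
  interpret P: primeideal P R by (rule P)
  have "\<one> \<notin> P" using P.I_notcarr P.one_imp_carrier by blast
  then have "carrier DD \<noteq> P \<inter> D" by auto
  moreover have "ideal (P \<inter> D) DD" by (rule DD_idealI) (use P.a_closed P.I_l_closed in auto)
  ultimately show ?thesis by (intro primeidealI DD_cring) (use P.I_prime in auto)
qed

lemma DD_prime_sub_m: "primeideal q DD \<Longrightarrow> q \<subseteq> m"
  using DD_ideal_sub_m[of q] primeideal.axioms(1)[of q DD] primeideal.I_notcarr[of q DD] by auto

text \<open>Height one enters through its lower bound: a chain of positive length ends at
  \<open>p\<close>.\<close>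

lemma chain_of_height:
  assumes "height B p = 1" obtains C n where "prime_chain B (Suc n) C" "C (Suc n) = p"
proof -
  have "0 < height B p" using assms by simp
  then obtain n C where "0 < enat n" "prime_chain B n C" "C n = p" unfolding height_def less_Sup_iff by blast
  then show thesis using that by (cases n) (auto simp: zero_enat_def)
qed

text \<open>A prime strictly between \<open>p\<close> and \<open>m\<close> would extend a chain of
  positive length ending at \<open>p\<close> by two members, to length at least three.\<close>

lemma only_prime_above:
  assumes dim: "krull_dim DD = 2" and ht: "height DD p = 1" and q: "primeideal q DD" "p \<subset> q"
  shows "q = m"
proof (rule ccontr)
  assume "q \<noteq> m"
  then have qm: "q \<subset> m" using DD_prime_sub_m[OF q(1)] by blast
  obtain C n where C: "prime_chain DD (Suc n) C" "C (Suc n) = p" using chain_of_height[OF ht] .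
  let ?C = "C(Suc (Suc n) := q, Suc (Suc (Suc n)) := m)"
  have "prime_chain DD (Suc (Suc (Suc n))) ?C"
    using C q qm m_prime unfolding prime_chain_def by (auto simp: less_Suc_eq le_Suc_eq)
  then have "enat (Suc (Suc (Suc n))) \<le> krull_dim DD" unfolding krull_dim_def by (intro Sup_upper) blast
  then show False unfolding dim by (simp add: numeral_eq_enat)
qed

text \<open>If \<open>p\<close> were \<open>m\<close>, replacing the top of a chain of length at
  least two by \<open>m\<close> would give \<open>p\<close> a height above one.\<close>

lemma height_one_strict:
  assumes dim: "krull_dim DD = 2" and ht: "height DD p = 1" and p: "primeideal p DD"
  shows "p \<subset> m"
proof (rule ccontr)
  assume "\<not> p \<subset> m"
  then have pm: "p = m" using DD_prime_sub_m[OF p] by blast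
  have "1 < krull_dim DD" unfolding dim by (simp add: one_enat_def numeral_eq_enat)
  then obtain n C where C: "1 < enat n" "prime_chain DD n C" unfolding krull_dim_def less_Sup_iff by blast
  then obtain k where k: "n = Suc k" by (cases n) (auto simp: one_enat_def)
  have "C n \<subseteq> m" using C(2) DD_prime_sub_m unfolding prime_chain_def by blast
  then have "prime_chain DD n (C(n := m))" using C(2) m_prime unfolding prime_chain_def k
    by (auto simp: less_Suc_eq)
  then have "enat n \<le> height DD m" unfolding height_def by (intro Sup_upper CollectI exI[of _ n] exI[of _ "C(n := m)"]) auto
  then show False using C(1) ht pm by simp
qed

text \<open>The constant coefficient is the value of the relation minus a multiple of
  \<open>y\<close>, hence lies in \<open>M\<close>; if it lies in \<open>P\<close>, then
  \<open>y\<close>, which does not, can be divided out. The constant term comes last in the list,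
  hence the reversed induction.\<close>

lemma constant_coefficient_in_ideal:
  assumes P: "primeideal P R" and M: "ideal M R" "P \<subseteq> M" and y: "y \<in> M" "y \<notin> P"
  shows "set q \<subseteq> D \<Longrightarrow> \<not> set q \<subseteq> P \<Longrightarrow> eval q y \<in> P \<Longrightarrow> \<exists>c\<in>D. c \<in> M \<and> c \<notin> P"
proof (induct q rule: rev_induct)
  case (snoc c q)
  interpret P: primeideal P R by (rule P)
  interpret M: ideal M R by (rule M)
  have yc: "y \<in> carrier R" using y(1) by simp
  have c: "c \<in> D" "c \<in> carrier R" using snoc(2) by auto
  have qc: "set q \<subseteq> carrier R" using snoc(2) D_carrier by auto
  have e: "eval q y \<in> carrier R" by (rule eval_in_carrier[OF qc yc])
  have ev: "eval (q @ [c]) y = eval q y \<otimes> y \<oplus> c" by (rule eval_append_aux[OF qc c(2) yc])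
  show ?case
  proof (cases "c \<in> P")
    case True
    have "(eval q y \<otimes> y \<oplus> c) \<ominus> c \<in> P" using snoc(4) True unfolding ev a_minus_def by simp
    moreover have "(eval q y \<otimes> y \<oplus> c) \<ominus> c = eval q y \<otimes> y" using e yc c(2) by algebra
    ultimately have "eval q y \<in> P" using P.I_prime[OF e yc] y(2) by auto
    moreover have "\<not> set q \<subseteq> P" using snoc(3) True by auto
    ultimately show ?thesis using snoc(1,2) by auto
  next
    case False
    have "(eval q y \<otimes> y \<oplus> c) \<ominus> eval q y \<otimes> y \<in> M"
      using M.a_closed[OF subsetD[OF M(2) snoc(4)[unfolded ev]] M.a_inv_closed[OF M.I_l_closed[OF y(1) e]]]
      by (simp add: a_minus_def)
    moreover have "(eval q y \<otimes> y \<oplus> c) \<ominus> eval q y \<otimes> y = c" using e yc c(2) by algebra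
    ultimately show ?thesis using c False by auto
  qed
qed simp

text \<open>Transports \<open>algebraic_of_trdeg_zero\<close> from the quotient by \<open>P\<close>
  back to \<open>R\<close> by lifting coefficients to \<open>D\<close>.\<close>

lemma algebraic_relation_mod_prime:
  assumes P: "primeideal P R" and tr: "trdeg ((\<lambda>r. P +> r) ` D) (R Quot P) = 0" and x: "x \<in> carrier R"
  shows "\<exists>q. set q \<subseteq> D \<and> \<not> set q \<subseteq> P \<and> eval q x \<in> P"
proof -
  interpret P: primeideal P R by (rule P)
  let ?h = "(+>) P"
  interpret E: domain "R Quot P" by (rule P.quotient_is_domain)
  interpret h: ring_hom_ring R "R Quot P" ?h by (rule P.rcos_ring_hom_ring)
  have h0: "?h y = \<zero>\<^bsub>R Quot P\<^esub> \<longleftrightarrow> y \<in> P" if "y \<in> carrier R" for y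
  proof -
    have "?h y = ?h \<zero> \<longleftrightarrow> y \<ominus> \<zero> \<in> P" by (rule quotient_eq_iff_same_a_r_cos[OF P.is_ideal that zero_closed, symmetric])
    then show ?thesis using that h.hom_zero by (simp add: a_minus_def)
  qed
  have S: "subring (?h ` D) (R Quot P)" by (rule h.img_is_subring[OF D])
  obtain q where q: "set q \<subseteq> ?h ` D" "\<not> set q \<subseteq> {\<zero>\<^bsub>R Quot P\<^esub>}" "E.eval q (?h x) = \<zero>\<^bsub>R Quot P\<^esub>"
    using E.algebraic_of_trdeg_zero[OF S tr, of "?h x"] h.hom_closed[OF x] by blast
  obtain p where p: "set p \<subseteq> D" "q = map ?h p" using q(1)
    by (induct q) (auto, metis insert_subset list.simps(15,9))
  have pc: "set p \<subseteq> carrier R" using p D_carrier by blast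
  have "?h (eval p x) = \<zero>\<^bsub>R Quot P\<^esub>" using h.eval_hom'[OF x pc] q(3) p(2) by simp
  then have "eval p x \<in> P" using h0[OF eval_in_carrier[OF pc x]] by simp
  moreover have "\<not> set p \<subseteq> P"
  proof
    assume "set p \<subseteq> P"
    then have "set q \<subseteq> {\<zero>\<^bsub>R Quot P\<^esub>}" unfolding p(2) using h0 pc by auto
    with q(2) show False by simp
  qed
  ultimately show ?thesis using p(1) by blast
qed

end

text \<open>Both biconditionals follow from a cycle: (i) gives (ii) by
  \<open>noetherian_quotient\<close>, (iii) gives (i), and (ii) gives (iii).\<close>

theorem theorem3p14:
  fixes A :: "('a, 'b) ring_scheme" (structure)
    and R \<mm> :: "'a set"
    and \<pi> :: 'a
  assumes "krull_domain A"
    and "subring R A"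
    and "noetherian_domain (A\<lparr>carrier := R\<rparr>)"
    and "local_ring (A\<lparr>carrier := R\<rparr>) \<mm>"
    and "adically_complete (A\<lparr>carrier := R\<rparr>) \<mm>"
    and "krull_dim (A\<lparr>carrier := R\<rparr>) = 2"
    and "finite_closure_degree (A\<lparr>carrier := R\<rparr> Quot \<mm>)"
    and "trdeg R A > 0"
    and "\<pi> \<in> \<mm>"
    and I: "noetherian_ring (localization A {\<pi> [^] n | n :: nat. True})"
    and II: "\<And>P. minimal_prime_over A (PIdl \<pi>) P \<Longrightarrow>
               height (A\<lparr>carrier := R\<rparr>) (P \<inter> R) = 1 \<and>
               trdeg ((\<lambda>r. P +> r) ` R) (A Quot P) = 0"
  shows "(noetherian_ring A \<longleftrightarrow> noetherian_ring (A Quot (PIdl \<pi>))) \<and>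
         (noetherian_ring (A Quot (PIdl \<pi>)) \<longleftrightarrow> Idl \<mm> = carrier A)"
proof -
  have dom: "domain A" using assms(1) unfolding krull_domain_def by simp
  interpret domain A by (rule dom)
  interpret N: noeth_local_subring A R \<mm>
    by (intro noeth_local_subring.intro noeth_local_subring_axioms.intro is_cring assms(2,4)
        noetherian_domain.axioms(1)[OF assms(3)])
  obtain F and val :: "('a \<times> 'a) set set \<Rightarrow> 'a \<Rightarrow> nat" where "krull_valuations A F val"
    using krull_domain_valuations[OF assms(1)] by blast
  then interpret K: krull_valuations A F val .
  have \<pi>c: "\<pi> \<in> carrier A" using assms(9) by auto
  \<comment> \<open>For \<pi> = 0 the zero ideal would be the minimal prime, and its contraction has
    no prime strictly below it, against height one in (II).\<close>
  have \<pi>0: "\<pi> \<noteq> \<zero>"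
  proof
    assume z: "\<pi> = \<zero>"
    have "PIdl \<zero> \<subseteq> {\<zero>}" by (rule cgenideal_minimal[OF zeroideal]) simp
    then have "minimal_prime_over A (PIdl \<pi>) {\<zero>}" unfolding minimal_prime_over_def z
      using zeroprimeideal additive_subgroup.zero_closed[OF ideal.axioms(1)[OF primeideal.axioms(1)]] by blast
    then have "height (A\<lparr>carrier := R\<rparr>) ({\<zero>} \<inter> R) = 1" using II by blast
    then obtain C n where C: "prime_chain (A\<lparr>carrier := R\<rparr>) (Suc n) C" "C (Suc n) = {\<zero>} \<inter> R"
      by (rule N.chain_of_height)
    then have "primeideal (C n) (A\<lparr>carrier := R\<rparr>)" "C n \<subset> {\<zero>}" unfolding prime_chain_def by auto
    then show False
      using additive_subgroup.zero_closed[OF ideal.axioms(1)[OF primeideal.axioms(1)], of "C n" "A\<lparr>carrier := R\<rparr>"] by auto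
  qed
  have \<pi>: "\<pi> \<in> carrier A - {\<zero>}" using \<pi>c \<pi>0 by simp
  have minP: "primeideal P A" if "minimal_prime_over A (PIdl \<pi>) P" for P
    using that unfolding minimal_prime_over_def by simp
  have rel: "\<exists>q. set q \<subseteq> R \<and> \<not> set q \<subseteq> P \<and> eval q x \<in> P"
    if "minimal_prime_over A (PIdl \<pi>) P" "x \<in> carrier A" for P x
    using N.algebraic_relation_mod_prime[OF minP[OF that(1)]] II[OF that(1)] that(2) by blast
  have above: "q = \<mm>" if "minimal_prime_over A (PIdl \<pi>) P" "primeideal q (A\<lparr>carrier := R\<rparr>)" "P \<inter> R \<subset> q" for P q
    using N.only_prime_above[OF assms(6)] II[OF that(1)] that(2,3) by blast
  have strict: "P \<inter> R \<subset> \<mm>" if "minimal_prime_over A (PIdl \<pi>) P" for P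
    using N.height_one_strict[OF assms(6)] II[OF that] N.contracted_prime[OF minP[OF that]] by blast
  have "noetherian_ring (A Quot (PIdl \<pi>))" if "noetherian_ring A"
    by (rule noetherian_quotient[OF that cgenideal_ideal[OF \<pi>c]])
  moreover have "noetherian_ring A" if comax: "Idl \<mm> = carrier A"
  proof (rule K.noetherian_of_maximal_minimal_primes[OF \<pi>])
    fix P M assume P: "minimal_prime_over A (PIdl \<pi>) P" and M: "maximalideal M A" "P \<subseteq> M"
    have Mpr: "primeideal M A" by (rule maximalideal_prime[OF M(1)])
    show "M = P"
    proof (rule ccontr)
      assume "M \<noteq> P"
      then obtain y where y: "y \<in> M" "y \<notin> P" using M(2) by blast
      then have yc: "y \<in> carrier A" using ideal.Icarr[OF primeideal.axioms(1)[OF Mpr]] by blast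
      obtain c where c: "c \<in> R" "c \<in> M" "c \<notin> P"
        using rel[OF P yc] N.constant_coefficient_in_ideal[OF minP[OF P] primeideal.axioms(1)[OF Mpr] M(2) y] by blast
      then have "P \<inter> R \<subset> M \<inter> R" using M(2) by blast
      then have "M \<inter> R = \<mm>" using above[OF P N.contracted_prime[OF Mpr]] by simp
      then have "Idl \<mm> \<subseteq> M" by (intro genideal_minimal[OF primeideal.axioms(1)[OF Mpr]]) blast
      then show False using comax primeideal.I_notcarr[OF Mpr] ideal.Icarr[OF primeideal.axioms(1)[OF Mpr]] by blast
    qed
  next
    fix J assume J: "ideal J A"
    interpret L: domain_localization A "{\<pi> [^] n | n :: nat. True}"
    proof
      show "{\<pi> [^] n | n :: nat. True} \<subseteq> carrier A - {\<zero>}" using K.pow_nz[OF \<pi>] by auto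
      show "\<one> \<in> {\<pi> [^] n | n :: nat. True}" by (rule CollectI, rule exI[of _ 0]) simp
    next
      fix s t assume "s \<in> {\<pi> [^] n | n :: nat. True}" "t \<in> {\<pi> [^] n | n :: nat. True}"
      then obtain n k :: nat where "s = \<pi> [^] n" "t = \<pi> [^] k" by blast
      then have "s \<otimes> t = \<pi> [^] (n + k)" using \<pi>c by (simp add: nat_pow_mult)
      then show "s \<otimes> t \<in> {\<pi> [^] n | n :: nat. True}" by blast
    qed
    show "\<exists>G\<subseteq>J. finite G \<and> (\<forall>x\<in>J. \<exists>n::nat. \<pi> [^] n \<otimes> x \<in> Idl G)"
      using L.fg_up_to_denominators[OF I J] by blast
  qed
  moreover have "Idl \<mm> = carrier A" if noeth: "noetherian_ring (A Quot (PIdl \<pi>))"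
  proof (rule ccontr)
    assume proper: "Idl \<mm> \<noteq> carrier A"
    have fg: "fg_ideal A J" if "ideal J A" "PIdl \<pi> \<subseteq> J" for J
      by (rule fg_ideal_of_quotient[OF noeth \<pi>c that])
    have \<pi>mA: "PIdl \<pi> \<subseteq> Idl \<mm>" by (rule cgenideal_minimal[OF N.mA_ideal]) (use N.m_mA assms(9) in blast)
    have "N.fin_over (Idl \<mm>)"
    proof (rule N.fin_over_of_primes[OF _ N.mA_ideal])
      show "fg_ideal A J" if "ideal J A" "Idl \<mm> \<subseteq> J" for J using fg[OF that(1)] \<pi>mA that(2) by blast
    next
      fix Q assume Q: "primeideal Q A" "Idl \<mm> \<subseteq> Q"
      then have mQ: "\<mm> \<subseteq> Q" using N.m_mA by blast
      have \<pi>Q: "\<pi> \<in> Q" using mQ assms(9) by blast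
      \<comment> \<open>Hypothesis (II) gives relations only modulo minimal primes of \<pi>A, so one
        is chosen below \<open>Q\<close>.\<close>
      obtain V where V: "K.center V \<subseteq> Q" "minimal_prime_over A (PIdl \<pi>) (K.center V)"
        using K.exists_minimal_prime_below[OF Q(1) \<pi>Q \<pi>0] by blast
      show "N.fin_over Q"
      proof (rule N.fin_over_residue[OF Q(1) mQ _ assms(7)])
        fix x assume x: "x \<in> carrier A"
        obtain p where p: "set p \<subseteq> R" "\<not> set p \<subseteq> K.center V" "eval p x \<in> K.center V" using rel[OF V(2) x] by blast
        have "\<exists>q. set q \<subseteq> R \<and> \<not> set q \<subseteq> \<mm> \<and> eval q x \<in> K.center V"
          by (rule N.exists_unit_relation[OF minP[OF V(2)] x p above[OF V(2)] strict[OF V(2)]])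
        then show "\<exists>q. set q \<subseteq> R \<and> \<not> set q \<subseteq> \<mm> \<and> eval q x \<in> Q" using V(1) by blast
      qed
    qed
    then obtain us where us: "set us \<subseteq> carrier A" "N.span_over us (Idl \<mm>) = carrier A"
      unfolding N.fin_over_def by blast
    \<comment> \<open>A maximal ideal over \<open>Idl \<mm>\<close> contains none of the factors
      \<open>\<one> \<ominus> e\<close>, so a valuation centered inside it gives them value zero and
      bounds the power of \<pi> that can divide \<open>x\<close>.\<close>
    obtain M where M: "maximalideal M A" "Idl \<mm> \<subseteq> M"
      by (rule exists_maximalideal_containing[OF N.mA_ideal proper])
    have Mpr: "primeideal M A" by (rule maximalideal_prime[OF M(1)])
    interpret M: primeideal M A by (rule Mpr)
    have \<pi>M: "\<pi> \<in> M" using M(2) N.m_mA assms(9) by blast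
    obtain V where V: "V \<in> F" "\<pi> \<in> K.center V" "K.center V \<subseteq> M"
      using K.prime_contains_center[OF Mpr \<pi>M \<pi>0] by blast
    have "Span R us = carrier A"
    proof (rule N.span_of_separated[OF assms(5,9) fg us])
      fix x assume x: "x \<in> carrier A"
        and div: "\<And>n::nat. \<exists>e\<in>Idl \<mm>. \<exists>b\<in>carrier A. (\<one> \<ominus> e) \<otimes> x = \<pi> [^] n \<otimes> b"
      show "x = \<zero>"
      proof (rule ccontr)
        assume "x \<noteq> \<zero>"
        then have xnz: "x \<in> carrier A - {\<zero>}" using x by simp
        \<comment> \<open>Since \<pi> has value at least one at \<open>V\<close>, this power of
          \<pi> has a value exceeding that of \<open>x\<close>.\<close>
        let ?n = "Suc (val V x)"
        obtain e b where eb: "e \<in> Idl \<mm>" "b \<in> carrier A" "(\<one> \<ominus> e) \<otimes> x = \<pi> [^] ?n \<otimes> b" using div[of ?n] by blast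
        have eM: "e \<in> M" using eb(1) M(2) by blast
        then have ec: "e \<in> carrier A" by simp
        have "\<one> \<ominus> e \<notin> M"
        proof
          assume "\<one> \<ominus> e \<in> M"
          then have "(\<one> \<ominus> e) \<oplus> e \<in> M" using eM by simp
          moreover have "(\<one> \<ominus> e) \<oplus> e = \<one>" using ec by algebra
          ultimately show False using M.one_imp_carrier M.I_notcarr by simp
        qed
        then have "\<one> \<ominus> e \<in> carrier A - {\<zero>}" "\<one> \<ominus> e \<notin> K.center V"
          using minus_closed[OF one_closed ec] V(3) M.zero_closed by (metis DiffI singletonD, blast)
        then have e1: "\<one> \<ominus> e \<in> carrier A - {\<zero>}" "val V (\<one> \<ominus> e) = 0"
          using K.val_zero_iff by blast+
        have "b \<noteq> \<zero>"
        proof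
          assume "b = \<zero>"
          then have "(\<one> \<ominus> e) \<otimes> x = \<zero>" using eb(3) nat_pow_closed[OF \<pi>c, of ?n] by simp
          then show False using K.mult_nz[OF e1(1) xnz] by blast
        qed
        then have b: "b \<in> carrier A - {\<zero>}" using eb(2) by simp
        have "val V x = ?n * val V \<pi> + val V b"
        proof -
          have "val V x = val V ((\<one> \<ominus> e) \<otimes> x)" using K.val_mult[OF V(1) e1(1) xnz] e1(2) by linarith
          also have "\<dots> = val V (\<pi> [^] ?n) + val V b" unfolding eb(3) by (rule K.val_mult[OF V(1) K.pow_nz[OF \<pi>] b])
          finally show ?thesis unfolding K.val_pow[OF V(1) \<pi>] .
        qed
        moreover have "0 < val V \<pi>" using V(2) \<pi>0 unfolding K.center_def by simp
        then have "?n \<le> ?n * val V \<pi>" by (metis mult_le_mono2 mult_1_right Suc_leI One_nat_def)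
        ultimately show False by (metis le_add1 le_trans not_less_eq_eq order_refl)
      qed
    qed
    then have span: "Span R us = carrier A" .
    show False
    proof (rule transcendental_of_trdeg_pos[OF assms(2,8)])
      fix a b assume ab: "a \<in> carrier A" "b \<in> carrier A" "b \<noteq> \<zero>"
        "\<And>k r. (\<And>i. r i \<in> R) \<Longrightarrow> (\<Oplus>i\<in>{..k::nat}. r i \<otimes> (a [^] i \<otimes> b [^] (k - i))) = \<zero> \<Longrightarrow> (\<forall>i\<le>k. r i = \<zero>)"
      \<comment> \<open>The exponents 0, ..., \<open>?k\<close> give one product more than there are
        generators.\<close>
      let ?k = "length us"
      have "\<exists>r. (\<forall>j. r j \<in> R) \<and> (\<exists>j\<in>{..?k}. r j \<noteq> \<zero>) \<and> (\<Oplus>j\<in>{..?k}. r j \<otimes> (a [^] j \<otimes> b [^] (?k - j))) = \<zero>"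
        by (rule N.linear_dependence[OF dom us(1)]) (use ab span in auto)
      then obtain r where r: "\<And>j. r j \<in> R" "\<exists>j\<in>{..?k}. r j \<noteq> \<zero>"
        "(\<Oplus>j\<in>{..?k}. r j \<otimes> (a [^] j \<otimes> b [^] (?k - j))) = \<zero>" by blast
      show False using ab(4)[OF r(1,3)] r(2) by blast
    qed
  qed
  ultimately show ?thesis by blast
qed

end
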